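(* Suppose $(G,P)$ is a quasi-lattice ordered group and $E$ is a product system over $P$. A representation $\phi:E\to\mathcal B(\mathcal H)$ is covariant if and only if, whenever $s,t\in P$, $S\in\mathcal K(E_s)$ and $T\in\mathcal K(E_t)$, we have $$\rho^\phi_s(S)\rho^\phi_t(T)=\begin{cases}\rho^\phi_{s\vee t}\bigl((S\otimes 1)(T\otimes 1)\bigr)&\text{if } s\vee t<\infty,\\ 0&\text{if } s\vee t=\infty.\end{cases}$$
   Context: Inner products are linear in the first variable; homomorphisms of $C^*$-algebras are $*$-homomorphisms. $P$ is a countable discrete semigroup with identity $e$. Product systems. A product system over $P$ is a family $p:E\to P$ of nontrivial separable complex Hilbert spaces $E_t:=p^{-1}(t)$ with an associative multiplication $E\times E\to E$ such that $p(xy)=p(x)p(y)$ and for all $s,t\in P$ the map $x\otimes y\in E_s\otimes E_t\mapsto xy\in E_{st}$ extends to a unitary isomorphism; also $\dim E_e=1$, so $E$ has an identity. For $S\in\mathcal B(E_s)$ and $s\le r$ (i.e. $s^{-1}r\in P$), $S\otimes 1$ denotes the operator on $E_{r}$ with $(S\otimes 1)(xy)=(Sx)y$ for $x\in E_s$, $y\in E_{s^{-1}r}$; in the claim $S\otimes 1$ and $T\otimes 1$ act on $E_{s\vee t}$. $\mathcal K(E_s)$ denotes the compact operators and, for $x,y\in E_s$, $x\otimes\overline y$ is the operator $z\mapsto\langle z,y\rangle x$. Representations. A representation of $E$ on a (separable) Hilbert space $\mathcal H$ is a map $\phi:E\to\mathcal B(\mathcal H)$ with (i) $\phi(xy)=\phi(x)\phi(y)$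 for all $x,y\in E$, and (ii) $\phi(y)^*\phi(x)=\langle x,y\rangle 1$ if $p(x)=p(y)$. For each $s\in P$ there is a unique homomorphism $\rho^\phi_s:\mathcal K(E_s)\to\mathcal B(\mathcal H)$ with $\rho^\phi_s(x\otimes\overline y)=\phi(x)\phi(y)^*$; it has a unique normal ($\sigma$-weakly continuous) extension to $\mathcal B(E_s)$, also denoted $\rho^\phi_s$. Orders. $(G,P)$ is quasi-lattice ordered if $P$ is a subsemigroup of the group $G$ with $P\cap P^{-1}=\{e\}$ and, for the left-invariant partial order $s\le t\iff s^{-1}t\in P$ on $G$, every finite subset of $G$ with an upper bound in $P$ has a least upper bound in $P$. For $s,t\in P$, $s\vee t$ is the least upper bound if a common upper bound exists (written $s\vee t<\infty$); otherwise $s\vee t=\infty$. Covariance. A representation $\phi$ of $E$ on $\mathcal H$ is covariant if, for all $s,t\in P$, $\rho^\phi_s(1)\rho^\phi_t(1)=\rho^\phi_{s\vee t}(1)$ when $s\vee t<\infty$ and $\rho^\phi_s(1)\rho^\phi_t(1)=0$ when $s\vee t=\infty$. *)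

theory Defs
  imports "HOL-Analysis.Analysis" "HOL-Algebra.Module"
begin

section \<open>Complex Hilbert spaces with explicit carriers\<close>

text \<open>
  The fibres of a product system vary with a group element and have varying dimensions, so Hilbert
  spaces are records with a carrier: a module over the field of complex numbers, together with an
  inner product that is linear in the first variable. (The ring multiplication and unit that the
  library's module record carries along are never used for Hilbert spaces.)
\<close>

definition complex_field :: "complex ring" where
  "complex_field = \<lparr>carrier = UNIV, mult = (*), one = 1, zero = 0, add = (+)\<rparr>"

record 'a inner_module = "(complex, 'a) module" +
  cinner :: "'a \<Rightarrow> 'a \<Rightarrow> complex" (\<open>\<langle>_,_\<rangle>\<index>\<close>)

definition hnorm :: "('a, 'm) inner_module_scheme \<Rightarrow> 'a \<Rightarrow> real" where
  "hnorm V x = sqrt (Re \<langle>x, x\<rangle>\<^bsub>V\<^esub>)"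

text \<open>
  The library's metric spaces require symmetry and nonnegativity also off the carrier, whence the
  case distinction.
\<close>

definition hdist :: "('a, 'm) inner_module_scheme \<Rightarrow> 'a \<Rightarrow> 'a \<Rightarrow> real" where
  "hdist V x y = (if x \<in> carrier V \<and> y \<in> carrier V then hnorm V (x \<ominus>\<^bsub>V\<^esub> y) else 0)"

definition htop :: "('a, 'm) inner_module_scheme \<Rightarrow> 'a topology" where
  "htop V = Metric_space.mtopology (carrier V) (hdist V)"

locale complex_hilbert_space = Module.module complex_field V
  for V :: "('a, 'm) inner_module_scheme" (structure) +
  assumes cinner_add_left:
      "\<lbrakk>x \<in> carrier V; y \<in> carrier V; z \<in> carrier V\<rbrakk> \<Longrightarrow> \<langle>x \<oplus> y, z\<rangle> = \<langle>x, z\<rangle> + \<langle>y, z\<rangle>"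
    and cinner_smult_left:
      "\<lbrakk>x \<in> carrier V; y \<in> carrier V\<rbrakk> \<Longrightarrow> \<langle>c \<odot> x, y\<rangle> = c * \<langle>x, y\<rangle>"
    and cinner_commute:
      "\<lbrakk>x \<in> carrier V; y \<in> carrier V\<rbrakk> \<Longrightarrow> \<langle>y, x\<rangle> = cnj \<langle>x, y\<rangle>"
    and cinner_nonneg: "x \<in> carrier V \<Longrightarrow> 0 \<le> Re \<langle>x, x\<rangle>"
    and cinner_definite: "\<lbrakk>x \<in> carrier V; \<langle>x, x\<rangle> = 0\<rbrakk> \<Longrightarrow> x = \<zero>"
    and complete: "Metric_space.mcomplete (carrier V) (hdist V)"

locale separable_hilbert_space = complex_hilbert_space +
  assumes separable: "separable_space (htop V)"

definition cspan :: "('a, 'm) inner_module_scheme \<Rightarrow> 'a set \<Rightarrow> 'a set" where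
  "cspan V A = \<Inter> {W. submodule W complex_field V \<and> A \<subseteq> W}"

text \<open>
  \<open>hilbert_tensor V W X \<tau>\<close>: the Hilbert space \<open>X\<close> with the bilinear map \<open>\<tau>\<close> is a Hilbert space
  tensor product of \<open>V\<close> and \<open>W\<close>, i.e. a completion of the algebraic tensor product for the inner
  product determined on elementary tensors by \<open>\<langle>x \<otimes> y, x' \<otimes> y'\<rangle> = \<langle>x, x'\<rangle>\<langle>y, y'\<rangle>\<close>. As such a
  completion is unique up to a unique unitary, this says exactly that \<open>x \<otimes> y \<mapsto> \<tau> x y\<close> extends to a
  unitary isomorphism of the tensor product of \<open>V\<close> and \<open>W\<close> onto \<open>X\<close>.
\<close>

definition hilbert_tensor ::
  "('a, 'm) inner_module_scheme \<Rightarrow> ('b, 'n) inner_module_scheme \<Rightarrow> ('c, 'o) inner_module_scheme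
    \<Rightarrow> ('a \<Rightarrow> 'b \<Rightarrow> 'c) \<Rightarrow> bool" where
  "hilbert_tensor V W X \<tau> \<longleftrightarrow>
     (\<forall>x\<in>carrier V. \<forall>y\<in>carrier W. \<tau> x y \<in> carrier X) \<and>
     (\<forall>x\<in>carrier V. \<forall>x'\<in>carrier V. \<forall>y\<in>carrier W. \<tau> (x \<oplus>\<^bsub>V\<^esub> x') y = \<tau> x y \<oplus>\<^bsub>X\<^esub> \<tau> x' y) \<and>
     (\<forall>x\<in>carrier V. \<forall>y\<in>carrier W. \<forall>y'\<in>carrier W. \<tau> x (y \<oplus>\<^bsub>W\<^esub> y') = \<tau> x y \<oplus>\<^bsub>X\<^esub> \<tau> x y') \<and>
     (\<forall>c. \<forall>x\<in>carrier V. \<forall>y\<in>carrier W.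
        \<tau> (c \<odot>\<^bsub>V\<^esub> x) y = c \<odot>\<^bsub>X\<^esub> \<tau> x y \<and> \<tau> x (c \<odot>\<^bsub>W\<^esub> y) = c \<odot>\<^bsub>X\<^esub> \<tau> x y) \<and>
     (\<forall>x\<in>carrier V. \<forall>x'\<in>carrier V. \<forall>y\<in>carrier W. \<forall>y'\<in>carrier W.
        \<langle>\<tau> x y, \<tau> x' y'\<rangle>\<^bsub>X\<^esub> = \<langle>x, x'\<rangle>\<^bsub>V\<^esub> * \<langle>y, y'\<rangle>\<^bsub>W\<^esub>) \<and>
     htop X closure_of cspan X {\<tau> x y | x y. x \<in> carrier V \<and> y \<in> carrier W} = carrier X"


section \<open>Bounded operators\<close>

text \<open>
  Operators are extensional functions on the carrier, so that equality of operators is equality of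
  functions; the product of \<open>S\<close> and \<open>T\<close> is \<open>compose (carrier V) S T\<close>.
\<close>

definition bounded_ops :: "('a, 'm) inner_module_scheme \<Rightarrow> ('a \<Rightarrow> 'a) set" where
  "bounded_ops V = {T \<in> carrier V \<rightarrow>\<^sub>E carrier V.
     (\<forall>x\<in>carrier V. \<forall>y\<in>carrier V. T (x \<oplus>\<^bsub>V\<^esub> y) = T x \<oplus>\<^bsub>V\<^esub> T y) \<and>
     (\<forall>c. \<forall>x\<in>carrier V. T (c \<odot>\<^bsub>V\<^esub> x) = c \<odot>\<^bsub>V\<^esub> T x) \<and>
     (\<exists>B. \<forall>x\<in>carrier V. hnorm V (T x) \<le> B * hnorm V x)}"

definition compact_ops :: "('a, 'm) inner_module_scheme \<Rightarrow> ('a \<Rightarrow> 'a) set" where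
  "compact_ops V = {T \<in> bounded_ops V.
     compactin (htop V) (htop V closure_of (T ` {x \<in> carrier V. hnorm V x \<le> 1}))}"

definition op_one :: "('a, 'm) inner_module_scheme \<Rightarrow> 'a \<Rightarrow> 'a" where
  "op_one V = (\<lambda>x\<in>carrier V. x)"

definition op_zero :: "('a, 'm) inner_module_scheme \<Rightarrow> 'a \<Rightarrow> 'a" where
  "op_zero V = (\<lambda>x\<in>carrier V. \<zero>\<^bsub>V\<^esub>)"

definition op_add :: "('a, 'm) inner_module_scheme \<Rightarrow> ('a \<Rightarrow> 'a) \<Rightarrow> ('a \<Rightarrow> 'a) \<Rightarrow> 'a \<Rightarrow> 'a" where
  "op_add V S T = (\<lambda>x\<in>carrier V. S x \<oplus>\<^bsub>V\<^esub> T x)"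

definition op_smult :: "('a, 'm) inner_module_scheme \<Rightarrow> complex \<Rightarrow> ('a \<Rightarrow> 'a) \<Rightarrow> 'a \<Rightarrow> 'a" where
  "op_smult V c T = (\<lambda>x\<in>carrier V. c \<odot>\<^bsub>V\<^esub> T x)"

abbreviation op_mult :: "('a, 'm) inner_module_scheme \<Rightarrow> ('a \<Rightarrow> 'a) \<Rightarrow> ('a \<Rightarrow> 'a) \<Rightarrow> 'a \<Rightarrow> 'a" where
  "op_mult V S T \<equiv> compose (carrier V) S T"

definition op_adj :: "('a, 'm) inner_module_scheme \<Rightarrow> ('a \<Rightarrow> 'a) \<Rightarrow> 'a \<Rightarrow> 'a" where
  "op_adj V T = (THE T'. T' \<in> bounded_ops V \<and>
     (\<forall>x\<in>carrier V. \<forall>y\<in>carrier V. \<langle>T x, y\<rangle>\<^bsub>V\<^esub> = \<langle>x, T' y\<rangle>\<^bsub>V\<^esub>))"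

text \<open>The rank-one operator usually written \<open>x \<otimes> y\<close> with a bar over \<open>y\<close>.\<close>

definition rank_one :: "('a, 'm) inner_module_scheme \<Rightarrow> 'a \<Rightarrow> 'a \<Rightarrow> 'a \<Rightarrow> 'a" where
  "rank_one V x y = (\<lambda>z\<in>carrier V. \<langle>z, y\<rangle>\<^bsub>V\<^esub> \<odot>\<^bsub>V\<^esub> x)"

text \<open>The \<open>\<sigma>\<close>-weak topology on the bounded operators: the coarsest one making all functionals
  \<open>T \<mapsto> \<Sum>n. \<langle>T \<xi>\<^sub>n, \<eta>\<^sub>n\<rangle>\<close> with square-summable \<open>\<xi>\<close>, \<open>\<eta>\<close> continuous.\<close>

definition square_summable :: "('a, 'm) inner_module_scheme \<Rightarrow> (nat \<Rightarrow> 'a) \<Rightarrow> bool" where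
  "square_summable V \<xi> \<longleftrightarrow> range \<xi> \<subseteq> carrier V \<and> summable (\<lambda>n. (hnorm V (\<xi> n))\<^sup>2)"

definition sigma_weak :: "('a, 'm) inner_module_scheme \<Rightarrow> ('a \<Rightarrow> 'a) topology" where
  "sigma_weak V = topology_generated_by
     {{T \<in> bounded_ops V. (\<Sum>n. \<langle>T (\<xi> n), \<eta> n\<rangle>\<^bsub>V\<^esub>) \<in> U} | \<xi> \<eta> U.
        square_summable V \<xi> \<and> square_summable V \<eta> \<and> open U}"

text \<open>\<open>star_hom V A H \<pi>\<close>: \<open>\<pi>\<close> is a (not necessarily unital) \<open>*\<close>-homomorphism from the \<open>*\<close>-algebra
  \<open>A\<close> of operators on \<open>V\<close> to the bounded operators on \<open>H\<close>.\<close>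

definition star_hom :: "('a, 'm) inner_module_scheme \<Rightarrow> ('a \<Rightarrow> 'a) set
    \<Rightarrow> ('h, 'n) inner_module_scheme \<Rightarrow> (('a \<Rightarrow> 'a) \<Rightarrow> 'h \<Rightarrow> 'h) \<Rightarrow> bool" where
  "star_hom V A H \<pi> \<longleftrightarrow>
     \<pi> \<in> A \<rightarrow>\<^sub>E bounded_ops H \<and>
     (\<forall>S\<in>A. \<forall>T\<in>A. \<pi> (op_add V S T) = op_add H (\<pi> S) (\<pi> T)) \<and>
     (\<forall>c. \<forall>T\<in>A. \<pi> (op_smult V c T) = op_smult H c (\<pi> T)) \<and>
     (\<forall>S\<in>A. \<forall>T\<in>A. \<pi> (op_mult V S T) = op_mult H (\<pi> S) (\<pi> T)) \<and>
     (\<forall>T\<in>A. \<pi> (op_adj V T) = op_adj H (\<pi> T))"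


section \<open>Quasi-lattice ordered groups\<close>

definition left_le :: "('g, 'k) monoid_scheme \<Rightarrow> 'g set \<Rightarrow> 'g \<Rightarrow> 'g \<Rightarrow> bool" where
  "left_le G P s t \<longleftrightarrow> inv\<^bsub>G\<^esub> s \<otimes>\<^bsub>G\<^esub> t \<in> P"

definition upper_bound :: "('g, 'k) monoid_scheme \<Rightarrow> 'g set \<Rightarrow> 'g set \<Rightarrow> 'g \<Rightarrow> bool" where
  "upper_bound G P A u \<longleftrightarrow> u \<in> P \<and> (\<forall>s\<in>A. left_le G P s u)"

definition least_upper_bound :: "('g, 'k) monoid_scheme \<Rightarrow> 'g set \<Rightarrow> 'g set \<Rightarrow> 'g \<Rightarrow> bool" where
  "least_upper_bound G P A r \<longleftrightarrow>
     upper_bound G P A r \<and> (\<forall>u. upper_bound G P A u \<longrightarrow> left_le G P r u)"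

locale quasi_lattice_ordered = group G for G (structure) +
  fixes P
  assumes P_subset: "P \<subseteq> carrier G"
    and P_closed: "\<lbrakk>s \<in> P; t \<in> P\<rbrakk> \<Longrightarrow> s \<otimes> t \<in> P"
    and P_inter_inv: "P \<inter> (\<lambda>s. inv s) ` P = {\<one>}"
    and ex_least_upper_bound:
      "\<lbrakk>finite A; A \<subseteq> carrier G; \<exists>u. upper_bound G P A u\<rbrakk> \<Longrightarrow> \<exists>r. least_upper_bound G P A r"

text \<open>\<open>None\<close> stands for the join \<open>\<infinity>\<close> of two elements without common upper bound.\<close>

definition join :: "('g, 'k) monoid_scheme \<Rightarrow> 'g set \<Rightarrow> 'g \<Rightarrow> 'g \<Rightarrow> 'g option" where
  "join G P s t =
     (if \<exists>u. upper_bound G P {s, t} u then Some (THE r. least_upper_bound G P {s, t} r) else None)"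


section \<open>Product systems and their representations\<close>

record ('g, 'e) prod_system =
  total :: "'e set"
  proj :: "'e \<Rightarrow> 'g"
  fibre :: "'g \<Rightarrow> 'e inner_module"
  pmult :: "'e \<Rightarrow> 'e \<Rightarrow> 'e" (infixl \<open>\<cdot>\<index>\<close> 70)

locale product_system =
  fixes G :: "('g, 'k) monoid_scheme" (structure) and P :: "'g set"
    and E :: "('g, 'e) prod_system"
  assumes proj_in: "x \<in> total E \<Longrightarrow> proj E x \<in> P"
    and carrier_fibre: "t \<in> P \<Longrightarrow> carrier (fibre E t) = {x \<in> total E. proj E x = t}"
    and fibre_hilbert: "t \<in> P \<Longrightarrow> separable_hilbert_space (fibre E t)"
    and fibre_nontrivial: "t \<in> P \<Longrightarrow> carrier (fibre E t) \<noteq> {\<zero>\<^bsub>fibre E t\<^esub>}"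
    and pmult_closed: "\<lbrakk>x \<in> total E; y \<in> total E\<rbrakk> \<Longrightarrow> x \<cdot>\<^bsub>E\<^esub> y \<in> total E"
    and pmult_assoc:
      "\<lbrakk>x \<in> total E; y \<in> total E; z \<in> total E\<rbrakk> \<Longrightarrow> (x \<cdot>\<^bsub>E\<^esub> y) \<cdot>\<^bsub>E\<^esub> z = x \<cdot>\<^bsub>E\<^esub> (y \<cdot>\<^bsub>E\<^esub> z)"
    and proj_pmult:
      "\<lbrakk>x \<in> total E; y \<in> total E\<rbrakk> \<Longrightarrow> proj E (x \<cdot>\<^bsub>E\<^esub> y) = proj E x \<otimes> proj E y"
    and pmult_unitary:
      "\<lbrakk>s \<in> P; t \<in> P\<rbrakk> \<Longrightarrow> hilbert_tensor (fibre E s) (fibre E t) (fibre E (s \<otimes> t)) (pmult E)"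
    and fibre_one_dim:
      "\<exists>u\<in>carrier (fibre E \<one>). u \<noteq> \<zero>\<^bsub>fibre E \<one>\<^esub> \<and>
         carrier (fibre E \<one>) = {c \<odot>\<^bsub>fibre E \<one>\<^esub> u | c. True}"

text \<open>\<open>amplify G E s r S\<close> is the operator \<open>S \<otimes> 1\<close> on the fibre over \<open>r\<close>, for \<open>s \<le> r\<close>.\<close>

definition amplify :: "('g, 'k) monoid_scheme \<Rightarrow> ('g, 'e) prod_system \<Rightarrow> 'g \<Rightarrow> 'g
    \<Rightarrow> ('e \<Rightarrow> 'e) \<Rightarrow> 'e \<Rightarrow> 'e" where
  "amplify G E s r S = (THE T. T \<in> bounded_ops (fibre E r) \<and>
     (\<forall>x\<in>carrier (fibre E s). \<forall>y\<in>carrier (fibre E (inv\<^bsub>G\<^esub> s \<otimes>\<^bsub>G\<^esub> r)).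
        T (x \<cdot>\<^bsub>E\<^esub> y) = S x \<cdot>\<^bsub>E\<^esub> y))"

definition representation ::
  "('g, 'e) prod_system \<Rightarrow> ('h, 'n) inner_module_scheme \<Rightarrow> ('e \<Rightarrow> 'h \<Rightarrow> 'h) \<Rightarrow> bool" where
  "representation E H \<phi> \<longleftrightarrow>
     (\<forall>x\<in>total E. \<phi> x \<in> bounded_ops H) \<and>
     (\<forall>x\<in>total E. \<forall>y\<in>total E. \<phi> (x \<cdot>\<^bsub>E\<^esub> y) = op_mult H (\<phi> x) (\<phi> y)) \<and>
     (\<forall>x\<in>total E. \<forall>y\<in>total E. proj E x = proj E y \<longrightarrow>
        op_mult H (op_adj H (\<phi> y)) (\<phi> x) =
          op_smult H (\<langle>x, y\<rangle>\<^bsub>fibre E (proj E x)\<^esub>) (op_one H))"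

definition is_compact_rho :: "('g, 'e) prod_system \<Rightarrow> ('h, 'n) inner_module_scheme
    \<Rightarrow> ('e \<Rightarrow> 'h \<Rightarrow> 'h) \<Rightarrow> 'g \<Rightarrow> (('e \<Rightarrow> 'e) \<Rightarrow> 'h \<Rightarrow> 'h) \<Rightarrow> bool" where
  "is_compact_rho E H \<phi> s \<pi> \<longleftrightarrow>
     star_hom (fibre E s) (compact_ops (fibre E s)) H \<pi> \<and>
     (\<forall>x\<in>carrier (fibre E s). \<forall>y\<in>carrier (fibre E s).
        \<pi> (rank_one (fibre E s) x y) = op_mult H (\<phi> x) (op_adj H (\<phi> y)))"

text \<open>
  The normal homomorphism on all bounded operators whose restriction to the compact operators is
  the homomorphism determined by \<open>\<phi>\<close>; that restriction is itself what \<open>\<rho>\<close> denotes on compact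
  operators.
\<close>

definition rho :: "('g, 'e) prod_system \<Rightarrow> ('h, 'n) inner_module_scheme
    \<Rightarrow> ('e \<Rightarrow> 'h \<Rightarrow> 'h) \<Rightarrow> 'g \<Rightarrow> ('e \<Rightarrow> 'e) \<Rightarrow> 'h \<Rightarrow> 'h" where
  "rho E H \<phi> s = (THE \<pi>.
     star_hom (fibre E s) (bounded_ops (fibre E s)) H \<pi> \<and>
     continuous_map (sigma_weak (fibre E s)) (sigma_weak H) \<pi> \<and>
     is_compact_rho E H \<phi> s (restrict \<pi> (compact_ops (fibre E s))))"

definition covariant :: "('g, 'k) monoid_scheme \<Rightarrow> 'g set \<Rightarrow> ('g, 'e) prod_system
    \<Rightarrow> ('h, 'n) inner_module_scheme \<Rightarrow> ('e \<Rightarrow> 'h \<Rightarrow> 'h) \<Rightarrow> bool" where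
  "covariant G P E H \<phi> \<longleftrightarrow>
     (\<forall>s\<in>P. \<forall>t\<in>P.
        op_mult H (rho E H \<phi> s (op_one (fibre E s))) (rho E H \<phi> t (op_one (fibre E t))) =
          (case join G P s t of
             Some r \<Rightarrow> rho E H \<phi> r (op_one (fibre E r))
           | None \<Rightarrow> op_zero H))"

end

theory Submission
  imports Defs
begin

text \<open>
  Both \<open>\<rho>\<^sub>s\<close> and the amplification \<open>S \<mapsto> S \<otimes> 1\<close> are instances of one construction. Let
  \<open>\<tau> : V \<times> W \<rightarrow> X\<close> preserve inner products, \<open>\<langle>\<tau> x w, \<tau> x' w'\<rangle> = \<langle>x, x'\<rangle>\<langle>w, w'\<rangle>\<close>, and let \<open>R\<^sub>j\<close> be the
  adjoint of \<open>x \<mapsto> \<tau> x f\<^sub>j\<close> for an orthonormal basis \<open>f\<close> of \<open>W\<close>. Then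
  \<open>\<langle>A(S) \<xi>, \<eta>\<rangle> = \<Sum>\<^sub>j \<langle>S R\<^sub>j \<xi>, R\<^sub>j \<eta>\<rangle>\<close> defines a normal \<open>*\<close>-homomorphism \<open>A\<close> with
  \<open>A(S) (\<tau> x w) = \<tau> (S x) w\<close> that vanishes on the complement of the elementary tensors. For
  \<open>\<tau> x h = \<phi>(x) h\<close> it is \<open>\<rho>\<^sub>s\<close>, for the multiplication \<open>E\<^sub>s \<times> E\<^bsub>s\<inverse>r\<^esub> \<rightarrow> E\<^sub>r\<close> it is \<open>S \<mapsto> S \<otimes> 1\<close>.

  For \<open>s \<le> r\<close> one has \<open>\<rho>\<^sub>s(S) \<rho>\<^sub>r(1) = \<rho>\<^sub>r(S \<otimes> 1) = \<rho>\<^sub>r(1) \<rho>\<^sub>s(S)\<close>. Hence with \<open>Z = \<rho>\<^sub>r(1)\<close>, \<open>r = s \<or> t\<close>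
  (or \<open>Z = 0\<close> if there is no upper bound), the right-hand side of the product formula is
  \<open>\<rho>\<^sub>s(S) Z \<rho>\<^sub>t(T)\<close>. Covariance says \<open>\<rho>\<^sub>s(1) \<rho>\<^sub>t(1) = Z\<close>, which gives the formula on multiplying by
  \<open>\<rho>\<^sub>s(S)\<close> and \<open>\<rho>\<^sub>t(T)\<close>; conversely, rank-one \<open>S\<close> and \<open>T\<close> suffice to recover
  \<open>\<rho>\<^sub>s(1) \<rho>\<^sub>t(1) = \<rho>\<^sub>s(1) Z \<rho>\<^sub>t(1) = Z\<close>.
\<close>

section \<open>Hilbert space geometry\<close>

lemma complex_field_simps [simp]:
  "carrier complex_field = UNIV" "\<zero>\<^bsub>complex_field\<^esub> = 0" "\<one>\<^bsub>complex_field\<^esub> = 1"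
  "x \<oplus>\<^bsub>complex_field\<^esub> y = x + y" "x \<otimes>\<^bsub>complex_field\<^esub> y = x * y"
  by (simp_all add: complex_field_def)

section \<open>Inner product and norm identities\<close>

context complex_hilbert_space
begin

lemma smult_in [simp, intro]: "x \<in> carrier V \<Longrightarrow> c \<odot> x \<in> carrier V"
  by (rule smult_closed) auto

lemma cinner_add_right:
  assumes "x \<in> carrier V" "y \<in> carrier V" "z \<in> carrier V"
  shows "\<langle>z, x \<oplus> y\<rangle> = \<langle>z, x\<rangle> + \<langle>z, y\<rangle>"
  using assms cinner_add_left[of x y z] cinner_commute[of _ z]
  by (metis M.a_closed complex_cnj_add)

lemma cinner_smult_right:
  assumes "x \<in> carrier V" "y \<in> carrier V"
  shows "\<langle>x, c \<odot> y\<rangle> = cnj c * \<langle>x, y\<rangle>"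
  using assms cinner_smult_left[of y x c] cinner_commute[of _ x]
  by (metis smult_in complex_cnj_mult)

lemma cinner_zero_left: "x \<in> carrier V \<Longrightarrow> \<langle>\<zero>, x\<rangle> = 0"
  using cinner_add_left[of \<zero> \<zero> x] by simp

lemma cinner_zero_right: "x \<in> carrier V \<Longrightarrow> \<langle>x, \<zero>\<rangle> = 0"
  using cinner_add_right[of \<zero> \<zero> x] by simp

lemma minus_add_cancel: "\<lbrakk>x \<in> carrier V; y \<in> carrier V\<rbrakk> \<Longrightarrow> (x \<ominus> y) \<oplus> y = x"
  by (simp add: a_minus_def M.a_assoc M.l_neg)

lemma minus_eq_zero_iff: "\<lbrakk>x \<in> carrier V; y \<in> carrier V\<rbrakk> \<Longrightarrow> x \<ominus> y = \<zero> \<longleftrightarrow> x = y"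
  using minus_add_cancel[of x y] by (auto simp: a_minus_def M.r_neg)

lemma cinner_minus_left:
  assumes "x \<in> carrier V" "y \<in> carrier V" "z \<in> carrier V"
  shows "\<langle>x \<ominus> y, z\<rangle> = \<langle>x, z\<rangle> - \<langle>y, z\<rangle>"
proof -
  have "(x \<ominus> y) \<oplus> y = x"
    using assms by (simp add: minus_add_cancel)
  then show ?thesis
    using assms cinner_add_left[of "x \<ominus> y" y z] by (simp add: eq_diff_eq)
qed

lemma cinner_minus_right:
  assumes "x \<in> carrier V" "y \<in> carrier V" "z \<in> carrier V"
  shows "\<langle>z, x \<ominus> y\<rangle> = \<langle>z, x\<rangle> - \<langle>z, y\<rangle>"
  using assms cinner_minus_left[of x y z] cinner_commute[of _ z]
  by (metis M.minus_closed complex_cnj_diff)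

lemmas cinner_simps = cinner_add_left cinner_add_right cinner_smult_left cinner_smult_right
  cinner_zero_left cinner_zero_right cinner_minus_left cinner_minus_right

text \<open>Used throughout to prove vector identities: testing against every \<open>z\<close> turns
  module equations into complex arithmetic by \<open>cinner_simps\<close>. Definiteness is applied
  to the difference.\<close>

lemma cinner_ext:
  assumes "x \<in> carrier V" "y \<in> carrier V" "\<And>z. z \<in> carrier V \<Longrightarrow> \<langle>x, z\<rangle> = \<langle>y, z\<rangle>"
  shows "x = y"
proof -
  have "\<langle>x \<ominus> y, x \<ominus> y\<rangle> = 0"
    using assms by (simp add: cinner_simps)
  then have "x \<ominus> y = \<zero>"
    using assms by (intro cinner_definite) auto
  then show ?thesis
    using assms(1,2) by (simp add: minus_eq_zero_iff)
qed

lemma cinner_ext_right: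
  assumes "x \<in> carrier V" "y \<in> carrier V" "\<And>z. z \<in> carrier V \<Longrightarrow> \<langle>z, x\<rangle> = \<langle>z, y\<rangle>"
  shows "x = y"
  using assms cinner_commute by (intro cinner_ext) metis+

lemma hnorm_nonneg [simp]: "x \<in> carrier V \<Longrightarrow> 0 \<le> hnorm V x"
  by (simp add: hnorm_def cinner_nonneg)

lemma cinner_self: "x \<in> carrier V \<Longrightarrow> \<langle>x, x\<rangle> = complex_of_real ((hnorm V x)\<^sup>2)"
  using cinner_commute[of x x] cinner_nonneg[of x]
  by (simp add: hnorm_def complex_eq_iff)

lemma hnorm_zero [simp]: "hnorm V \<zero> = 0"
  by (simp add: hnorm_def cinner_zero_left)

lemma hnorm_eq_zero: "x \<in> carrier V \<Longrightarrow> hnorm V x = 0 \<longleftrightarrow> x = \<zero>"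
  using cinner_definite cinner_self by force

lemma hnorm_smult: "x \<in> carrier V \<Longrightarrow> hnorm V (c \<odot> x) = cmod c * hnorm V x"
proof -
  assume x: "x \<in> carrier V"
  have "\<langle>c \<odot> x, c \<odot> x\<rangle> = complex_of_real ((cmod c * hnorm V x)\<^sup>2)"
    using x complex_norm_square[of c] cinner_self[OF x]
    by (simp add: cinner_simps power_mult_distrib mult_ac)
  then show ?thesis
    using x by (simp add: hnorm_def[of V "c \<odot> x"])
qed

lemma cauchy_schwarz:
  assumes x: "x \<in> carrier V" and y: "y \<in> carrier V"
  shows "cmod \<langle>x, y\<rangle> \<le> hnorm V x * hnorm V y"
proof (cases "y = \<zero>")
  case False
  let ?a = "(hnorm V x)\<^sup>2" and ?b = "(hnorm V y)\<^sup>2" and ?c = "\<langle>x, y\<rangle>"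
  \<comment> \<open>The component of \<open>x\<close> orthogonal to \<open>y\<close>, scaled by
    \<open>?b\<close> to avoid division; its squared norm is nonnegative.\<close>
  let ?z = "(of_real ?b \<odot> x) \<ominus> (?c \<odot> y)"
  have b: "?b > 0"
    using False hnorm_eq_zero[OF y] by simp
  have "\<langle>?z, ?z\<rangle> = of_real ?b * (of_real ?b * of_real ?a - ?c * cnj ?c)"
    using x y by (simp add: cinner_simps cinner_commute[OF x y] cinner_self[OF x] cinner_self[OF y]
        right_diff_distrib mult_ac)
  also have "\<dots> = of_real (?b * (?b * ?a - (cmod ?c)\<^sup>2))"
    by (simp only: complex_norm_square of_real_mult of_real_diff)
  finally have "Re \<langle>?z, ?z\<rangle> = ?b * (?b * ?a - (cmod ?c)\<^sup>2)"
    by (simp only: Re_complex_of_real)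
  then have "0 \<le> ?b * (?b * ?a - (cmod ?c)\<^sup>2)"
    using cinner_nonneg[of ?z] x y by (simp only: M.minus_closed smult_in)
  then have "(cmod ?c)\<^sup>2 \<le> (hnorm V x * hnorm V y)\<^sup>2"
    using b by (simp add: zero_le_mult_iff power_mult_distrib mult.commute)
  then show ?thesis
    by (rule power2_le_imp_le) (use x y in simp)
qed (use x in \<open>simp add: cinner_zero_right\<close>)

lemma hnorm_triangle:
  assumes x: "x \<in> carrier V" and y: "y \<in> carrier V"
  shows "hnorm V (x \<oplus> y) \<le> hnorm V x + hnorm V y"
proof -
  have "complex_of_real ((hnorm V (x \<oplus> y))\<^sup>2)
      = of_real ((hnorm V x)\<^sup>2 + (hnorm V y)\<^sup>2) + (\<langle>x, y\<rangle> + cnj \<langle>x, y\<rangle>)"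
    using x y cinner_commute[OF x y] cinner_self[of "x \<oplus> y", symmetric]
      cinner_self[OF x] cinner_self[OF y]
    by (simp add: cinner_simps)
  then have "(hnorm V (x \<oplus> y))\<^sup>2 = (hnorm V x)\<^sup>2 + (hnorm V y)\<^sup>2 + 2 * Re \<langle>x, y\<rangle>"
    by (simp add: complex_eq_iff)
  also have "\<dots> \<le> (hnorm V x + hnorm V y)\<^sup>2"
    using cauchy_schwarz[OF x y] complex_Re_le_cmod[of "\<langle>x, y\<rangle>"] by (simp add: power2_sum)
  finally show ?thesis
    by (rule power2_le_imp_le) (use x y in simp)
qed

lemma hnorm_minus_commute:
  assumes "x \<in> carrier V" "y \<in> carrier V"
  shows "hnorm V (x \<ominus> y) = hnorm V (y \<ominus> x)"
  using assms by (simp add: hnorm_def cinner_simps)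

section \<open>The norm metric, completeness and density\<close>

lemma Metric_space_hdist: "Metric_space (carrier V) (hdist V)"
proof
  fix x y z
  show "0 \<le> hdist V x y" "hdist V x y = hdist V y x"
    by (auto simp: hdist_def hnorm_minus_commute)
  assume x: "x \<in> carrier V" and y: "y \<in> carrier V"
  then show "hdist V x y = 0 \<longleftrightarrow> x = y"
    by (auto simp: hdist_def hnorm_eq_zero minus_eq_zero_iff)
  assume z: "z \<in> carrier V"
  have "x \<ominus> z = (x \<ominus> y) \<oplus> (y \<ominus> z)"
    using x y z by (intro cinner_ext) (simp_all add: cinner_simps)
  then show "hdist V x z \<le> hdist V x y + hdist V y z"
    using x y z hnorm_triangle[of "x \<ominus> y" "y \<ominus> z"] by (simp add: hdist_def)
qed

sublocale metric: Metric_space "carrier V" "hdist V"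
  by (rule Metric_space_hdist)

lemma topspace_htop [simp]: "topspace (htop V) = carrier V"
  by (simp add: htop_def)

lemma Cauchy_imp_limit:
  assumes "\<And>n. f n \<in> carrier V"
    and "\<And>\<epsilon>. \<epsilon> > 0 \<Longrightarrow> \<exists>N. \<forall>m\<ge>N. \<forall>n\<ge>N. hnorm V (f m \<ominus> f n) < \<epsilon>"
  obtains v where "v \<in> carrier V" "(\<lambda>n. hnorm V (f n \<ominus> v)) \<longlonglongrightarrow> 0"
proof -
  have "metric.MCauchy f"
    unfolding metric.MCauchy_def using assms by (auto simp: hdist_def)
  then obtain v where "limitin metric.mtopology f v sequentially"
    using complete metric.mcomplete_def by blast
  then have "v \<in> carrier V" "(\<lambda>n. hdist V (f n) v) \<longlonglongrightarrow> 0"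
    by (auto simp: metric.limitin_metric_dist_null)
  then show ?thesis
    using that assms(1) by (simp add: hdist_def)
qed

lemma cinner_tendsto:
  assumes f: "\<And>n. f n \<in> carrier V" and v: "v \<in> carrier V"
    and lim: "(\<lambda>n. hnorm V (f n \<ominus> v)) \<longlonglongrightarrow> 0" and z: "z \<in> carrier V"
  shows "(\<lambda>n. \<langle>f n, z\<rangle>) \<longlonglongrightarrow> \<langle>v, z\<rangle>"
proof -
  have "norm (\<langle>f n, z\<rangle> - \<langle>v, z\<rangle>) \<le> hnorm V (f n \<ominus> v) * hnorm V z" for n
    using cauchy_schwarz[of "f n \<ominus> v" z] f v z by (simp add: cinner_simps)
  moreover have "(\<lambda>n. hnorm V (f n \<ominus> v) * hnorm V z) \<longlonglongrightarrow> 0"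
    using tendsto_mult[OF lim tendsto_const] by simp
  ultimately have "(\<lambda>n. \<langle>f n, z\<rangle> - \<langle>v, z\<rangle>) \<longlonglongrightarrow> 0"
    by (rule Lim_null_comparison[OF always_eventually[OF allI]])
  then show ?thesis
    by (rule LIM_zero_cancel)
qed

text \<open>The vectors orthogonal to \<open>y\<close> form a submodule containing \<open>A\<close>,
  hence the span. Density puts such a vector within every \<epsilon> of \<open>y\<close>, which
  bounds \<open>(hnorm V y)\<^sup>2\<close> by \<open>\<epsilon> * hnorm V y\<close>.\<close>

lemma orthogonal_total:
  assumes cl: "htop V closure_of cspan V A = carrier V" and A: "A \<subseteq> carrier V"
    and y: "y \<in> carrier V" and orth: "\<And>x. x \<in> A \<Longrightarrow> \<langle>x, y\<rangle> = 0"
  shows "y = \<zero>"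
proof -
  let ?W = "{x \<in> carrier V. \<langle>x, y\<rangle> = 0}"
  \<comment> \<open>The inner product rules treat binary differences, so the additive inverse is
    rewritten as one.\<close>
  have neg: "\<ominus> x = \<zero> \<ominus> x" if "x \<in> carrier V" for x
    using that by (simp add: a_minus_def)
  have "submodule ?W complex_field V"
  proof
    show "?W \<subseteq> carrier (add_monoid V)" "\<one>\<^bsub>add_monoid V\<^esub> \<in> ?W"
      using y by (auto simp: cinner_simps)
    fix x x' assume "x \<in> ?W" "x' \<in> ?W"
    then show "x \<otimes>\<^bsub>add_monoid V\<^esub> x' \<in> ?W"
      using y by (auto simp: cinner_simps)
  next
    fix x assume "x \<in> ?W"
    then show "inv\<^bsub>add_monoid V\<^esub> x \<in> ?W"
      using y neg[of x] by (auto simp: cinner_simps simp flip: a_inv_def)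
  qed (use y in \<open>auto simp: cinner_simps\<close>)
  then have span: "cspan V A \<subseteq> ?W"
    using A orth by (auto simp: cspan_def)
  have "(hnorm V y)\<^sup>2 \<le> \<epsilon> * hnorm V y" if "\<epsilon> > 0" for \<epsilon>
  proof -
    have "y \<in> metric.mtopology closure_of cspan V A"
      using cl y by (simp add: htop_def)
    then obtain x where x: "x \<in> cspan V A" "x \<in> metric.mball y \<epsilon>"
      using \<open>\<epsilon> > 0\<close> by (auto simp: metric.metric_closure_of)
    then have xV: "x \<in> carrier V" "\<langle>x, y\<rangle> = 0" "hnorm V (y \<ominus> x) < \<epsilon>"
      using span by (auto simp: hdist_def metric.in_mball)
    have "(hnorm V y)\<^sup>2 = cmod \<langle>y \<ominus> x, y\<rangle>"
      using xV y by (simp add: cinner_simps cinner_self norm_power)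
    also have "\<dots> \<le> hnorm V (y \<ominus> x) * hnorm V y"
      using xV y by (intro cauchy_schwarz) auto
    also have "\<dots> \<le> \<epsilon> * hnorm V y"
      using xV y by (intro mult_right_mono) auto
    finally show ?thesis .
  qed
  \<comment> \<open>For this \<epsilon> the bound says that the squared norm is at most half of
    itself.\<close>
  from this[of "hnorm V y / 2"] have "\<not> hnorm V y > 0"
    by (auto simp: power2_eq_square)
  then show ?thesis
    using y hnorm_nonneg[OF y] by (simp add: hnorm_eq_zero[symmetric])
qed

end

section \<open>Orthogonal frames and the Riesz representation\<close>

primrec lincomb ::
  "('a, 'm) inner_module_scheme \<Rightarrow> (nat \<Rightarrow> complex) \<Rightarrow> (nat \<Rightarrow> 'a) \<Rightarrow> nat \<Rightarrow> 'a" where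
  "lincomb V c e 0 = \<zero>\<^bsub>V\<^esub>"
| "lincomb V c e (Suc n) = lincomb V c e n \<oplus>\<^bsub>V\<^esub> c n \<odot>\<^bsub>V\<^esub> e n"

definition normalize_vec :: "('a, 'm) inner_module_scheme \<Rightarrow> 'a \<Rightarrow> 'a" where
  "normalize_vec V u = complex_of_real (1 / hnorm V u) \<odot>\<^bsub>V\<^esub> u"

text \<open>The projections onto the spans of the initial segments of a sequence; linear dependence in the
  sequence only produces zero vectors in \<open>gram_schmidt\<close>, because \<open>normalize_vec V \<zero> = \<zero>\<close>.\<close>

primrec gs_proj :: "('a, 'm) inner_module_scheme \<Rightarrow> (nat \<Rightarrow> 'a) \<Rightarrow> nat \<Rightarrow> 'a \<Rightarrow> 'a" where
  "gs_proj V d 0 = (\<lambda>x. \<zero>\<^bsub>V\<^esub>)"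
| "gs_proj V d (Suc n) =
     (let u = normalize_vec V (d n \<ominus>\<^bsub>V\<^esub> gs_proj V d n (d n))
      in (\<lambda>x. gs_proj V d n x \<oplus>\<^bsub>V\<^esub> \<langle>x, u\<rangle>\<^bsub>V\<^esub> \<odot>\<^bsub>V\<^esub> u))"

definition gram_schmidt :: "('a, 'm) inner_module_scheme \<Rightarrow> (nat \<Rightarrow> 'a) \<Rightarrow> nat \<Rightarrow> 'a" where
  "gram_schmidt V d n = normalize_vec V (d n \<ominus>\<^bsub>V\<^esub> gs_proj V d n (d n))"

text \<open>An orthonormal basis padded with zero vectors: orthogonality and the Parseval clause
  together force each norm to be 0 or 1. Finite and infinite dimension thus share the index type
  \<open>nat\<close>.\<close>

definition orthogonal_frame :: "('a, 'm) inner_module_scheme \<Rightarrow> (nat \<Rightarrow> 'a) \<Rightarrow> bool" where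
  "orthogonal_frame V e \<longleftrightarrow> range e \<subseteq> carrier V \<and> (\<forall>i j. i \<noteq> j \<longrightarrow> \<langle>e i, e j\<rangle>\<^bsub>V\<^esub> = 0) \<and>
     (\<forall>x\<in>carrier V. \<forall>y\<in>carrier V. (\<lambda>i. \<langle>x, e i\<rangle>\<^bsub>V\<^esub> * \<langle>e i, y\<rangle>\<^bsub>V\<^esub>) sums \<langle>x, y\<rangle>\<^bsub>V\<^esub>)"

definition hconv :: "('a, 'm) inner_module_scheme \<Rightarrow> (nat \<Rightarrow> 'a) \<Rightarrow> 'a \<Rightarrow> bool" where
  "hconv V f v \<longleftrightarrow> (\<forall>n. f n \<in> carrier V) \<and> v \<in> carrier V \<and> (\<lambda>n. hnorm V (f n \<ominus>\<^bsub>V\<^esub> v)) \<longlonglongrightarrow> 0"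

section \<open>Finite combinations, normalization and norm convergence\<close>

context complex_hilbert_space
begin

lemma minus_zero_right: "x \<in> carrier V \<Longrightarrow> x \<ominus> \<zero> = x"
  by (rule cinner_ext) (auto simp: cinner_simps)

lemma lincomb_closed [simp]:
  "(\<And>i. e i \<in> carrier V) \<Longrightarrow> lincomb V c e n \<in> carrier V"
  by (induction n) auto

lemma cinner_lincomb:
  "\<lbrakk>\<And>i. e i \<in> carrier V; y \<in> carrier V\<rbrakk> \<Longrightarrow> \<langle>lincomb V c e n, y\<rangle> = (\<Sum>i<n. c i * \<langle>e i, y\<rangle>)"
  by (induction n) (auto simp: cinner_simps)

lemma normalize_vec_closed [simp]: "u \<in> carrier V \<Longrightarrow> normalize_vec V u \<in> carrier V"
  by (simp add: normalize_vec_def)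

lemma normalize_vec_self:
  assumes u: "u \<in> carrier V"
  shows "complex_of_real (hnorm V u) \<odot> normalize_vec V u = u"
proof (cases "hnorm V u = 0")
  case True
  then have "u = \<zero>"
    using u hnorm_eq_zero by blast
  then show ?thesis
    using True by (intro cinner_ext) (auto simp: normalize_vec_def cinner_simps)
next
  case False
  then show ?thesis
    using u by (intro cinner_ext) (auto simp: normalize_vec_def cinner_simps)
qed

text \<open>A normalized vector has norm 1 or is zero; this form of the norm condition covers both
  cases.\<close>

lemma cinner_normalize_vec:
  assumes u: "u \<in> carrier V" and y: "y \<in> carrier V"
  shows "\<langle>normalize_vec V u, normalize_vec V u\<rangle> * \<langle>normalize_vec V u, y\<rangle> = \<langle>normalize_vec V u, y\<rangle>"
proof (cases "hnorm V u = 0")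
  case True
  then show ?thesis
    using u y by (simp add: normalize_vec_def cinner_simps)
next
  case False
  then have "\<langle>normalize_vec V u, normalize_vec V u\<rangle> = 1"
    using u by (simp add: normalize_vec_def cinner_simps cinner_self[OF u] power2_eq_square)
  then show ?thesis
    by simp
qed

lemma hconv_cinner: "\<lbrakk>hconv V f v; z \<in> carrier V\<rbrakk> \<Longrightarrow> (\<lambda>n. \<langle>f n, z\<rangle>) \<longlonglongrightarrow> \<langle>v, z\<rangle>"
  by (auto simp: hconv_def intro: cinner_tendsto)

lemma hconv_bound:
  assumes "\<And>n. f n \<in> carrier V" "v \<in> carrier V" "g \<longlonglongrightarrow> 0" "\<And>n. hnorm V (f n \<ominus> v) \<le> g n"
  shows "hconv V f v"
proof -
  have "(\<lambda>n. hnorm V (f n \<ominus> v)) \<longlonglongrightarrow> 0"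
    by (rule Lim_null_comparison[OF always_eventually[OF allI] assms(3)]) (use assms in simp)
  then show ?thesis
    using assms by (simp add: hconv_def)
qed

lemma hconv_subseq: "\<lbrakk>hconv V f v; strict_mono r\<rbrakk> \<Longrightarrow> hconv V (\<lambda>n. f (r n)) v"
  unfolding hconv_def using LIMSEQ_subseq_LIMSEQ[of "\<lambda>n. hnorm V (f n \<ominus> v)"] by (auto simp: o_def)

lemma hconv_add:
  assumes "hconv V f v" "hconv V g w"
  shows "hconv V (\<lambda>n. f n \<oplus> g n) (v \<oplus> w)"
proof (rule hconv_bound)
  show "(\<lambda>n. hnorm V (f n \<ominus> v) + hnorm V (g n \<ominus> w)) \<longlonglongrightarrow> 0"
    using tendsto_add[of "\<lambda>n. hnorm V (f n \<ominus> v)" 0 sequentially "\<lambda>n. hnorm V (g n \<ominus> w)" 0] assms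
    by (simp add: hconv_def)
  fix n
  have [simp]: "f n \<in> carrier V" "g n \<in> carrier V" "v \<in> carrier V" "w \<in> carrier V"
    using assms by (auto simp: hconv_def)
  have "(f n \<oplus> g n) \<ominus> (v \<oplus> w) = (f n \<ominus> v) \<oplus> (g n \<ominus> w)"
    by (rule cinner_ext) (auto simp: cinner_simps)
  then show "hnorm V ((f n \<oplus> g n) \<ominus> (v \<oplus> w)) \<le> hnorm V (f n \<ominus> v) + hnorm V (g n \<ominus> w)"
    by (simp add: hnorm_triangle)
qed (use assms in \<open>auto simp: hconv_def\<close>)

lemma hconv_Cauchy:
  assumes f: "hconv V f v" and \<epsilon>: "\<epsilon> > 0"
  shows "\<exists>N. \<forall>m\<ge>N. \<forall>n\<ge>N. hnorm V (f m \<ominus> f n) < \<epsilon>"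
proof -
  have [simp]: "f n \<in> carrier V" "v \<in> carrier V" for n
    using f by (auto simp: hconv_def)
  have "(\<lambda>n. hnorm V (f n \<ominus> v)) \<longlonglongrightarrow> 0"
    using f by (simp add: hconv_def)
  then have "\<forall>\<^sub>F n in sequentially. hnorm V (f n \<ominus> v) < \<epsilon> / 2"
    using \<epsilon> by (intro order_tendstoD(2)[where y = 0]) auto
  then obtain N where N: "\<And>n. n \<ge> N \<Longrightarrow> hnorm V (f n \<ominus> v) < \<epsilon> / 2"
    by (auto simp: eventually_sequentially)
  have "hnorm V (f m \<ominus> f n) < \<epsilon>" if "m \<ge> N" "n \<ge> N" for m n
  proof -
    have "f m \<ominus> f n = (f m \<ominus> v) \<oplus> (v \<ominus> f n)"
      by (rule cinner_ext) (auto simp: cinner_simps)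
    then have "hnorm V (f m \<ominus> f n) \<le> hnorm V (f m \<ominus> v) + hnorm V (v \<ominus> f n)"
      using hnorm_triangle[of "f m \<ominus> v" "v \<ominus> f n"] by simp
    then show ?thesis
      using N[OF that(1)] N[OF that(2)] by (simp add: hnorm_minus_commute[of v])
  qed
  then show ?thesis
    by blast
qed

lemma Cauchy_imp_hconv:
  assumes "\<And>n. f n \<in> carrier V"
    and "\<And>\<epsilon>. \<epsilon> > 0 \<Longrightarrow> \<exists>N. \<forall>m\<ge>N. \<forall>n\<ge>N. hnorm V (f m \<ominus> f n) < \<epsilon>"
  obtains v where "hconv V f v"
  using Cauchy_imp_limit[OF assms] assms(1) by (auto simp: hconv_def)

section \<open>Gram-Schmidt orthogonalization of a sequence\<close>

context
  fixes d :: "nat \<Rightarrow> 'a"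
  assumes d: "\<And>n. d n \<in> carrier V"
begin

private abbreviation e where "e \<equiv> gram_schmidt V d"

private lemma gs_proj_closed: "gs_proj V d n x \<in> carrier V" if "x \<in> carrier V"
  using that d by (induction n arbitrary: x) (auto simp: Let_def)

lemma gram_schmidt_closed [simp]: "e n \<in> carrier V"
  using d gs_proj_closed by (simp add: gram_schmidt_def)

private lemma gs_proj_eq: "gs_proj V d n x = lincomb V (\<lambda>i. \<langle>x, e i\<rangle>) e n"
  by (induction n) (auto simp: gram_schmidt_def Let_def)

private lemma cinner_gs_proj:
  "y \<in> carrier V \<Longrightarrow> \<langle>gs_proj V d n x, y\<rangle> = (\<Sum>i<n. \<langle>x, e i\<rangle> * \<langle>e i, y\<rangle>)"
  by (simp add: gs_proj_eq cinner_lincomb)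

private lemma e_self: "y \<in> carrier V \<Longrightarrow> \<langle>e i, e i\<rangle> * \<langle>e i, y\<rangle> = \<langle>e i, y\<rangle>"
  using d gs_proj_closed by (simp add: gram_schmidt_def cinner_normalize_vec)

private lemma e_self': "y \<in> carrier V \<Longrightarrow> \<langle>y, e i\<rangle> * \<langle>e i, e i\<rangle> = \<langle>y, e i\<rangle>"
  using e_self[of y i] cinner_commute[of "e i" y] cinner_commute[of "e i" "e i"]
  by (metis complex_cnj_mult gram_schmidt_closed mult.commute)

private lemma scale_e: "complex_of_real (hnorm V (d n \<ominus> gs_proj V d n (d n))) \<odot> e n
    = d n \<ominus> gs_proj V d n (d n)"
  using d gs_proj_closed by (simp add: gram_schmidt_def normalize_vec_self)

text \<open>By strong induction the earlier vectors are mutually orthogonal, so the projection of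
  \<open>d n\<close> has the same inner product with \<open>e i\<close> as \<open>d n\<close>
  itself, and the residual is orthogonal to \<open>e i\<close>.\<close>

lemma gram_schmidt_orth: "i < n \<Longrightarrow> \<langle>e i, e n\<rangle> = 0"
proof (induction n arbitrary: i rule: less_induct)
  case (less n)
  let ?u = "d n \<ominus> gs_proj V d n (d n)"
  have [simp]: "?u \<in> carrier V" "gs_proj V d n (d n) \<in> carrier V"
    using d gs_proj_closed by auto
  have *: "\<langle>e j, e i\<rangle> = 0" if "j < n" "j \<noteq> i" for j
    using less that cinner_commute[of "e i" "e j"] by (cases "j < i") auto
  have "\<langle>gs_proj V d n (d n), e i\<rangle> = (\<Sum>j<n. \<langle>d n, e j\<rangle> * \<langle>e j, e i\<rangle>)"
    by (simp add: cinner_gs_proj)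
  also have "\<dots> = (\<Sum>j<n. if j = i then \<langle>d n, e i\<rangle> else 0)"
    by (rule sum.cong) (auto simp: * e_self' d)
  also have "\<dots> = \<langle>d n, e i\<rangle>"
    using less.prems by simp
  finally have "\<langle>?u, e i\<rangle> = 0"
    using d by (simp add: cinner_simps)
  then have "\<langle>e n, e i\<rangle> = 0"
    by (simp add: gram_schmidt_def[of _ _ n] normalize_vec_def cinner_smult_left)
  then show ?case
    using cinner_commute[of "e n" "e i"] by simp
qed

private lemma e_orth: "i \<noteq> j \<Longrightarrow> \<langle>e i, e j\<rangle> = 0"
  using gram_schmidt_orth[of i j] gram_schmidt_orth[of j i] cinner_commute[of "e j" "e i"]
  by (cases "i < j") auto

text \<open>By \<open>scale_e\<close>, \<open>d k\<close> is a combination of \<open>e 0\<close> to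
  \<open>e k\<close>, so its coefficients beyond \<open>k\<close> vanish and the sum up to
  \<open>n\<close> already stops at \<open>k\<close>.\<close>

private lemma gs_proj_d:
  assumes "k < n"
  shows "gs_proj V d n (d k) = d k"
proof (rule cinner_ext)
  fix y assume y: "y \<in> carrier V"
  let ?h = "complex_of_real (hnorm V (d k \<ominus> gs_proj V d k (d k)))"
  have eq: "d k = ?h \<odot> e k \<oplus> gs_proj V d k (d k)"
    using d gs_proj_closed by (simp only: scale_e minus_add_cancel)
  have dk: "\<langle>d k, z\<rangle> = ?h * \<langle>e k, z\<rangle> + (\<Sum>i<k. \<langle>d k, e i\<rangle> * \<langle>e i, z\<rangle>)" if "z \<in> carrier V" for z
    by (subst eq) (use that d gs_proj_closed in \<open>simp add: cinner_add_left cinner_smult_left cinner_gs_proj\<close>)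
  have "(\<Sum>i<k. \<langle>d k, e i\<rangle> * \<langle>e i, e j\<rangle>) = 0" if "k \<le> j" for j
    using that by (intro sum.neutral) (auto simp: e_orth)
  then have ek: "\<langle>d k, e j\<rangle> = ?h * \<langle>e k, e j\<rangle>" if "k \<le> j" for j
    using dk[of "e j"] that by simp
  have "(\<Sum>i<n. \<langle>d k, e i\<rangle> * \<langle>e i, y\<rangle>) = (\<Sum>i<Suc k. \<langle>d k, e i\<rangle> * \<langle>e i, y\<rangle>)"
    using assms ek e_orth by (intro sum.mono_neutral_right) auto
  also have "\<dots> = \<langle>d k, y\<rangle>"
    using dk[OF y] ek[of k] e_self[OF y, of k] by (simp add: mult.assoc)
  finally show "\<langle>gs_proj V d n (d k), y\<rangle> = \<langle>d k, y\<rangle>"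
    using y by (simp add: cinner_gs_proj)
qed (use d gs_proj_closed in auto)

text \<open>The residual is orthogonal to the projection, so its squared norm is its inner product
  with \<open>x\<close>; Cauchy-Schwarz and cancellation finish.\<close>

private lemma hnorm_gs_residual:
  assumes x: "x \<in> carrier V"
  shows "hnorm V (x \<ominus> gs_proj V d n x) \<le> hnorm V x"
proof -
  let ?p = "gs_proj V d n x" and ?r = "x \<ominus> gs_proj V d n x"
  have [simp]: "?p \<in> carrier V" "?r \<in> carrier V"
    using x gs_proj_closed by auto
  have "\<langle>e i, ?r\<rangle> = 0" if "i < n" for i
  proof -
    have "\<langle>?p, e i\<rangle> = (\<Sum>j<n. if j = i then \<langle>x, e i\<rangle> else 0)"
      unfolding cinner_gs_proj[OF gram_schmidt_closed]
      by (rule sum.cong) (auto simp: e_orth e_self' x)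
    then have "\<langle>?r, e i\<rangle> = 0"
      using that x by (simp add: cinner_simps)
    then show ?thesis
      using cinner_commute[of ?r "e i"] by simp
  qed
  then have "\<langle>?p, ?r\<rangle> = 0"
    by (simp add: cinner_gs_proj)
  then have "(hnorm V ?r)\<^sup>2 = cmod \<langle>x, ?r\<rangle>"
    using cinner_self[of ?r] cinner_minus_left[of x ?p ?r] x by (simp add: norm_power)
  also have "\<dots> \<le> hnorm V x * hnorm V ?r"
    using x by (simp add: cauchy_schwarz)
  finally have "hnorm V ?r * hnorm V ?r \<le> hnorm V x * hnorm V ?r"
    by (simp add: power2_eq_square)
  then show ?thesis
    using x by (cases "hnorm V ?r = 0") (auto simp: mult_le_cancel_right dest: hnorm_nonneg)
qed

text \<open>Approximate \<open>x\<close> by some \<open>d k\<close>. For \<open>n > k\<close> the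
  projection fixes \<open>d k\<close>, so the error of the partial sum is the residual of the small
  vector \<open>x \<ominus> d k\<close> paired with \<open>y\<close>.\<close>

lemma orthogonal_frame_gram_schmidt:
  assumes dense: "\<And>x \<epsilon>. \<lbrakk>x \<in> carrier V; \<epsilon> > 0\<rbrakk> \<Longrightarrow> \<exists>k. hnorm V (x \<ominus> d k) < \<epsilon>"
  shows "orthogonal_frame V e"
  unfolding orthogonal_frame_def
proof (intro conjI ballI allI impI)
  fix x y assume x: "x \<in> carrier V" and y: "y \<in> carrier V"
  show "(\<lambda>i. \<langle>x, e i\<rangle> * \<langle>e i, y\<rangle>) sums \<langle>x, y\<rangle>"
    unfolding sums_def LIMSEQ_iff
  proof (intro allI impI)
    fix \<epsilon> :: real assume "\<epsilon> > 0"
    \<comment> \<open>The added 1 keeps the denominator positive when \<open>y\<close> is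
      zero.\<close>
    then have "\<epsilon> / (hnorm V y + 1) > 0"
      using y by (simp add: add_nonneg_pos)
    then obtain k where k: "hnorm V (x \<ominus> d k) < \<epsilon> / (hnorm V y + 1)"
      using dense x by blast
    have "norm ((\<Sum>i<n. \<langle>x, e i\<rangle> * \<langle>e i, y\<rangle>) - \<langle>x, y\<rangle>) < \<epsilon>" if n: "n \<ge> Suc k" for n
    proof -
      let ?w = "x \<ominus> d k"
      let ?r = "?w \<ominus> gs_proj V d n ?w"
      have [simp]: "?w \<in> carrier V" "?r \<in> carrier V" "gs_proj V d n ?w \<in> carrier V"
        using x d gs_proj_closed by auto
      have "\<langle>gs_proj V d n (d k), y\<rangle> = \<langle>d k, y\<rangle>"
        using gs_proj_d n by simp
      then have "\<langle>?r, y\<rangle> = \<langle>x, y\<rangle> - (\<Sum>i<n. \<langle>x, e i\<rangle> * \<langle>e i, y\<rangle>)"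
        using x y d by (simp add: cinner_gs_proj cinner_simps algebra_simps sum_subtractf)
      then have "norm ((\<Sum>i<n. \<langle>x, e i\<rangle> * \<langle>e i, y\<rangle>) - \<langle>x, y\<rangle>) = cmod \<langle>?r, y\<rangle>"
        by (simp add: norm_minus_commute)
      also have "\<dots> \<le> hnorm V ?r * hnorm V y"
        using y by (simp add: cauchy_schwarz)
      also have "\<dots> \<le> hnorm V ?w * (hnorm V y + 1)"
        using y hnorm_gs_residual[of ?w n] by (intro mult_mono) auto
      also have "\<dots> < \<epsilon>"
        using k y by (simp add: pos_less_divide_eq add_nonneg_pos)
      finally show ?thesis .
    qed
    then show "\<exists>N. \<forall>n\<ge>N. norm ((\<Sum>i<n. \<langle>x, e i\<rangle> * \<langle>e i, y\<rangle>) - \<langle>x, y\<rangle>) < \<epsilon>"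
      by blast
  qed
qed (auto simp: e_orth)

end

end

text \<open>Gram-Schmidt is run on an enumeration of a countable dense set. Repetitions in the
  enumeration are harmless, since dependent vectors become zero.\<close>

lemma (in separable_hilbert_space) ex_orthogonal_frame: "\<exists>e. orthogonal_frame V e"
proof -
  obtain C where C: "countable C" "C \<subseteq> carrier V" "htop V closure_of C = carrier V"
    using separable by (auto simp: separable_space_def)
  have ex: "\<exists>y\<in>C. hnorm V (x \<ominus> y) < \<epsilon>" if "x \<in> carrier V" "\<epsilon> > 0" for x \<epsilon>
  proof -
    have "x \<in> metric.mtopology closure_of C"
      using C that by (simp add: htop_def)
    then show ?thesis
      using that by (force simp: metric.metric_closure_of metric.in_mball hdist_def)
  qed
  \<comment> \<open>Approximating the zero vector yields an element; \<open>from_nat_into\<close>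
    enumerates only nonempty sets.\<close>
  then have "C \<noteq> {}"
    using ex[of \<zero> 1] by force
  define d where "d = from_nat_into C"
  have ran: "range d = C"
    unfolding d_def by (rule range_from_nat_into[OF \<open>C \<noteq> {}\<close> C(1)])
  have "orthogonal_frame V (gram_schmidt V d)"
  proof (rule orthogonal_frame_gram_schmidt)
    show "d n \<in> carrier V" for n
      using ran C(2) by blast
    show "\<exists>k. hnorm V (x \<ominus> d k) < \<epsilon>" if "x \<in> carrier V" "\<epsilon> > 0" for x \<epsilon>
      using ex[OF that] ran by (metis imageE)
  qed
  then show ?thesis
    by (intro exI[of "orthogonal_frame V" "gram_schmidt V d"])
qed

section \<open>Parseval, Bessel and Riesz-Fischer for orthogonal frames\<close>

context complex_hilbert_space
begin

lemma orthogonal_frame_closed [simp]: "orthogonal_frame V e \<Longrightarrow> e i \<in> carrier V"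
  by (auto simp: orthogonal_frame_def)

lemma orthogonal_frame_sums:
  "\<lbrakk>orthogonal_frame V e; x \<in> carrier V; y \<in> carrier V\<rbrakk>
    \<Longrightarrow> (\<lambda>i. \<langle>x, e i\<rangle> * \<langle>e i, y\<rangle>) sums \<langle>x, y\<rangle>"
  by (auto simp: orthogonal_frame_def)

lemma orthogonal_frame_orth: "\<lbrakk>orthogonal_frame V e; i \<noteq> j\<rbrakk> \<Longrightarrow> \<langle>e i, e j\<rangle> = 0"
  by (auto simp: orthogonal_frame_def)

lemma parseval_identity:
  assumes e: "orthogonal_frame V e" and x: "x \<in> carrier V"
  shows "(\<lambda>i. (cmod \<langle>x, e i\<rangle>)\<^sup>2) sums (hnorm V x)\<^sup>2"
proof -
  have "\<langle>x, e i\<rangle> * \<langle>e i, x\<rangle> = complex_of_real ((cmod \<langle>x, e i\<rangle>)\<^sup>2)" for i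
    using e x cinner_commute[of x "e i"] by (simp only: complex_norm_square orthogonal_frame_closed)
  then show ?thesis
    using orthogonal_frame_sums[OF e x x] by (simp only: cinner_self[OF x] sums_of_real_iff)
qed

lemma bessel_inequality:
  assumes e: "orthogonal_frame V e" and x: "x \<in> carrier V" and F: "finite F"
  shows "(\<Sum>i\<in>F. (cmod \<langle>x, e i\<rangle>)\<^sup>2) \<le> (hnorm V x)\<^sup>2"
  using parseval_identity[OF e x] sum_le_suminf[of "\<lambda>i. (cmod \<langle>x, e i\<rangle>)\<^sup>2" F] F
  by (simp add: sums_iff)

text \<open>Cauchy-Schwarz for finite sums, with Bessel's inequality bounding the factor that
  depends on \<open>x\<close>.\<close>

lemma frame_sum_bound:
  assumes e: "orthogonal_frame V e" and x: "x \<in> carrier V" and F: "finite F"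
  shows "cmod (\<Sum>i\<in>F. a i * \<langle>e i, x\<rangle>) \<le> sqrt (\<Sum>i\<in>F. (cmod (a i))\<^sup>2) * hnorm V x"
proof -
  have "cmod \<langle>e i, x\<rangle> = cmod \<langle>x, e i\<rangle>" for i
    using e x cinner_commute[of x "e i"] by simp
  then have "cmod (\<Sum>i\<in>F. a i * \<langle>e i, x\<rangle>) \<le> (\<Sum>i\<in>F. \<bar>cmod (a i)\<bar> * \<bar>cmod \<langle>x, e i\<rangle>\<bar>)"
    using norm_sum[of "\<lambda>i. a i * \<langle>e i, x\<rangle>" F] by (simp add: norm_mult)
  also have "\<dots> \<le> L2_set (\<lambda>i. cmod (a i)) F * L2_set (\<lambda>i. cmod \<langle>x, e i\<rangle>) F"
    by (rule L2_set_mult_ineq)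
  also have "\<dots> \<le> sqrt (\<Sum>i\<in>F. (cmod (a i))\<^sup>2) * hnorm V x"
    unfolding L2_set_def using bessel_inequality[OF e x F] x
    by (intro mult_left_mono real_le_lsqrt) (auto intro: sum_nonneg)
  finally show ?thesis .
qed

text \<open>Pairing the difference with itself and applying \<open>frame_sum_bound\<close> bounds
  its squared norm by the root times its norm; one factor cancels.\<close>

lemma hnorm_lincomb_diff:
  assumes e: "orthogonal_frame V e" and "n \<le> m"
  shows "hnorm V (lincomb V c e m \<ominus> lincomb V c e n) \<le> sqrt (\<Sum>i\<in>{n..<m}. (cmod (c i))\<^sup>2)"
proof -
  let ?u = "lincomb V c e m \<ominus> lincomb V c e n"
  have u [simp]: "?u \<in> carrier V"
    using e by simp
  have "\<langle>?u, ?u\<rangle> = (\<Sum>i\<in>{n..<m}. c i * \<langle>e i, ?u\<rangle>)"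
    using e assms(2) cinner_minus_left[of "lincomb V c e m" "lincomb V c e n" ?u]
    by (simp add: cinner_lincomb lessThan_atLeast0 sum_diff_nat_ivl)
  moreover have "cmod \<langle>?u, ?u\<rangle> = (hnorm V ?u)\<^sup>2"
    unfolding cinner_self[OF u] by (simp add: norm_power)
  ultimately have "(hnorm V ?u)\<^sup>2 \<le> sqrt (\<Sum>i\<in>{n..<m}. (cmod (c i))\<^sup>2) * hnorm V ?u"
    using frame_sum_bound[OF e u, of "{n..<m}" c] by simp
  then show ?thesis
    using hnorm_nonneg[OF u]
    by (cases "hnorm V ?u = 0") (auto simp: power2_eq_square mult_le_cancel_right intro: sum_nonneg)
qed

text \<open>Riesz-Fischer: the tails of the coefficient series control the distances of partial
  sums, and completeness supplies the limit.\<close>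

lemma hconv_lincomb:
  assumes e: "orthogonal_frame V e" and c: "summable (\<lambda>i. (cmod (c i))\<^sup>2)"
  obtains v where "hconv V (lincomb V c e) v"
proof (rule Cauchy_imp_hconv)
  fix \<epsilon> :: real assume \<epsilon>: "\<epsilon> > 0"
  then have "\<epsilon>\<^sup>2 > 0"
    by simp
  then obtain N where N: "\<And>m n. m \<ge> N \<Longrightarrow> norm (\<Sum>i\<in>{m..<n}. (cmod (c i))\<^sup>2) < \<epsilon>\<^sup>2"
    using c unfolding summable_Cauchy by meson
  have *: "hnorm V (lincomb V c e m \<ominus> lincomb V c e n) < \<epsilon>" if "n \<ge> N" "n \<le> m" for m n
  proof -
    have "(\<Sum>i\<in>{n..<m}. (cmod (c i))\<^sup>2) < \<epsilon>\<^sup>2"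
      using N[OF that(1), of m] by simp
    then show ?thesis
      using \<epsilon> hnorm_lincomb_diff[OF e that(2), of c]
      by (meson le_less_trans real_less_lsqrt sum_nonneg zero_le_power2 order_less_imp_le)
  qed
  have "hnorm V (lincomb V c e m \<ominus> lincomb V c e n) < \<epsilon>" if "m \<ge> N" "n \<ge> N" for m n
    using that *[of n m] *[of m n] e hnorm_minus_commute[of "lincomb V c e m" "lincomb V c e n"]
    by (cases "n \<le> m") auto
  then show "\<exists>N. \<forall>m\<ge>N. \<forall>n\<ge>N. hnorm V (lincomb V c e m \<ominus> lincomb V c e n) < \<epsilon>"
    by blast
qed (use e that in auto)

end

section \<open>The Riesz representation theorem\<close>

context separable_hilbert_space
begin

text \<open>The representing vector is the frame series with coefficients
  \<open>cnj (f (e i))\<close>. Evaluating \<open>f\<close> on the partial sums of this very series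
  shows that the coefficients are square-summable.\<close>

lemma riesz_representation:
  assumes add: "\<And>x y. \<lbrakk>x \<in> carrier V; y \<in> carrier V\<rbrakk> \<Longrightarrow> f (x \<oplus> y) = f x + f y"
    and smult: "\<And>c x. x \<in> carrier V \<Longrightarrow> f (c \<odot> x) = c * f x"
    and bound: "\<And>x. x \<in> carrier V \<Longrightarrow> cmod (f x) \<le> B * hnorm V x"
  obtains y where "y \<in> carrier V" "\<And>x. x \<in> carrier V \<Longrightarrow> f x = \<langle>x, y\<rangle>"
proof -
  obtain e where e: "orthogonal_frame V e"
    using ex_orthogonal_frame ..
  have zero: "f \<zero> = 0"
    using add[of \<zero> \<zero>] by simp
  have f_lincomb: "f (lincomb V c e n) = (\<Sum>i<n. c i * f (e i))" for c n
    using e by (induction n) (simp_all add: zero add smult)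
  have diff: "f (x \<ominus> y) = f x - f y" if "x \<in> carrier V" "y \<in> carrier V" for x y
    using add[of "x \<ominus> y" y] that by (simp add: minus_add_cancel)
  let ?c = "\<lambda>i. cnj (f (e i))"
  have "(\<Sum>i<n. (cmod (?c i))\<^sup>2) \<le> B\<^sup>2" for n
  proof -
    let ?s = "\<Sum>i<n. (cmod (?c i))\<^sup>2"
    have s0: "0 \<le> ?s"
      by (rule sum_nonneg) simp
    have "f (lincomb V ?c e n) = (\<Sum>i<n. of_real ((cmod (f (e i)))\<^sup>2))"
      unfolding f_lincomb complex_norm_square by (simp only: mult.commute)
    also have "\<dots> = of_real ?s"
      by simp
    finally have "?s = cmod (f (lincomb V ?c e n))"
      using s0 by (simp only: norm_of_real abs_of_nonneg)
    also have "\<dots> \<le> B * hnorm V (lincomb V ?c e n)"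
      using e by (intro bound) simp
    \<comment> \<open>The hypotheses do not fix the sign of \<open>B\<close>, whence the absolute
      value.\<close>
    also have "\<dots> \<le> \<bar>B\<bar> * sqrt ?s"
    proof -
      have "hnorm V (lincomb V ?c e n) \<le> sqrt ?s"
        using hnorm_lincomb_diff[OF e, of 0 n ?c] e
        by (simp add: lessThan_atLeast0 minus_zero_right)
      then show ?thesis
        using e by (intro mult_mono) auto
    qed
    finally have *: "sqrt ?s * sqrt ?s \<le> \<bar>B\<bar> * sqrt ?s"
      using s0 by simp
    have "sqrt ?s \<le> \<bar>B\<bar>"
    proof (cases "sqrt ?s = 0")
      case False
      then have "sqrt ?s > 0"
        using real_sqrt_ge_zero[OF s0] by linarith
      then show ?thesis
        by (rule mult_right_le_imp_le[OF *])
    qed simp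
    then show ?thesis
      using sqrt_le_D[of ?s "\<bar>B\<bar>"] by (simp only: power2_abs)
  qed
  then have "summable (\<lambda>i. (cmod (?c i))\<^sup>2)"
    by (rule summableI_nonneg_bounded[rotated]) (rule zero_le_power2)
  then obtain y where y: "hconv V (lincomb V ?c e) y"
    by (rule hconv_lincomb[OF e])
  have yV: "y \<in> carrier V"
    using y by (simp add: hconv_def)
  have "f x = \<langle>x, y\<rangle>" if x: "x \<in> carrier V" for x
  proof -
    let ?a = "\<lambda>i. \<langle>x, e i\<rangle>"
    have "summable (\<lambda>i. (cmod (?a i))\<^sup>2)"
      using parseval_identity[OF e x] by (simp add: sums_iff)
    then obtain x' where x': "hconv V (lincomb V ?a e) x'"
      by (rule hconv_lincomb[OF e])
    have x'V: "x' \<in> carrier V"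
      using x' by (simp add: hconv_def)
    have "x' = x"
    proof (rule cinner_ext[OF x'V x])
      fix z assume z: "z \<in> carrier V"
      have "(\<lambda>n. \<langle>lincomb V ?a e n, z\<rangle>) \<longlonglongrightarrow> \<langle>x, z\<rangle>"
        using orthogonal_frame_sums[OF e x z] e z by (simp add: cinner_lincomb sums_def)
      then show "\<langle>x', z\<rangle> = \<langle>x, z\<rangle>"
        using hconv_cinner[OF x' z] LIMSEQ_unique by blast
    qed
    have lim0: "(\<lambda>n. B * hnorm V (lincomb V ?a e n \<ominus> x)) \<longlonglongrightarrow> 0"
      using x' \<open>x' = x\<close> tendsto_mult[of "\<lambda>_. B" B sequentially _ 0] by (simp add: hconv_def)
    have "norm (f (lincomb V ?a e n) - f x) \<le> B * hnorm V (lincomb V ?a e n \<ominus> x)" for n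
      using bound[of "lincomb V ?a e n \<ominus> x"] e x by (simp add: diff)
    then have "(\<lambda>n. f (lincomb V ?a e n) - f x) \<longlonglongrightarrow> 0"
      by (rule Lim_null_comparison[OF always_eventually[OF allI] lim0])
    then have "(\<lambda>n. f (lincomb V ?a e n)) \<longlonglongrightarrow> f x"
      by (rule LIM_zero_cancel)
    \<comment> \<open>The same finite sum is read in two ways, as \<open>f\<close> on partial sums
      for \<open>x\<close> and as the conjugate pairing of partial sums for \<open>y\<close> with
      \<open>x\<close>; comparing the limits gives the claim.\<close>
    moreover have "f (lincomb V ?a e n) = cnj \<langle>lincomb V ?c e n, x\<rangle>" for n
      using e x cinner_commute[of "e _" x] by (simp add: f_lincomb cinner_lincomb mult.commute)
    moreover have "(\<lambda>n. cnj \<langle>lincomb V ?c e n, x\<rangle>) \<longlonglongrightarrow> cnj \<langle>y, x\<rangle>"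
      by (intro tendsto_cnj hconv_cinner[OF y x])
    ultimately have "f x = cnj \<langle>y, x\<rangle>"
      using LIMSEQ_unique by force
    then show ?thesis
      using cinner_commute[OF yV x] by simp
  qed
  then show ?thesis
    using yV that by blast
qed

end

section \<open>Bounded and compact operators\<close>

context complex_hilbert_space
begin

lemma norm_cinner_self: "x \<in> carrier V \<Longrightarrow> cmod \<langle>x, x\<rangle> = (hnorm V x)\<^sup>2"
  by (simp only: cinner_self norm_of_real abs_power2)

lemma bounded_ops_closed [simp]: "\<lbrakk>T \<in> bounded_ops V; x \<in> carrier V\<rbrakk> \<Longrightarrow> T x \<in> carrier V"
  by (auto simp: bounded_ops_def)

lemma bounded_ops_extensional: "T \<in> bounded_ops V \<Longrightarrow> T \<in> extensional (carrier V)"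
  unfolding bounded_ops_def PiE_def by blast

lemma bounded_ops_add:
  "\<lbrakk>T \<in> bounded_ops V; x \<in> carrier V; y \<in> carrier V\<rbrakk> \<Longrightarrow> T (x \<oplus> y) = T x \<oplus> T y"
  by (auto simp: bounded_ops_def)

lemma bounded_ops_smult:
  "\<lbrakk>T \<in> bounded_ops V; x \<in> carrier V\<rbrakk> \<Longrightarrow> T (c \<odot> x) = c \<odot> T x"
  by (auto simp: bounded_ops_def)

lemma bounded_ops_diff:
  assumes "T \<in> bounded_ops V" "x \<in> carrier V" "y \<in> carrier V"
  shows "T (x \<ominus> y) = T x \<ominus> T y"
proof (rule cinner_ext)
  fix z assume z: "z \<in> carrier V"
  have "T x = T (x \<ominus> y) \<oplus> T y"
    using assms bounded_ops_add[of T "x \<ominus> y" y] by (simp add: minus_add_cancel)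
  then have "\<langle>T x, z\<rangle> = \<langle>T (x \<ominus> y), z\<rangle> + \<langle>T y, z\<rangle>"
    using assms z by (simp add: cinner_simps)
  then show "\<langle>T (x \<ominus> y), z\<rangle> = \<langle>T x \<ominus> T y, z\<rangle>"
    using assms z by (simp add: cinner_simps)
qed (use assms in auto)

text \<open>The definition does not ask for a nonnegative constant; the absolute value of any bound
  is one.\<close>

lemma bounded_ops_bound:
  assumes T: "T \<in> bounded_ops V"
  obtains B where "B \<ge> 0" "\<And>x. x \<in> carrier V \<Longrightarrow> hnorm V (T x) \<le> B * hnorm V x"
proof -
  obtain B where B: "\<And>x. x \<in> carrier V \<Longrightarrow> hnorm V (T x) \<le> B * hnorm V x"
    using T unfolding bounded_ops_def by blast
  have "hnorm V (T x) \<le> \<bar>B\<bar> * hnorm V x" if x: "x \<in> carrier V" for x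
    using order_trans[OF B[OF x] mult_right_mono[OF abs_ge_self hnorm_nonneg[OF x]]] .
  then show ?thesis
    using that[of "\<bar>B\<bar>"] by simp
qed

lemma bounded_opsI:
  assumes "T \<in> extensional (carrier V)" "\<And>x. x \<in> carrier V \<Longrightarrow> T x \<in> carrier V"
    "\<And>x y. \<lbrakk>x \<in> carrier V; y \<in> carrier V\<rbrakk> \<Longrightarrow> T (x \<oplus> y) = T x \<oplus> T y"
    "\<And>c x. x \<in> carrier V \<Longrightarrow> T (c \<odot> x) = c \<odot> T x"
    "\<And>x. x \<in> carrier V \<Longrightarrow> hnorm V (T x) \<le> B * hnorm V x"
  shows "T \<in> bounded_ops V"
  using assms unfolding bounded_ops_def by (auto simp: PiE_def intro!: exI[of _ B])

lemma op_ext: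
  assumes "S \<in> bounded_ops V" "T \<in> bounded_ops V" "\<And>x. x \<in> carrier V \<Longrightarrow> S x = T x"
  shows "S = T"
  using bounded_ops_extensional[OF assms(1)] bounded_ops_extensional[OF assms(2)] assms(3)
  by (rule extensionalityI)

lemma op_cinner_ext:
  assumes "S \<in> bounded_ops V" "T \<in> bounded_ops V"
    "\<And>x y. \<lbrakk>x \<in> carrier V; y \<in> carrier V\<rbrakk> \<Longrightarrow> \<langle>S x, y\<rangle> = \<langle>T x, y\<rangle>"
  shows "S = T"
  using assms by (intro op_ext cinner_ext) auto

lemma hconv_op:
  assumes T: "T \<in> bounded_ops V" and f: "hconv V f v"
  shows "hconv V (\<lambda>n. T (f n)) (T v)"
proof -
  obtain B where B: "\<And>x. x \<in> carrier V \<Longrightarrow> hnorm V (T x) \<le> B * hnorm V x"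
    using bounded_ops_bound[OF T] by metis
  have [simp]: "f n \<in> carrier V" "v \<in> carrier V" for n
    using f by (auto simp: hconv_def)
  show ?thesis
  proof (rule hconv_bound)
    show "(\<lambda>n. B * hnorm V (f n \<ominus> v)) \<longlonglongrightarrow> 0"
      using f tendsto_mult[of "\<lambda>_. B" B sequentially _ 0] by (simp add: hconv_def)
    show "hnorm V (T (f n) \<ominus> T v) \<le> B * hnorm V (f n \<ominus> v)" for n
      using B[of "f n \<ominus> v"] T by (simp add: bounded_ops_diff)
  qed (use T in auto)
qed

lemma op_one_bounded [simp]: "op_one V \<in> bounded_ops V"
  by (rule bounded_opsI[where B = 1]) (auto simp: op_one_def)

lemma op_zero_bounded [simp]: "op_zero V \<in> bounded_ops V"
  by (rule bounded_opsI[where B = 0]) (auto simp: op_zero_def intro!: cinner_ext simp: cinner_simps)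

lemma op_add_bounded [simp]:
  assumes S: "S \<in> bounded_ops V" and T: "T \<in> bounded_ops V"
  shows "op_add V S T \<in> bounded_ops V"
proof -
  obtain A where A: "\<And>x. x \<in> carrier V \<Longrightarrow> hnorm V (S x) \<le> A * hnorm V x"
    using bounded_ops_bound[OF S] by metis
  obtain B where B: "\<And>x. x \<in> carrier V \<Longrightarrow> hnorm V (T x) \<le> B * hnorm V x"
    using bounded_ops_bound[OF T] by metis
  show ?thesis
  proof (rule bounded_opsI[where B = "A + B"])
    fix x assume x: "x \<in> carrier V"
    show "hnorm V (op_add V S T x) \<le> (A + B) * hnorm V x"
      using A[OF x] B[OF x] hnorm_triangle[of "S x" "T x"] S T x
      by (simp add: op_add_def distrib_right)
  qed (use S T in \<open>auto simp: op_add_def bounded_ops_add bounded_ops_smult cinner_simps intro!: cinner_ext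
        simp: algebra_simps\<close>)
qed

lemma op_smult_bounded [simp]:
  assumes T: "T \<in> bounded_ops V"
  shows "op_smult V c T \<in> bounded_ops V"
proof -
  obtain B where B: "\<And>x. x \<in> carrier V \<Longrightarrow> hnorm V (T x) \<le> B * hnorm V x"
    using bounded_ops_bound[OF T] by metis
  show ?thesis
  proof (rule bounded_opsI[where B = "cmod c * B"])
    fix x assume x: "x \<in> carrier V"
    show "hnorm V (op_smult V c T x) \<le> cmod c * B * hnorm V x"
      using mult_left_mono[OF B[OF x], of "cmod c"] T x by (simp add: op_smult_def hnorm_smult)
  qed (use T in \<open>auto simp: op_smult_def bounded_ops_add bounded_ops_smult cinner_simps intro!: cinner_ext
        simp: algebra_simps\<close>)
qed

lemma op_mult_bounded [simp]:
  assumes S: "S \<in> bounded_ops V" and T: "T \<in> bounded_ops V"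
  shows "op_mult V S T \<in> bounded_ops V"
proof -
  obtain A where A: "A \<ge> 0" "\<And>x. x \<in> carrier V \<Longrightarrow> hnorm V (S x) \<le> A * hnorm V x"
    using bounded_ops_bound[OF S] by metis
  obtain B where B: "\<And>x. x \<in> carrier V \<Longrightarrow> hnorm V (T x) \<le> B * hnorm V x"
    using bounded_ops_bound[OF T] by metis
  show ?thesis
  proof (rule bounded_opsI[where B = "A * B"])
    fix x assume x: "x \<in> carrier V"
    show "hnorm V (op_mult V S T x) \<le> A * B * hnorm V x"
      using A(2)[of "T x"] mult_left_mono[OF B[OF x] A(1)] T x by (simp add: compose_eq)
  qed (use S T in \<open>auto simp: compose_eq bounded_ops_add bounded_ops_smult\<close>)
qed

lemma rank_one_bounded [simp]:
  assumes x: "x \<in> carrier V" and y: "y \<in> carrier V"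
  shows "rank_one V x y \<in> bounded_ops V"
proof (rule bounded_opsI[where B = "hnorm V y * hnorm V x"])
  fix z assume z: "z \<in> carrier V"
  show "hnorm V (rank_one V x y z) \<le> hnorm V y * hnorm V x * hnorm V z"
    using mult_right_mono[OF cauchy_schwarz[OF z y], of "hnorm V x"] x y z
    by (simp add: rank_one_def hnorm_smult mult_ac)
qed (use x y in \<open>auto simp: rank_one_def cinner_simps intro!: cinner_ext simp: algebra_simps\<close>)

end

section \<open>Bounded sesquilinear forms and adjoints\<close>

context separable_hilbert_space
begin

text \<open>Riesz gives a vector \<open>t x\<close> for each \<open>x\<close>. Linearity of
  \<open>t\<close> follows because inner products determine vectors, and boundedness from inserting
  \<open>y = t x\<close> into the bound of the form.\<close>

lemma bounded_form_op:
  assumes add_left: "\<And>x x' y. \<lbrakk>x \<in> carrier V; x' \<in> carrier V; y \<in> carrier V\<rbrakk> \<Longrightarrow> b (x \<oplus> x') y = b x y + b x' y"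
    and smult_left: "\<And>c x y. \<lbrakk>x \<in> carrier V; y \<in> carrier V\<rbrakk> \<Longrightarrow> b (c \<odot> x) y = c * b x y"
    and add_right: "\<And>x y y'. \<lbrakk>x \<in> carrier V; y \<in> carrier V; y' \<in> carrier V\<rbrakk> \<Longrightarrow> b x (y \<oplus> y') = b x y + b x y'"
    and smult_right: "\<And>c x y. \<lbrakk>x \<in> carrier V; y \<in> carrier V\<rbrakk> \<Longrightarrow> b x (c \<odot> y) = cnj c * b x y"
    and bound: "\<And>x y. \<lbrakk>x \<in> carrier V; y \<in> carrier V\<rbrakk> \<Longrightarrow> cmod (b x y) \<le> B * hnorm V x * hnorm V y"
  obtains T where "T \<in> bounded_ops V"
    "\<And>x y. \<lbrakk>x \<in> carrier V; y \<in> carrier V\<rbrakk> \<Longrightarrow> \<langle>T x, y\<rangle> = b x y"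
proof -
  have "\<exists>z. z \<in> carrier V \<and> (\<forall>y\<in>carrier V. \<langle>z, y\<rangle> = b x y)" if x: "x \<in> carrier V" for x
  proof -
    \<comment> \<open>The conjugate is needed because \<open>b\<close> is conjugate-linear in its
      second argument while Riesz asks for a linear functional.\<close>
    obtain z where z: "z \<in> carrier V" "\<And>y. y \<in> carrier V \<Longrightarrow> cnj (b x y) = \<langle>y, z\<rangle>"
      by (rule riesz_representation[of "\<lambda>y. cnj (b x y)" "B * hnorm V x"])
        (use x add_right smult_right bound in auto)
    have "\<langle>z, y\<rangle> = b x y" if "y \<in> carrier V" for y
      using z that cinner_commute[of y z] by (metis complex_cnj_cnj)
    then show ?thesis
      using z(1) by blast
  qed
  then obtain t where t: "\<And>x. x \<in> carrier V \<Longrightarrow> t x \<in> carrier V"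
    "\<And>x y. \<lbrakk>x \<in> carrier V; y \<in> carrier V\<rbrakk> \<Longrightarrow> \<langle>t x, y\<rangle> = b x y"
    by metis
  let ?T = "restrict t (carrier V)"
  have "?T \<in> bounded_ops V"
  proof (rule bounded_opsI[where B = "\<bar>B\<bar>"])
    fix x assume x: "x \<in> carrier V"
    have "hnorm V (t x) * hnorm V (t x) = cmod \<langle>t x, t x\<rangle>"
      using norm_cinner_self[OF t(1)[OF x]] by (simp only: power2_eq_square)
    also have "\<dots> \<le> B * hnorm V x * hnorm V (t x)"
      using t x bound by simp
    also have "\<dots> \<le> \<bar>B\<bar> * hnorm V x * hnorm V (t x)"
      using t x by (intro mult_right_mono) auto
    finally have "hnorm V (t x) \<le> \<bar>B\<bar> * hnorm V x"
      using x t(1)[OF x] hnorm_nonneg[OF t(1)[OF x]]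
      by (cases "hnorm V (t x) = 0") (auto simp: mult_le_cancel_right)
    then show "hnorm V (?T x) \<le> \<bar>B\<bar> * hnorm V x"
      using x by simp
  next
    fix x y assume x: "x \<in> carrier V" and y: "y \<in> carrier V"
    show "?T (x \<oplus> y) = ?T x \<oplus> ?T y"
      by (rule cinner_ext) (use x y t in \<open>auto simp: cinner_simps add_left\<close>)
  next
    fix c x assume x: "x \<in> carrier V"
    show "?T (c \<odot> x) = c \<odot> ?T x"
      by (rule cinner_ext) (use x t in \<open>auto simp: cinner_simps smult_left\<close>)
  qed (use t in auto)
  then show ?thesis
    using that[of ?T] t by simp
qed

text \<open>Evaluates the definite description in \<open>op_adj\<close>; every later formula for an
  adjoint goes through this rule.\<close>

lemma op_adj_unique:
  assumes T: "T \<in> bounded_ops V" and T': "T' \<in> bounded_ops V"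
    and adj: "\<And>x y. \<lbrakk>x \<in> carrier V; y \<in> carrier V\<rbrakk> \<Longrightarrow> \<langle>T x, y\<rangle> = \<langle>x, T' y\<rangle>"
  shows "op_adj V T = T'"
  unfolding op_adj_def
proof (rule the_equality)
  fix S assume S: "S \<in> bounded_ops V \<and> (\<forall>x\<in>carrier V. \<forall>y\<in>carrier V. \<langle>T x, y\<rangle> = \<langle>x, S y\<rangle>)"
  show "S = T'"
  proof (rule op_ext)
    fix y assume y: "y \<in> carrier V"
    show "S y = T' y"
      using S T' y adj by (intro cinner_ext_right) auto
  qed (use S T' in auto)
qed (use T' adj in auto)

lemma op_adj_exists:
  assumes T: "T \<in> bounded_ops V"
  shows "op_adj V T \<in> bounded_ops V \<and> (\<forall>x\<in>carrier V. \<forall>y\<in>carrier V. \<langle>T x, y\<rangle> = \<langle>x, op_adj V T y\<rangle>)"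
proof -
  obtain B where B: "B \<ge> 0" "\<And>x. x \<in> carrier V \<Longrightarrow> hnorm V (T x) \<le> B * hnorm V x"
    using bounded_ops_bound[OF T] by metis
  obtain T' where T': "T' \<in> bounded_ops V"
    "\<And>x y. \<lbrakk>x \<in> carrier V; y \<in> carrier V\<rbrakk> \<Longrightarrow> \<langle>T' x, y\<rangle> = \<langle>x, T y\<rangle>"
  proof (rule bounded_form_op[of "\<lambda>x y. \<langle>x, T y\<rangle>" B])
    fix x y assume x: "x \<in> carrier V" and y: "y \<in> carrier V"
    have "cmod \<langle>x, T y\<rangle> \<le> hnorm V x * hnorm V (T y)"
      using T x y by (simp add: cauchy_schwarz)
    also have "\<dots> \<le> hnorm V x * (B * hnorm V y)"
      using B x y by (intro mult_left_mono) auto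
    finally show "cmod \<langle>x, T y\<rangle> \<le> B * hnorm V x * hnorm V y"
      by (simp add: mult_ac)
  qed (use T in \<open>auto simp: bounded_ops_add bounded_ops_smult cinner_simps\<close>)
  have adj: "\<langle>T x, y\<rangle> = \<langle>x, T' y\<rangle>" if "x \<in> carrier V" "y \<in> carrier V" for x y
    using T'(1) T'(2)[of y x] T that cinner_commute[of y "T x"] cinner_commute[of "T' y" x] by simp
  then have "op_adj V T = T'"
    using T T'(1) op_adj_unique by blast
  then show ?thesis
    using T'(1) adj by blast
qed

lemma op_adj_bounded [simp]: "T \<in> bounded_ops V \<Longrightarrow> op_adj V T \<in> bounded_ops V"
  using op_adj_exists by blast

lemma cinner_op_adj:
  "\<lbrakk>T \<in> bounded_ops V; x \<in> carrier V; y \<in> carrier V\<rbrakk> \<Longrightarrow> \<langle>T x, y\<rangle> = \<langle>x, op_adj V T y\<rangle>"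
  using op_adj_exists by blast

lemma cinner_op_adj':
  "\<lbrakk>T \<in> bounded_ops V; x \<in> carrier V; y \<in> carrier V\<rbrakk> \<Longrightarrow> \<langle>op_adj V T x, y\<rangle> = \<langle>x, T y\<rangle>"
  using cinner_op_adj[of T y x] cinner_commute[of "T y" x] cinner_commute[of y "op_adj V T x"] by simp

lemma op_adj_adj: "T \<in> bounded_ops V \<Longrightarrow> op_adj V (op_adj V T) = T"
  by (rule op_adj_unique) (auto simp: cinner_op_adj')

lemma op_adj_mult:
  "\<lbrakk>S \<in> bounded_ops V; T \<in> bounded_ops V\<rbrakk>
    \<Longrightarrow> op_adj V (op_mult V S T) = op_mult V (op_adj V T) (op_adj V S)"
  by (rule op_adj_unique) (auto simp: compose_eq cinner_op_adj)

lemma op_adj_one: "op_adj V (op_one V) = op_one V"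
  by (rule op_adj_unique) (simp_all, simp add: op_one_def)

section \<open>Compact operators\<close>

lemma compact_ops_bounded [simp]: "T \<in> compact_ops V \<Longrightarrow> T \<in> bounded_ops V"
  by (simp add: compact_ops_def)

text \<open>In a complete metric space, a subset has compact closure exactly when it is totally
  bounded.\<close>

lemma compact_ops_iff_totally_bounded:
  assumes T: "T \<in> bounded_ops V"
  shows "T \<in> compact_ops V \<longleftrightarrow> metric.mtotally_bounded (T ` {x \<in> carrier V. hnorm V x \<le> 1})"
proof -
  have "T ` {x \<in> carrier V. hnorm V x \<le> 1} \<subseteq> carrier V"
    using T by auto
  then show ?thesis
    using T metric.mtotally_bounded_eq_compact_closure_of[OF complete, of "T ` {x \<in> carrier V. hnorm V x \<le> 1}"]
    unfolding compact_ops_def htop_def by blast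
qed

text \<open>Total boundedness asks for Cauchy subsequences of sequences in the image of the unit
  ball; norm-convergent ones are Cauchy.\<close>

lemma compact_opsI:
  assumes T: "T \<in> bounded_ops V"
    and conv: "\<And>\<sigma> :: nat \<Rightarrow> 'a. \<lbrakk>\<And>n. \<sigma> n \<in> carrier V; \<And>n. hnorm V (\<sigma> n) \<le> 1\<rbrakk>
      \<Longrightarrow> \<exists>r v. strict_mono r \<and> hconv V (\<lambda>n. T (\<sigma> (r n))) v"
  shows "T \<in> compact_ops V"
  unfolding compact_ops_iff_totally_bounded[OF T] metric.mtotally_bounded_sequentially
proof (intro conjI allI impI)
  show "T ` {x \<in> carrier V. hnorm V x \<le> 1} \<subseteq> carrier V"
    using T by auto
  fix s :: "nat \<Rightarrow> 'a" assume "range s \<subseteq> T ` {x \<in> carrier V. hnorm V x \<le> 1}"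
  then have "\<forall>n. \<exists>x. x \<in> carrier V \<and> hnorm V x \<le> 1 \<and> s n = T x"
    by blast
  then obtain \<sigma> where \<sigma>: "\<And>n. \<sigma> n \<in> carrier V" "\<And>n. hnorm V (\<sigma> n) \<le> 1" "\<And>n. s n = T (\<sigma> n)"
    by metis
  then obtain r v where r: "strict_mono r" "hconv V (\<lambda>n. T (\<sigma> (r n))) v"
    using conv[of \<sigma>] by metis
  have "metric.MCauchy (s \<circ> r)"
    unfolding metric.MCauchy_def
  proof (intro conjI allI impI)
    show "range (s \<circ> r) \<subseteq> carrier V"
      using \<sigma> T by auto
    fix \<epsilon> :: real assume "\<epsilon> > 0"
    then show "\<exists>N. \<forall>m n. N \<le> m \<longrightarrow> N \<le> n \<longrightarrow> hdist V ((s \<circ> r) m) ((s \<circ> r) n) < \<epsilon>"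
      using hconv_Cauchy[OF r(2)] \<sigma> T by (simp add: hdist_def)
  qed
  then show "\<exists>r. strict_mono r \<and> metric.MCauchy (s \<circ> r)"
    using r(1) by blast
qed

text \<open>Compactness speaks of the unit ball, so the sequence is divided by \<open>k\<close> and
  the limit multiplied by \<open>k\<close> afterwards.\<close>

lemma compact_opsD:
  fixes \<sigma> :: "nat \<Rightarrow> 'a"
  assumes T: "T \<in> compact_ops V" and \<sigma>: "\<And>n. \<sigma> n \<in> carrier V" "\<And>n. hnorm V (\<sigma> n) \<le> B"
  obtains r v where "strict_mono r" "hconv V (\<lambda>n. T (\<sigma> (r n))) v"
proof -
  have Tb [simp]: "T \<in> bounded_ops V"
    using T by simp
  define k where "k = \<bar>B\<bar> + 1"
  have k: "k > 0" "B \<le> k"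
    by (auto simp: k_def)
  let ?s = "\<lambda>n. complex_of_real (1 / k) \<odot> \<sigma> n"
  have "hnorm V (?s n) \<le> 1" for n
    using order_trans[OF \<sigma>(2)[of n] k(2)] k(1) by (simp add: hnorm_smult[OF \<sigma>(1)] norm_divide divide_le_eq)
  then have "range (\<lambda>n. T (?s n)) \<subseteq> T ` {x \<in> carrier V. hnorm V x \<le> 1}"
    using \<sigma>(1) by auto
  then obtain r where r: "strict_mono r" "metric.MCauchy ((\<lambda>n. T (?s n)) \<circ> r)"
    using T unfolding compact_ops_iff_totally_bounded[OF Tb] metric.mtotally_bounded_sequentially by meson
  then obtain v where v: "limitin metric.mtopology ((\<lambda>n. T (?s n)) \<circ> r) v sequentially"
    using complete metric.mcomplete_def by blast
  have "v \<in> carrier V" "(\<lambda>n. hdist V (T (?s (r n))) v) \<longlonglongrightarrow> 0"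
    using v by (auto simp: metric.limitin_metric_dist_null o_def)
  then have "hconv V (\<lambda>n. T (?s (r n))) v"
    using \<sigma>(1) by (simp add: hconv_def hdist_def)
  \<comment> \<open>Rescaling by \<open>k\<close> is treated as a bounded operator, which preserves
    convergence.\<close>
  from hconv_op[OF op_smult_bounded[OF op_one_bounded, of "complex_of_real k"] this]
  have "hconv V (\<lambda>n. op_smult V (complex_of_real k) (op_one V) (T (?s (r n))))
    (op_smult V (complex_of_real k) (op_one V) v)" .
  moreover have "op_smult V (complex_of_real k) (op_one V) (T (?s n)) = T (\<sigma> n)" for n
  proof -
    have "complex_of_real k \<odot> ?s n = \<sigma> n"
      by (rule cinner_ext) (use k(1) in \<open>auto simp: \<sigma>(1) cinner_simps\<close>)
    then show ?thesis
      using \<sigma>(1) bounded_ops_smult[OF Tb, of "?s n" "complex_of_real k"]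
      by (simp add: op_smult_def op_one_def)
  qed
  ultimately show ?thesis
    using that r(1) by simp
qed

lemma op_add_compact [simp]:
  assumes S: "S \<in> compact_ops V" and T: "T \<in> compact_ops V"
  shows "op_add V S T \<in> compact_ops V"
proof (rule compact_opsI)
  fix \<sigma> :: "nat \<Rightarrow> 'a" assume \<sigma>: "\<And>n. \<sigma> n \<in> carrier V" "\<And>n. hnorm V (\<sigma> n) \<le> 1"
  obtain r v where r: "strict_mono r" "hconv V (\<lambda>n. S (\<sigma> (r n))) v"
    using compact_opsD[OF S \<sigma>] .
  obtain q w where q: "strict_mono q" "hconv V (\<lambda>n. T (\<sigma> (r (q n)))) w"
    using compact_opsD[OF T, of "\<lambda>n. \<sigma> (r n)" 1] \<sigma> by blast
  have "hconv V (\<lambda>n. S (\<sigma> (r (q n))) \<oplus> T (\<sigma> (r (q n)))) (v \<oplus> w)"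
    using hconv_add[OF hconv_subseq[OF r(2) q(1)] q(2)] .
  then have "hconv V (\<lambda>n. op_add V S T (\<sigma> ((r \<circ> q) n))) (v \<oplus> w)"
    using \<sigma>(1) by (simp add: op_add_def)
  then show "\<exists>r v. strict_mono r \<and> hconv V (\<lambda>n. op_add V S T (\<sigma> (r n))) v"
    using strict_mono_o[OF r(1) q(1)] by blast
qed (use S T in simp)

lemma op_mult_compact [simp]:
  assumes S: "S \<in> bounded_ops V" and T: "T \<in> compact_ops V"
  shows "op_mult V S T \<in> compact_ops V"
proof (rule compact_opsI)
  fix \<sigma> :: "nat \<Rightarrow> 'a" assume \<sigma>: "\<And>n. \<sigma> n \<in> carrier V" "\<And>n. hnorm V (\<sigma> n) \<le> 1"
  obtain r v where r: "strict_mono r" "hconv V (\<lambda>n. T (\<sigma> (r n))) v"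
    using compact_opsD[OF T \<sigma>] .
  then show "\<exists>r v. strict_mono r \<and> hconv V (\<lambda>n. op_mult V S T (\<sigma> (r n))) v"
    using hconv_op[OF S r(2)] \<sigma>(1) by (auto simp: compose_eq)
qed (use S T in simp)

lemma op_smult_compact [simp]:
  assumes T: "T \<in> compact_ops V"
  shows "op_smult V c T \<in> compact_ops V"
proof -
  have "op_smult V c T = op_mult V (op_smult V c (op_one V)) T"
    using T by (intro op_ext) (simp_all, simp add: op_smult_def compose_eq op_one_def)
  then show ?thesis
    using T by simp
qed

text \<open>Schauder's theorem. For a bounded sequence, compactness of \<open>T\<close> makes a
  subsequence of its image under \<open>T\<close> after \<open>?T'\<close> converge. Since
  \<open>(hnorm V (?T' x))\<^sup>2\<close> is at most
  \<open>hnorm V x * hnorm V (T (?T' x))\<close>, the image under \<open>?T'\<close> is then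
  Cauchy.\<close>

lemma op_adj_compact [simp]:
  assumes T: "T \<in> compact_ops V"
  shows "op_adj V T \<in> compact_ops V"
proof (rule compact_opsI)
  fix \<sigma> :: "nat \<Rightarrow> 'a" assume \<sigma>: "\<And>n. \<sigma> n \<in> carrier V" "\<And>n. hnorm V (\<sigma> n) \<le> 1"
  have Tb [simp]: "T \<in> bounded_ops V"
    using T by simp
  let ?T' = "op_adj V T"
  obtain B where B: "B \<ge> 0" "\<And>x. x \<in> carrier V \<Longrightarrow> hnorm V (?T' x) \<le> B * hnorm V x"
    using bounded_ops_bound[OF op_adj_bounded[OF Tb]] by metis
  have "hnorm V (?T' (\<sigma> n)) \<le> B" for n
    using B(2)[OF \<sigma>(1)[of n]] mult_left_mono[OF \<sigma>(2)[of n] B(1)] by simp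
  then obtain r v where r: "strict_mono r" "hconv V (\<lambda>n. T (?T' (\<sigma> (r n)))) v"
    using compact_opsD[OF T, of "\<lambda>n. ?T' (\<sigma> n)" B] \<sigma>(1) by auto
  obtain w where "hconv V (\<lambda>n. ?T' (\<sigma> (r n))) w"
  proof (rule Cauchy_imp_hconv)
    fix \<epsilon> :: real assume \<epsilon>: "\<epsilon> > 0"
    \<comment> \<open>Differences of unit-ball vectors have norm at most 2, which explains the half;
      the square comes from the estimate of the squared norm.\<close>
    then obtain N where N: "\<And>m n. \<lbrakk>m \<ge> N; n \<ge> N\<rbrakk>
        \<Longrightarrow> hnorm V (T (?T' (\<sigma> (r m))) \<ominus> T (?T' (\<sigma> (r n)))) < \<epsilon>\<^sup>2 / 2"
      using hconv_Cauchy[OF r(2), of "\<epsilon>\<^sup>2 / 2"] by auto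
    have "hnorm V (?T' (\<sigma> (r m)) \<ominus> ?T' (\<sigma> (r n))) < \<epsilon>" if mn: "m \<ge> N" "n \<ge> N" for m n
    proof -
      let ?x = "\<sigma> (r m) \<ominus> \<sigma> (r n)"
      have [simp]: "?x \<in> carrier V"
        using \<sigma>(1) by simp
      have x2: "hnorm V ?x \<le> 2"
      proof -
        have "?x = \<sigma> (r m) \<oplus> (\<zero> \<ominus> \<sigma> (r n))"
          by (rule cinner_ext) (auto simp: \<sigma>(1) cinner_simps)
        moreover have "hnorm V (\<zero> \<ominus> \<sigma> (r n)) = hnorm V (\<sigma> (r n))"
          using \<sigma>(1) by (simp add: hnorm_minus_commute[of \<zero>] minus_zero_right)
        ultimately show ?thesis
          using hnorm_triangle[of "\<sigma> (r m)" "\<zero> \<ominus> \<sigma> (r n)"] \<sigma>(1) \<sigma>(2)[of "r m"] \<sigma>(2)[of "r n"] by simp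
      qed
      have "(hnorm V (?T' ?x))\<^sup>2 = cmod \<langle>?T' ?x, ?T' ?x\<rangle>"
        by (simp add: norm_cinner_self)
      also have "\<dots> = cmod \<langle>?x, T (?T' ?x)\<rangle>"
        by (simp add: cinner_op_adj')
      also have "\<dots> \<le> hnorm V ?x * hnorm V (T (?T' ?x))"
        by (simp add: cauchy_schwarz)
      also have "\<dots> \<le> 2 * hnorm V (T (?T' ?x))"
        using x2 by (intro mult_right_mono) auto
      also have "T (?T' ?x) = T (?T' (\<sigma> (r m))) \<ominus> T (?T' (\<sigma> (r n)))"
        using \<sigma>(1) by (simp add: bounded_ops_diff)
      also have "2 * hnorm V \<dots> < \<epsilon>\<^sup>2"
        using N[OF mn] by simp
      finally have "hnorm V (?T' ?x) < \<epsilon>"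
        by (rule power2_less_imp_less) (use \<epsilon> in simp)
      then show ?thesis
        using \<sigma>(1) by (simp add: bounded_ops_diff)
    qed
    then show "\<exists>N. \<forall>m\<ge>N. \<forall>n\<ge>N. hnorm V (?T' (\<sigma> (r m)) \<ominus> ?T' (\<sigma> (r n))) < \<epsilon>"
      by blast
  qed (use \<sigma>(1) that in auto)
  then show "\<exists>r v. strict_mono r \<and> hconv V (\<lambda>n. ?T' (\<sigma> (r n))) v"
    using r(1) by blast
qed (use T in simp)

text \<open>The images are the bounded scalars \<open>\<langle>\<sigma> n, y\<rangle>\<close> times
  the fixed vector \<open>x\<close>, so Bolzano-Weierstrass for complex numbers suffices.\<close>

lemma rank_one_compact [simp]:
  assumes x: "x \<in> carrier V" and y: "y \<in> carrier V"
  shows "rank_one V x y \<in> compact_ops V"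
proof (rule compact_opsI)
  fix \<sigma> :: "nat \<Rightarrow> 'a" assume \<sigma>: "\<And>n. \<sigma> n \<in> carrier V" "\<And>n. hnorm V (\<sigma> n) \<le> 1"
  have "cmod \<langle>\<sigma> n, y\<rangle> \<le> hnorm V y" for n
    using order_trans[OF cauchy_schwarz[OF \<sigma>(1) y] mult_right_mono[OF \<sigma>(2), of "hnorm V y"]] y by simp
  then have "bounded (range (\<lambda>n. \<langle>\<sigma> n, y\<rangle>))"
    by (auto simp: bounded_iff)
  then obtain l r where r: "strict_mono r" "((\<lambda>n. \<langle>\<sigma> n, y\<rangle>) \<circ> r) \<longlonglongrightarrow> l"
    using bounded_imp_convergent_subsequence by blast
  have "(\<lambda>n. \<langle>\<sigma> (r n), y\<rangle> - l) \<longlonglongrightarrow> 0"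
    using r(2) by (simp add: o_def LIM_zero)
  then have "(\<lambda>n. cmod (\<langle>\<sigma> (r n), y\<rangle> - l) * hnorm V x) \<longlonglongrightarrow> 0"
    by (intro tendsto_mult_left_zero tendsto_norm_zero)
  then have "hconv V (\<lambda>n. \<langle>\<sigma> (r n), y\<rangle> \<odot> x) (l \<odot> x)"
  proof (rule hconv_bound[rotated 2])
    fix n
    have "(\<langle>\<sigma> (r n), y\<rangle> \<odot> x) \<ominus> (l \<odot> x) = (\<langle>\<sigma> (r n), y\<rangle> - l) \<odot> x"
      by (rule cinner_ext) (use x in \<open>auto simp: cinner_simps algebra_simps\<close>)
    then show "hnorm V ((\<langle>\<sigma> (r n), y\<rangle> \<odot> x) \<ominus> (l \<odot> x)) \<le> cmod (\<langle>\<sigma> (r n), y\<rangle> - l) * hnorm V x"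
      using x by (simp add: hnorm_smult)
  qed (use x in auto)
  then show "\<exists>r v. strict_mono r \<and> hconv V (\<lambda>n. rank_one V x y (\<sigma> (r n))) v"
    using r(1) \<sigma>(1) by (auto simp: rank_one_def)
qed (use x y in simp)

end

section \<open>Units, zeros and associativity of operator products\<close>

context complex_hilbert_space
begin

lemma bounded_ops_zero:
  assumes T: "T \<in> bounded_ops V"
  shows "T \<zero> = \<zero>"
proof -
  have "T \<zero> \<ominus> T \<zero> = \<zero>"
    using minus_eq_zero_iff[of "T \<zero>" "T \<zero>"] T by simp
  then show ?thesis
    using bounded_ops_diff[OF T, of \<zero> \<zero>] minus_zero_right[of \<zero>] by simp
qed

lemma op_mult_one_right: "T \<in> bounded_ops V \<Longrightarrow> op_mult V T (op_one V) = T"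
  by (rule op_ext) (simp_all, simp add: compose_eq op_one_def)

lemma op_mult_one_left: "T \<in> bounded_ops V \<Longrightarrow> op_mult V (op_one V) T = T"
  by (rule op_ext) (simp_all, simp add: compose_eq op_one_def)

lemma op_mult_zero_right: "T \<in> bounded_ops V \<Longrightarrow> op_mult V T (op_zero V) = op_zero V"
  by (rule op_ext) (simp_all, simp add: compose_eq op_zero_def bounded_ops_zero)

lemma op_mult_zero_left: "T \<in> bounded_ops V \<Longrightarrow> op_mult V (op_zero V) T = op_zero V"
  by (rule op_ext) (simp_all, simp add: compose_eq op_zero_def)

lemma op_mult_assoc:
  "\<lbrakk>R \<in> bounded_ops V; S \<in> bounded_ops V; T \<in> bounded_ops V\<rbrakk>
    \<Longrightarrow> op_mult V (op_mult V R S) T = op_mult V R (op_mult V S T)"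
  by (rule op_ext) (simp_all, simp add: compose_eq)

end

lemma (in separable_hilbert_space) op_adj_inject:
  "\<lbrakk>op_adj V S = op_adj V T; S \<in> bounded_ops V; T \<in> bounded_ops V\<rbrakk> \<Longrightarrow> S = T"
  by (metis op_adj_adj)

section \<open>The sigma-weak topology\<close>

text \<open>Convergence can be tested on the subbasis: the property passes to finite intersections
  and to unions by induction on the generation of open sets.\<close>

lemma limitin_topology_generated_by:
  assumes l: "l \<in> \<Union>S" and ev: "\<And>U. \<lbrakk>U \<in> S; l \<in> U\<rbrakk> \<Longrightarrow> eventually (\<lambda>n. f n \<in> U) F"
  shows "limitin (topology_generated_by S) f l F"
  unfolding limitin_def
proof (intro conjI allI impI; (elim conjE)?)
  show "l \<in> topspace (topology_generated_by S)"
    using l by simp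
  fix U assume "openin (topology_generated_by S) U" "l \<in> U"
  then have "generate_topology_on S U" "l \<in> U"
    by (simp_all add: openin_topology_generated_by)
  then show "eventually (\<lambda>n. f n \<in> U) F"
  proof induction
    case (Int a b)
    then show ?case
      by (simp add: eventually_conj)
  next
    case (UN K)
    then obtain k where k: "k \<in> K" "l \<in> k"
      by blast
    then have "eventually (\<lambda>n. f n \<in> k) F"
      using UN.IH by blast
    then show ?case
      by (rule eventually_mono) (use k in blast)
  qed (use ev in auto)
qed

context complex_hilbert_space
begin

lemma square_summable_closed: "square_summable V \<xi> \<Longrightarrow> \<xi> n \<in> carrier V"
  by (auto simp: square_summable_def)

text \<open>Sequences with one nonzero entry make each matrix coefficient one of the functionals
  that define the \<sigma>-weak topology.\<close>

lemma square_summable_single: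
  assumes "h \<in> carrier V"
  shows "square_summable V (\<lambda>n. if n = 0 then h else \<zero>)"
  unfolding square_summable_def
proof
  show "range (\<lambda>n. if n = 0 then h else \<zero>) \<subseteq> carrier V"
    using assms by auto
  show "summable (\<lambda>n. (hnorm V (if n = 0 then h else \<zero>))\<^sup>2)"
    by (rule summable_finite[of "{0}"]) auto
qed

lemma square_summable_prod:
  assumes "square_summable V \<xi>" "square_summable V \<eta>"
  shows "summable (\<lambda>n. hnorm V (\<xi> n) * hnorm V (\<eta> n))"
proof (rule summable_comparison_test')
  show "summable (\<lambda>n. (hnorm V (\<xi> n))\<^sup>2 + (hnorm V (\<eta> n))\<^sup>2)"
    using assms by (auto simp: square_summable_def intro: summable_add)
  fix n
  have "0 \<le> hnorm V (\<xi> n)" "0 \<le> hnorm V (\<eta> n)"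
    using assms square_summable_closed by auto
  then show "norm (hnorm V (\<xi> n) * hnorm V (\<eta> n)) \<le> (hnorm V (\<xi> n))\<^sup>2 + (hnorm V (\<eta> n))\<^sup>2"
    using sum_squares_bound[of "hnorm V (\<xi> n)" "hnorm V (\<eta> n)"]
    by (simp add: abs_mult mult.assoc) (use mult_nonneg_nonneg in smt)
qed

lemma topspace_sigma_weak [simp]: "topspace (sigma_weak V) = bounded_ops V"
proof
  \<comment> \<open>The zero sequence, shaped as an instance of
    \<open>square_summable_single\<close>; with \<open>U = UNIV\<close> its subbasic set is all of
    \<open>bounded_ops V\<close>.\<close>
  let ?z = "\<lambda>n::nat. if n = 0 then \<zero> else \<zero>"
  have "{T \<in> bounded_ops V. (\<Sum>n. \<langle>T (?z n), ?z n\<rangle>) \<in> UNIV} \<subseteq> topspace (sigma_weak V)"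
    unfolding sigma_weak_def topology_generated_by_topspace
    by (rule Union_upper) (use square_summable_single[of \<zero>] open_UNIV in blast)
  then show "bounded_ops V \<subseteq> topspace (sigma_weak V)"
    by simp
qed (auto simp: sigma_weak_def)

lemma openin_sigma_weak:
  assumes "square_summable V \<xi>" "square_summable V \<eta>" "open U"
  shows "openin (sigma_weak V) {T \<in> bounded_ops V. (\<Sum>n. \<langle>T (\<xi> n), \<eta> n\<rangle>) \<in> U}"
  unfolding sigma_weak_def by (rule topology_generated_by_Basis) (use assms in blast)

lemma continuous_map_cinner_sigma_weak:
  assumes h: "h \<in> carrier V" and k: "k \<in> carrier V"
  shows "continuous_map (sigma_weak V) euclidean (\<lambda>T. \<langle>T h, k\<rangle>)"
  unfolding continuous_map_def
proof (intro conjI allI impI)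
  fix U :: "complex set" assume U: "openin euclidean U"
  let ?h = "\<lambda>n::nat. if n = 0 then h else \<zero>" and ?k = "\<lambda>n::nat. if n = 0 then k else \<zero>"
  have "(\<Sum>n. \<langle>T (?h n), ?k n\<rangle>) = \<langle>T h, k\<rangle>" if "T \<in> bounded_ops V" for T
    using suminf_finite[of "{0}" "\<lambda>n. \<langle>T (?h n), ?k n\<rangle>"] that by (auto simp: cinner_simps)
  then have "{T \<in> topspace (sigma_weak V). \<langle>T h, k\<rangle> \<in> U}
      = {T \<in> bounded_ops V. (\<Sum>n. \<langle>T (?h n), ?k n\<rangle>) \<in> U}"
    by auto
  then show "openin (sigma_weak V) {T \<in> topspace (sigma_weak V). \<langle>T h, k\<rangle> \<in> U}"
    using openin_sigma_weak[OF square_summable_single[OF h] square_summable_single[OF k]] U by simp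
qed auto

end

text \<open>\<open>truncation V T e n\<close> is \<open>T\<close> composed with the projection onto the span of the first \<open>n\<close> vectors
  of an orthogonal frame \<open>e\<close>.\<close>

primrec truncation ::
  "('a, 'm) inner_module_scheme \<Rightarrow> ('a \<Rightarrow> 'a) \<Rightarrow> (nat \<Rightarrow> 'a) \<Rightarrow> nat \<Rightarrow> 'a \<Rightarrow> 'a" where
  "truncation V T e 0 = op_smult V 0 (op_one V)"
| "truncation V T e (Suc n) = op_add V (truncation V T e n) (rank_one V (T (e n)) (e n))"

section \<open>Sigma-weak approximation by compact operators\<close>

context separable_hilbert_space
begin

lemma truncation_compact [simp]:
  assumes "orthogonal_frame V e" "T \<in> bounded_ops V"
  shows "truncation V T e n \<in> compact_ops V"
proof (induction n)
  case 0
  \<comment> \<open>The zero operator is also a multiple of a rank-one operator, which is known to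
    be compact.\<close>
  have "op_smult V 0 (op_one V) = op_smult V 0 (rank_one V \<zero> \<zero>)"
    by (rule op_cinner_ext) (simp_all, simp add: op_smult_def op_one_def rank_one_def cinner_simps)
  then show ?case
    by simp
qed (use assms in simp)

lemma cinner_truncation:
  assumes e: "orthogonal_frame V e" and T: "T \<in> bounded_ops V" and xy: "x \<in> carrier V" "y \<in> carrier V"
  shows "\<langle>truncation V T e n x, y\<rangle> = (\<Sum>i<n. \<langle>x, e i\<rangle> * \<langle>e i, op_adj V T y\<rangle>)"
proof (induction n)
  case 0
  show ?case
    using xy by (simp add: op_smult_def op_one_def cinner_simps)
next
  case (Suc n)
  have "truncation V T e n \<in> bounded_ops V"
    using e T truncation_compact by simp
  then show ?case
    using Suc e T xy by (simp add: op_add_def rank_one_def cinner_simps cinner_op_adj)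
qed

text \<open>Each matrix coefficient converges by the frame expansion. A bound uniform in
  \<open>n\<close>, summable in \<open>k\<close>, lets Tannery's theorem exchange the limit with the
  series.\<close>

lemma truncation_tendsto:
  assumes e: "orthogonal_frame V e" and T: "T \<in> bounded_ops V"
  shows "limitin (sigma_weak V) (truncation V T e) T sequentially"
  unfolding sigma_weak_def
proof (rule limitin_topology_generated_by)
  show "T \<in> \<Union> {{T \<in> bounded_ops V. (\<Sum>n. \<langle>T (\<xi> n), \<eta> n\<rangle>) \<in> U} | \<xi> \<eta> U.
        square_summable V \<xi> \<and> square_summable V \<eta> \<and> open U}"
    using topspace_sigma_weak T by (simp add: sigma_weak_def)
  fix A assume "A \<in> {{T \<in> bounded_ops V. (\<Sum>n. \<langle>T (\<xi> n), \<eta> n\<rangle>) \<in> U} | \<xi> \<eta> U.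
        square_summable V \<xi> \<and> square_summable V \<eta> \<and> open U}" and TA: "T \<in> A"
  then obtain \<xi> \<eta> U where \<xi>: "square_summable V \<xi>" and \<eta>: "square_summable V \<eta>" and U: "open U"
    and A: "A = {T \<in> bounded_ops V. (\<Sum>n. \<langle>T (\<xi> n), \<eta> n\<rangle>) \<in> U}"
    by blast
  have [simp]: "\<xi> k \<in> carrier V" "\<eta> k \<in> carrier V" for k
    using \<xi> \<eta> square_summable_closed by auto
  obtain B where B: "B \<ge> 0" "\<And>x. x \<in> carrier V \<Longrightarrow> hnorm V (op_adj V T x) \<le> B * hnorm V x"
    using bounded_ops_bound[OF op_adj_bounded[OF T]] by metis
  have lim: "(\<lambda>n. \<langle>truncation V T e n (\<xi> k), \<eta> k\<rangle>) \<longlonglongrightarrow> \<langle>T (\<xi> k), \<eta> k\<rangle>" for k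
    using orthogonal_frame_sums[OF e, of "\<xi> k" "op_adj V T (\<eta> k)"] e T
    by (simp add: cinner_truncation sums_def cinner_op_adj[OF T])
  have bound: "norm \<langle>truncation V T e n (\<xi> k), \<eta> k\<rangle> \<le> B * (hnorm V (\<xi> k) * hnorm V (\<eta> k))" for k n
  proof -
    let ?y = "op_adj V T (\<eta> k)"
    have "norm \<langle>truncation V T e n (\<xi> k), \<eta> k\<rangle> \<le> sqrt (\<Sum>i<n. (cmod \<langle>\<xi> k, e i\<rangle>)\<^sup>2) * hnorm V ?y"
      using frame_sum_bound[OF e, of ?y "{..<n}" "\<lambda>i. \<langle>\<xi> k, e i\<rangle>"] e T by (simp add: cinner_truncation)
    also have "\<dots> \<le> hnorm V (\<xi> k) * (B * hnorm V (\<eta> k))"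
      using bessel_inequality[OF e, of "\<xi> k" "{..<n}"] B T
      by (intro mult_mono real_le_lsqrt) (auto intro: sum_nonneg)
    finally show ?thesis
      by (simp add: mult_ac)
  qed
  have "(\<lambda>n. \<Sum>k. \<langle>truncation V T e n (\<xi> k), \<eta> k\<rangle>) \<longlonglongrightarrow> (\<Sum>k. \<langle>T (\<xi> k), \<eta> k\<rangle>)"
  proof -
    have "eventually (\<lambda>(k, n). norm \<langle>truncation V T e n (\<xi> k), \<eta> k\<rangle> \<le> B * (hnorm V (\<xi> k) * hnorm V (\<eta> k)))
        (at_top \<times>\<^sub>F sequentially)"
      using bound by (auto intro: always_eventually)
    then show ?thesis
      using tannerys_theorem[of "\<lambda>k n. \<langle>truncation V T e n (\<xi> k), \<eta> k\<rangle>", OF lim]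
        summable_mult[OF square_summable_prod[OF \<xi> \<eta>], of B] by auto
  qed
  then have "eventually (\<lambda>n. (\<Sum>k. \<langle>truncation V T e n (\<xi> k), \<eta> k\<rangle>) \<in> U) sequentially"
    using U TA A topological_tendstoD by fastforce
  then show "eventually (\<lambda>n. truncation V T e n \<in> A) sequentially"
    using e T by (simp add: A)
qed

end

section \<open>Ampliations\<close>

text \<open>No density of the elementary tensors is required, so \<open>X\<close> may be larger than the tensor product
  of \<open>V\<close> and \<open>W\<close>. Bilinearity of \<open>\<tau>\<close> is a consequence.\<close>

locale tensor_isometry =
  V: separable_hilbert_space V + W: separable_hilbert_space W + X: separable_hilbert_space X
  for V :: "('a, 'm) inner_module_scheme" and W :: "('b, 'n) inner_module_scheme"
    and X :: "('c, 'o) inner_module_scheme" +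
  fixes \<tau> :: "'a \<Rightarrow> 'b \<Rightarrow> 'c"
  assumes \<tau>_closed [simp]: "\<lbrakk>x \<in> carrier V; w \<in> carrier W\<rbrakk> \<Longrightarrow> \<tau> x w \<in> carrier X"
    and cinner_\<tau>: "\<lbrakk>x \<in> carrier V; x' \<in> carrier V; w \<in> carrier W; w' \<in> carrier W\<rbrakk>
      \<Longrightarrow> \<langle>\<tau> x w, \<tau> x' w'\<rangle>\<^bsub>X\<^esub> = \<langle>x, x'\<rangle>\<^bsub>V\<^esub> * \<langle>w, w'\<rangle>\<^bsub>W\<^esub>"
begin

section \<open>Bilinearity, symmetry and slices\<close>

lemma flip: "tensor_isometry W V X (\<lambda>w x. \<tau> x w)"
  by unfold_locales (simp_all add: cinner_\<tau>)

text \<open>The squared norm of the difference expands by \<open>cinner_\<tau>\<close> into inner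
  products on \<open>V\<close> and \<open>W\<close>, where it cancels. Pairing with elementary
  tensors alone would not do, as they need not be total in \<open>X\<close>.\<close>

lemma \<tau>_add_left:
  assumes "x \<in> carrier V" "x' \<in> carrier V" "w \<in> carrier W"
  shows "\<tau> (x \<oplus>\<^bsub>V\<^esub> x') w = \<tau> x w \<oplus>\<^bsub>X\<^esub> \<tau> x' w"
proof -
  let ?u = "\<tau> (x \<oplus>\<^bsub>V\<^esub> x') w \<ominus>\<^bsub>X\<^esub> (\<tau> x w \<oplus>\<^bsub>X\<^esub> \<tau> x' w)"
  have "\<langle>?u, ?u\<rangle>\<^bsub>X\<^esub> = 0"
    using assms by (simp add: X.cinner_simps cinner_\<tau> V.cinner_simps algebra_simps)
  then show ?thesis
    using assms X.cinner_definite[of ?u] by (simp add: X.minus_eq_zero_iff)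
qed

lemma \<tau>_smult_left:
  assumes "x \<in> carrier V" "w \<in> carrier W"
  shows "\<tau> (c \<odot>\<^bsub>V\<^esub> x) w = c \<odot>\<^bsub>X\<^esub> \<tau> x w"
proof -
  let ?u = "\<tau> (c \<odot>\<^bsub>V\<^esub> x) w \<ominus>\<^bsub>X\<^esub> c \<odot>\<^bsub>X\<^esub> \<tau> x w"
  have "\<langle>?u, ?u\<rangle>\<^bsub>X\<^esub> = 0"
    using assms by (simp add: X.cinner_simps cinner_\<tau> V.cinner_simps algebra_simps)
  then show ?thesis
    using assms X.cinner_definite[of ?u] by (simp add: X.minus_eq_zero_iff)
qed

lemma hnorm_\<tau>:
  assumes "x \<in> carrier V" "w \<in> carrier W"
  shows "hnorm X (\<tau> x w) = hnorm V x * hnorm W w"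
proof -
  have "\<langle>\<tau> x w, \<tau> x w\<rangle>\<^bsub>X\<^esub> = of_real ((hnorm V x)\<^sup>2 * (hnorm W w)\<^sup>2)"
    using assms by (simp only: cinner_\<tau> V.cinner_self W.cinner_self of_real_mult)
  then have "Re \<langle>\<tau> x w, \<tau> x w\<rangle>\<^bsub>X\<^esub> = (hnorm V x * hnorm W w)\<^sup>2"
    by (simp only: Re_complex_of_real power_mult_distrib)
  then show ?thesis
    using assms by (simp add: hnorm_def[of X])
qed

text \<open>The adjoint of \<open>\<lambda>x. \<tau> x w\<close>.\<close>

definition slice :: "'b \<Rightarrow> 'c \<Rightarrow> 'a" where
  "slice w \<xi> = (SOME r. r \<in> carrier V \<and> (\<forall>x\<in>carrier V. \<langle>\<tau> x w, \<xi>\<rangle>\<^bsub>X\<^esub> = \<langle>x, r\<rangle>\<^bsub>V\<^esub>))"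

lemma slice_props:
  assumes w: "w \<in> carrier W" and \<xi>: "\<xi> \<in> carrier X"
  shows "slice w \<xi> \<in> carrier V \<and> (\<forall>x\<in>carrier V. \<langle>\<tau> x w, \<xi>\<rangle>\<^bsub>X\<^esub> = \<langle>x, slice w \<xi>\<rangle>\<^bsub>V\<^esub>)"
proof -
  obtain r where "r \<in> carrier V" "\<And>x. x \<in> carrier V \<Longrightarrow> \<langle>\<tau> x w, \<xi>\<rangle>\<^bsub>X\<^esub> = \<langle>x, r\<rangle>\<^bsub>V\<^esub>"
  proof (rule V.riesz_representation[of "\<lambda>x. \<langle>\<tau> x w, \<xi>\<rangle>\<^bsub>X\<^esub>" "hnorm W w * hnorm X \<xi>"])
    fix x assume x: "x \<in> carrier V"
    show "cmod \<langle>\<tau> x w, \<xi>\<rangle>\<^bsub>X\<^esub> \<le> hnorm W w * hnorm X \<xi> * hnorm V x"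
      using X.cauchy_schwarz[of "\<tau> x w" \<xi>] w \<xi> x by (simp add: hnorm_\<tau> mult_ac)
  qed (use w \<xi> in \<open>auto simp: \<tau>_add_left \<tau>_smult_left X.cinner_simps\<close>)
  then show ?thesis
    unfolding slice_def by (intro someI_ex[of "\<lambda>r. r \<in> carrier V \<and> _ r"]) blast
qed

lemma slice_closed [simp]: "\<lbrakk>w \<in> carrier W; \<xi> \<in> carrier X\<rbrakk> \<Longrightarrow> slice w \<xi> \<in> carrier V"
  using slice_props by blast

lemma cinner_slice:
  "\<lbrakk>w \<in> carrier W; \<xi> \<in> carrier X; x \<in> carrier V\<rbrakk> \<Longrightarrow> \<langle>\<tau> x w, \<xi>\<rangle>\<^bsub>X\<^esub> = \<langle>x, slice w \<xi>\<rangle>\<^bsub>V\<^esub>"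
  using slice_props by blast

lemma cinner_slice':
  "\<lbrakk>w \<in> carrier W; \<xi> \<in> carrier X; x \<in> carrier V\<rbrakk> \<Longrightarrow> \<langle>\<xi>, \<tau> x w\<rangle>\<^bsub>X\<^esub> = \<langle>slice w \<xi>, x\<rangle>\<^bsub>V\<^esub>"
  using cinner_slice X.cinner_commute[of "\<tau> x w" \<xi>] V.cinner_commute[of x "slice w \<xi>"] by simp

lemma slice_add:
  assumes "w \<in> carrier W" "\<xi> \<in> carrier X" "\<eta> \<in> carrier X"
  shows "slice w (\<xi> \<oplus>\<^bsub>X\<^esub> \<eta>) = slice w \<xi> \<oplus>\<^bsub>V\<^esub> slice w \<eta>"
  by (rule V.cinner_ext_right)
    (use assms in \<open>simp_all add: V.cinner_simps X.cinner_simps flip: cinner_slice\<close>)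

lemma slice_smult:
  assumes "w \<in> carrier W" "\<xi> \<in> carrier X"
  shows "slice w (c \<odot>\<^bsub>X\<^esub> \<xi>) = c \<odot>\<^bsub>V\<^esub> slice w \<xi>"
  by (rule V.cinner_ext_right)
    (use assms in \<open>simp_all add: V.cinner_simps X.cinner_simps flip: cinner_slice\<close>)

lemma slice_\<tau>:
  assumes "w \<in> carrier W" "w' \<in> carrier W" "x \<in> carrier V"
  shows "slice w (\<tau> x w') = \<langle>w', w\<rangle>\<^bsub>W\<^esub> \<odot>\<^bsub>V\<^esub> x"
  by (rule V.cinner_ext)
    (use assms in \<open>simp_all add: V.cinner_simps cinner_\<tau> flip: cinner_slice'\<close>)

section \<open>Convergence of series of slices\<close>

definition frame :: "nat \<Rightarrow> 'b" where
  "frame = (SOME f. orthogonal_frame W f)"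

lemma frame: "orthogonal_frame W frame"
  unfolding frame_def using W.ex_orthogonal_frame by (rule someI_ex)

lemma frame_closed [simp]: "frame j \<in> carrier W"
  using frame by simp

text \<open>A Bessel inequality. With \<open>?z\<close> the sum of the tensors \<open>?t j\<close>,
  pairing with \<open>\<xi>\<close> gives exactly \<open>?s\<close>, while orthogonality of the
  frame gives \<open>(hnorm X ?z)\<^sup>2 \<le> ?s\<close>; Cauchy-Schwarz then bounds
  \<open>?s\<close> by \<open>sqrt ?s * hnorm X \<xi>\<close>.\<close>

lemma sum_slice_le:
  assumes \<xi>: "\<xi> \<in> carrier X"
  shows "(\<Sum>j<n. (hnorm V (slice (frame j) \<xi>))\<^sup>2) \<le> (hnorm X \<xi>)\<^sup>2"
proof -
  let ?a = "\<lambda>j. slice (frame j) \<xi>"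
  let ?t = "\<lambda>j. \<tau> (?a j) (frame j)"
  let ?z = "lincomb X (\<lambda>_. 1) ?t n"
  let ?s = "\<Sum>j<n. (hnorm V (?a j))\<^sup>2"
  have t [simp]: "?t j \<in> carrier X" "?z \<in> carrier X" for j
    using \<xi> by auto
  have s0: "0 \<le> ?s"
    by (rule sum_nonneg) simp
  \<comment> \<open>Bessel for the single index \<open>j\<close> says that the squared norm
    \<open>?h\<close> satisfies \<open>?h * ?h \<le> ?h\<close>.\<close>
  have f1: "(hnorm W (frame j))\<^sup>2 \<le> 1" for j
  proof (rule ccontr)
    let ?h = "(hnorm W (frame j))\<^sup>2"
    assume "\<not> ?h \<le> 1"
    then have "?h * 1 < ?h * ?h"
      by (intro mult_strict_left_mono) auto
    moreover have "?h * ?h \<le> ?h"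
      using W.bessel_inequality[OF frame, of "frame j" "{j}"]
      by (simp add: W.norm_cinner_self power2_eq_square)
    ultimately show False
      by simp
  qed
  have zt: "\<langle>?t j, ?z\<rangle>\<^bsub>X\<^esub> = of_real ((hnorm V (?a j))\<^sup>2 * (hnorm W (frame j))\<^sup>2)" if "j < n" for j
  proof -
    have "\<langle>?z, ?t j\<rangle>\<^bsub>X\<^esub> = (\<Sum>i<n. \<langle>?t i, ?t j\<rangle>\<^bsub>X\<^esub>)"
      using t by (subst X.cinner_lincomb) auto
    also have "\<dots> = (\<Sum>i<n. if i = j then \<langle>?t j, ?t j\<rangle>\<^bsub>X\<^esub> else 0)"
      by (rule sum.cong) (use \<xi> in \<open>auto simp: cinner_\<tau> W.orthogonal_frame_orth[OF frame]\<close>)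
    also have "\<dots> = \<langle>?t j, ?t j\<rangle>\<^bsub>X\<^esub>"
      using that by simp
    also have "\<dots> = of_real ((hnorm V (?a j))\<^sup>2 * (hnorm W (frame j))\<^sup>2)"
      using \<xi> by (simp only: cinner_\<tau> slice_closed frame_closed V.cinner_self W.cinner_self of_real_mult)
    finally show ?thesis
      using X.cinner_commute[of ?z "?t j"] by simp
  qed
  have "\<langle>?z, ?z\<rangle>\<^bsub>X\<^esub> = (\<Sum>j<n. of_real ((hnorm V (?a j))\<^sup>2 * (hnorm W (frame j))\<^sup>2))"
    using t by (subst X.cinner_lincomb) (auto simp: zt)
  then have "(hnorm X ?z)\<^sup>2 = (\<Sum>j<n. (hnorm V (?a j))\<^sup>2 * (hnorm W (frame j))\<^sup>2)"
    unfolding X.cinner_self[OF t(2)] of_real_sum[symmetric] of_real_eq_iff .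
  also have "\<dots> \<le> ?s"
    using f1 by (intro sum_mono mult_left_le) auto
  finally have z: "hnorm X ?z \<le> sqrt ?s"
    by (rule real_le_rsqrt)
  have "\<langle>?z, \<xi>\<rangle>\<^bsub>X\<^esub> = (\<Sum>j<n. of_real ((hnorm V (?a j))\<^sup>2))"
    using t \<xi> by (subst X.cinner_lincomb) (auto simp: cinner_slice V.cinner_self)
  then have "\<langle>?z, \<xi>\<rangle>\<^bsub>X\<^esub> = of_real ?s"
    by simp
  then have "?s = cmod \<langle>?z, \<xi>\<rangle>\<^bsub>X\<^esub>"
    using s0 by (simp only: norm_of_real abs_of_nonneg)
  also have "\<dots> \<le> sqrt ?s * hnorm X \<xi>"
    using X.cauchy_schwarz[of ?z \<xi>] z \<xi> mult_right_mono[OF z, of "hnorm X \<xi>"] by simp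
  finally have *: "sqrt ?s * sqrt ?s \<le> hnorm X \<xi> * sqrt ?s"
    using s0 by (simp add: mult.commute)
  have "sqrt ?s \<le> hnorm X \<xi>"
  proof (cases "sqrt ?s = 0")
    case False
    then have "sqrt ?s > 0"
      using real_sqrt_ge_zero[OF s0] by linarith
    then show ?thesis
      by (rule mult_right_le_imp_le[OF *])
  qed (use \<xi> in simp)
  then show ?thesis
    by (rule sqrt_le_D)
qed

lemma summable_slice: "\<xi> \<in> carrier X \<Longrightarrow> summable (\<lambda>j. (hnorm V (slice (frame j) \<xi>))\<^sup>2)"
  using sum_slice_le by (intro summableI_nonneg_bounded) auto

lemma suminf_slice_le: "\<xi> \<in> carrier X \<Longrightarrow> (\<Sum>j. (hnorm V (slice (frame j) \<xi>))\<^sup>2) \<le> (hnorm X \<xi>)\<^sup>2"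
  using sum_slice_le summable_slice by (intro suminf_le_const) auto

lemma square_summable_slice: "\<xi> \<in> carrier X \<Longrightarrow> square_summable V (\<lambda>j. slice (frame j) \<xi>)"
  using summable_slice by (auto simp: square_summable_def)

lemma sum_slice_prod_le:
  assumes \<xi>: "\<xi> \<in> carrier X" and \<eta>: "\<eta> \<in> carrier X"
  shows "(\<Sum>j<n. hnorm V (slice (frame j) \<xi>) * hnorm V (slice (frame j) \<eta>)) \<le> hnorm X \<xi> * hnorm X \<eta>"
proof -
  have "(\<Sum>j<n. hnorm V (slice (frame j) \<xi>) * hnorm V (slice (frame j) \<eta>))
      \<le> L2_set (\<lambda>j. hnorm V (slice (frame j) \<xi>)) {..<n} * L2_set (\<lambda>j. hnorm V (slice (frame j) \<eta>)) {..<n}"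
    using L2_set_mult_ineq[of "\<lambda>j. hnorm V (slice (frame j) \<xi>)" "\<lambda>j. hnorm V (slice (frame j) \<eta>)" "{..<n}"] \<xi> \<eta>
    by simp
  also have "\<dots> \<le> hnorm X \<xi> * hnorm X \<eta>"
    unfolding L2_set_def using sum_slice_le \<xi> \<eta>
    by (intro mult_mono real_le_lsqrt) (auto intro: sum_nonneg)
  finally show ?thesis .
qed

lemma norm_slice_op_le:
  assumes S: "S \<in> bounded_ops V" and B: "\<And>x. x \<in> carrier V \<Longrightarrow> hnorm V (S x) \<le> B * hnorm V x"
    and \<xi>: "\<xi> \<in> carrier X" and \<eta>: "\<eta> \<in> carrier X"
  shows "cmod \<langle>S (slice (frame j) \<xi>), slice (frame j) \<eta>\<rangle>\<^bsub>V\<^esub>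
    \<le> B * (hnorm V (slice (frame j) \<xi>) * hnorm V (slice (frame j) \<eta>))"
proof -
  have "cmod \<langle>S (slice (frame j) \<xi>), slice (frame j) \<eta>\<rangle>\<^bsub>V\<^esub>
      \<le> hnorm V (S (slice (frame j) \<xi>)) * hnorm V (slice (frame j) \<eta>)"
    using S \<xi> \<eta> by (intro V.cauchy_schwarz) auto
  also have "\<dots> \<le> B * hnorm V (slice (frame j) \<xi>) * hnorm V (slice (frame j) \<eta>)"
    using B \<xi> \<eta> by (intro mult_right_mono) auto
  finally show ?thesis
    by (simp add: mult.assoc)
qed

text \<open>Absolute convergence is what later permits regrouping into a double series in
  \<open>suminf_ampliation\<close>.\<close>

lemma summable_slice_op_norm:
  assumes S: "S \<in> bounded_ops V" and \<xi>: "\<xi> \<in> carrier X" and \<eta>: "\<eta> \<in> carrier X"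
  shows "summable (\<lambda>j. cmod \<langle>S (slice (frame j) \<xi>), slice (frame j) \<eta>\<rangle>\<^bsub>V\<^esub>)"
proof -
  obtain B where B: "\<And>x. x \<in> carrier V \<Longrightarrow> hnorm V (S x) \<le> B * hnorm V x"
    using V.bounded_ops_bound[OF S] by metis
  have "summable (\<lambda>j. B * (hnorm V (slice (frame j) \<xi>) * hnorm V (slice (frame j) \<eta>)))"
    by (intro summable_mult V.square_summable_prod square_summable_slice \<xi> \<eta>)
  then show ?thesis
    by (rule summable_comparison_test') (simp only: real_norm_def abs_norm_cancel norm_slice_op_le[OF S B \<xi> \<eta>])
qed

section \<open>Construction, adjoints and linearity of ampliations\<close>

definition slice_form :: "('a \<Rightarrow> 'a) \<Rightarrow> 'c \<Rightarrow> 'c \<Rightarrow> complex" where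
  "slice_form S \<xi> \<eta> = (\<Sum>j. \<langle>S (slice (frame j) \<xi>), slice (frame j) \<eta>\<rangle>\<^bsub>V\<^esub>)"

lemma slice_form_sums:
  "\<lbrakk>S \<in> bounded_ops V; \<xi> \<in> carrier X; \<eta> \<in> carrier X\<rbrakk>
    \<Longrightarrow> (\<lambda>j. \<langle>S (slice (frame j) \<xi>), slice (frame j) \<eta>\<rangle>\<^bsub>V\<^esub>) sums slice_form S \<xi> \<eta>"
  unfolding slice_form_def
  by (rule summable_sums[OF summable_norm_cancel[OF summable_slice_op_norm]])

text \<open>Outside \<open>bounded_ops V\<close> the choice may be arbitrary, so
  \<open>ampliation\<close> is restricted wherever it has to be an extensional map.\<close>

definition ampliation :: "('a \<Rightarrow> 'a) \<Rightarrow> 'c \<Rightarrow> 'c" where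
  "ampliation S = (SOME T. T \<in> bounded_ops X \<and>
     (\<forall>\<xi>\<in>carrier X. \<forall>\<eta>\<in>carrier X. \<langle>T \<xi>, \<eta>\<rangle>\<^bsub>X\<^esub> = slice_form S \<xi> \<eta>))"

lemma ampliation_props:
  assumes S: "S \<in> bounded_ops V"
  shows "ampliation S \<in> bounded_ops X \<and>
    (\<forall>\<xi>\<in>carrier X. \<forall>\<eta>\<in>carrier X. \<langle>ampliation S \<xi>, \<eta>\<rangle>\<^bsub>X\<^esub> = slice_form S \<xi> \<eta>)"
proof -
  obtain B where B: "B \<ge> 0" "\<And>x. x \<in> carrier V \<Longrightarrow> hnorm V (S x) \<le> B * hnorm V x"
    using V.bounded_ops_bound[OF S] by metis
  obtain T where "T \<in> bounded_ops X"
    "\<And>\<xi> \<eta>. \<lbrakk>\<xi> \<in> carrier X; \<eta> \<in> carrier X\<rbrakk> \<Longrightarrow> \<langle>T \<xi>, \<eta>\<rangle>\<^bsub>X\<^esub> = slice_form S \<xi> \<eta>"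
  proof (rule X.bounded_form_op[of "slice_form S" B])
    fix x y z assume *: "x \<in> carrier X" "y \<in> carrier X" "z \<in> carrier X"
    have "(\<lambda>j. \<langle>S (slice (frame j) (x \<oplus>\<^bsub>X\<^esub> y)), slice (frame j) z\<rangle>\<^bsub>V\<^esub>) sums
        (slice_form S x z + slice_form S y z)"
      using sums_add[OF slice_form_sums slice_form_sums, of S x z S y z] S *
      by (simp add: slice_add V.bounded_ops_add V.cinner_simps)
    then show "slice_form S (x \<oplus>\<^bsub>X\<^esub> y) z = slice_form S x z + slice_form S y z"
      using slice_form_sums[of S "x \<oplus>\<^bsub>X\<^esub> y" z] S * sums_unique2 by blast
    have "(\<lambda>j. \<langle>S (slice (frame j) x), slice (frame j) (y \<oplus>\<^bsub>X\<^esub> z)\<rangle>\<^bsub>V\<^esub>) sums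
        (slice_form S x y + slice_form S x z)"
      using sums_add[OF slice_form_sums slice_form_sums, of S x y S x z] S *
      by (simp add: slice_add V.cinner_simps)
    then show "slice_form S x (y \<oplus>\<^bsub>X\<^esub> z) = slice_form S x y + slice_form S x z"
      using slice_form_sums[of S x "y \<oplus>\<^bsub>X\<^esub> z"] S * sums_unique2 by blast
  next
    fix c x y assume *: "x \<in> carrier X" "y \<in> carrier X"
    have "(\<lambda>j. \<langle>S (slice (frame j) (c \<odot>\<^bsub>X\<^esub> x)), slice (frame j) y\<rangle>\<^bsub>V\<^esub>) sums (c * slice_form S x y)"
      using sums_mult[OF slice_form_sums, of S x y c] S *
      by (simp add: slice_smult V.bounded_ops_smult V.cinner_simps)
    then show "slice_form S (c \<odot>\<^bsub>X\<^esub> x) y = c * slice_form S x y"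
      using slice_form_sums[of S "c \<odot>\<^bsub>X\<^esub> x" y] S * sums_unique2 by blast
    have "(\<lambda>j. \<langle>S (slice (frame j) x), slice (frame j) (c \<odot>\<^bsub>X\<^esub> y)\<rangle>\<^bsub>V\<^esub>) sums (cnj c * slice_form S x y)"
      using sums_mult[OF slice_form_sums, of S x y "cnj c"] S *
      by (simp add: slice_smult V.cinner_simps)
    then show "slice_form S x (c \<odot>\<^bsub>X\<^esub> y) = cnj c * slice_form S x y"
      using slice_form_sums[of S x "c \<odot>\<^bsub>X\<^esub> y"] S * sums_unique2 by blast
    have "cmod (slice_form S x y) \<le> (\<Sum>j. cmod \<langle>S (slice (frame j) x), slice (frame j) y\<rangle>\<^bsub>V\<^esub>)"
      unfolding slice_form_def using S * by (intro summable_norm summable_slice_op_norm)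
    also have "\<dots> \<le> B * hnorm X x * hnorm X y"
    proof (rule suminf_le_const)
      fix n
      have "(\<Sum>j<n. cmod \<langle>S (slice (frame j) x), slice (frame j) y\<rangle>\<^bsub>V\<^esub>)
          \<le> B * (\<Sum>j<n. hnorm V (slice (frame j) x) * hnorm V (slice (frame j) y))"
        unfolding sum_distrib_left using S B * by (intro sum_mono norm_slice_op_le) auto
      also have "\<dots> \<le> B * (hnorm X x * hnorm X y)"
        using B(1) * by (intro mult_left_mono sum_slice_prod_le)
      finally show "(\<Sum>j<n. cmod \<langle>S (slice (frame j) x), slice (frame j) y\<rangle>\<^bsub>V\<^esub>) \<le> B * hnorm X x * hnorm X y"
        by (simp add: mult.assoc)
    qed (use S * summable_slice_op_norm in blast)
    finally show "cmod (slice_form S x y) \<le> B * hnorm X x * hnorm X y" .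
  qed (erule that, simp)
  then show ?thesis
    unfolding ampliation_def by (intro someI_ex[of "\<lambda>T. T \<in> bounded_ops X \<and> _ T"]) blast
qed

lemma ampliation_bounded [simp]: "S \<in> bounded_ops V \<Longrightarrow> ampliation S \<in> bounded_ops X"
  using ampliation_props by blast

lemma cinner_ampliation:
  "\<lbrakk>S \<in> bounded_ops V; \<xi> \<in> carrier X; \<eta> \<in> carrier X\<rbrakk>
    \<Longrightarrow> (\<lambda>j. \<langle>S (slice (frame j) \<xi>), slice (frame j) \<eta>\<rangle>\<^bsub>V\<^esub>) sums \<langle>ampliation S \<xi>, \<eta>\<rangle>\<^bsub>X\<^esub>"
  using slice_form_sums ampliation_props by simp

text \<open>Reduces the algebraic laws of \<open>ampliation\<close> to termwise identities between
  convergent series.\<close>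

lemma ampliation_eqI:
  assumes "S \<in> bounded_ops V" "T \<in> bounded_ops X"
    and "\<And>\<xi> \<eta>. \<lbrakk>\<xi> \<in> carrier X; \<eta> \<in> carrier X\<rbrakk>
      \<Longrightarrow> (\<lambda>j. \<langle>S (slice (frame j) \<xi>), slice (frame j) \<eta>\<rangle>\<^bsub>V\<^esub>) sums \<langle>T \<xi>, \<eta>\<rangle>\<^bsub>X\<^esub>"
  shows "ampliation S = T"
  using assms(1,2)
  by (intro X.op_cinner_ext) (auto intro: sums_unique2[OF cinner_ampliation[OF assms(1)] assms(3)])

lemma ampliation_adj:
  assumes S: "S \<in> bounded_ops V"
  shows "ampliation (op_adj V S) = op_adj X (ampliation S)"
proof (rule ampliation_eqI)
  fix \<xi> \<eta> assume *: "\<xi> \<in> carrier X" "\<eta> \<in> carrier X"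
  have "cnj \<langle>S (slice (frame j) \<eta>), slice (frame j) \<xi>\<rangle>\<^bsub>V\<^esub>
      = \<langle>op_adj V S (slice (frame j) \<xi>), slice (frame j) \<eta>\<rangle>\<^bsub>V\<^esub>" for j
    using S * V.cinner_commute[of "S (slice (frame j) \<eta>)" "slice (frame j) \<xi>"] by (simp add: V.cinner_op_adj')
  moreover have "cnj \<langle>ampliation S \<eta>, \<xi>\<rangle>\<^bsub>X\<^esub> = \<langle>op_adj X (ampliation S) \<xi>, \<eta>\<rangle>\<^bsub>X\<^esub>"
    using S * X.cinner_commute[of "ampliation S \<eta>" \<xi>] by (simp add: X.cinner_op_adj')
  ultimately show "(\<lambda>j. \<langle>op_adj V S (slice (frame j) \<xi>), slice (frame j) \<eta>\<rangle>\<^bsub>V\<^esub>) sums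
      \<langle>op_adj X (ampliation S) \<xi>, \<eta>\<rangle>\<^bsub>X\<^esub>"
    using cinner_ampliation[OF S *(2) *(1), THEN sums_cnj[THEN iffD2]] by simp
qed (use S in auto)

lemma ampliation_add:
  assumes S: "S \<in> bounded_ops V" and T: "T \<in> bounded_ops V"
  shows "ampliation (op_add V S T) = op_add X (ampliation S) (ampliation T)"
proof (rule ampliation_eqI)
  fix \<xi> \<eta> assume *: "\<xi> \<in> carrier X" "\<eta> \<in> carrier X"
  then show "(\<lambda>j. \<langle>op_add V S T (slice (frame j) \<xi>), slice (frame j) \<eta>\<rangle>\<^bsub>V\<^esub>) sums
      \<langle>op_add X (ampliation S) (ampliation T) \<xi>, \<eta>\<rangle>\<^bsub>X\<^esub>"
    using sums_add[OF cinner_ampliation[OF S *] cinner_ampliation[OF T *]] S T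
    by (simp add: op_add_def V.cinner_simps X.cinner_simps)
qed (use S T in auto)

lemma ampliation_smult:
  assumes S: "S \<in> bounded_ops V"
  shows "ampliation (op_smult V c S) = op_smult X c (ampliation S)"
proof (rule ampliation_eqI)
  fix \<xi> \<eta> assume *: "\<xi> \<in> carrier X" "\<eta> \<in> carrier X"
  then show "(\<lambda>j. \<langle>op_smult V c S (slice (frame j) \<xi>), slice (frame j) \<eta>\<rangle>\<^bsub>V\<^esub>) sums
      \<langle>op_smult X c (ampliation S) \<xi>, \<eta>\<rangle>\<^bsub>X\<^esub>"
    using sums_mult[OF cinner_ampliation[OF S *], of c] S
    by (simp add: op_smult_def V.cinner_simps X.cinner_simps)
qed (use S in auto)

end

section \<open>Elementary tensors, products, rank-one operators and normality\<close>

context tensor_isometry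
begin

text \<open>The slice in the other variable, that is, the adjoint of \<open>\<tau> x\<close>. The
  flipped interpretation stays local to the proof.\<close>

lemma cinner_flip_slice:
  assumes "x \<in> carrier V"
  obtains u where "\<And>\<xi>. \<xi> \<in> carrier X \<Longrightarrow> u \<xi> \<in> carrier W"
    "\<And>\<xi> w. \<lbrakk>\<xi> \<in> carrier X; w \<in> carrier W\<rbrakk> \<Longrightarrow> \<langle>\<tau> x w, \<xi>\<rangle>\<^bsub>X\<^esub> = \<langle>w, u \<xi>\<rangle>\<^bsub>W\<^esub>"
proof -
  interpret F: tensor_isometry W V X "\<lambda>w x. \<tau> x w"
    by (rule flip)
  show ?thesis
    by (rule that[of "F.slice x"]) (use assms F.cinner_slice in auto)
qed

text \<open>With \<open>u\<close> adjoint to \<open>\<tau> x\<close>, the terms are those of the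
  frame expansion of \<open>\<langle>w, u \<eta>\<rangle>\<close> in \<open>W\<close>.\<close>

lemma slice_expansion:
  assumes x: "x \<in> carrier V" and w: "w \<in> carrier W" and \<eta>: "\<eta> \<in> carrier X"
  shows "(\<lambda>j. \<langle>w, frame j\<rangle>\<^bsub>W\<^esub> * \<langle>x, slice (frame j) \<eta>\<rangle>\<^bsub>V\<^esub>) sums \<langle>\<tau> x w, \<eta>\<rangle>\<^bsub>X\<^esub>"
proof -
  obtain u where u: "\<And>\<xi>. \<xi> \<in> carrier X \<Longrightarrow> u \<xi> \<in> carrier W"
    "\<And>\<xi> w. \<lbrakk>\<xi> \<in> carrier X; w \<in> carrier W\<rbrakk> \<Longrightarrow> \<langle>\<tau> x w, \<xi>\<rangle>\<^bsub>X\<^esub> = \<langle>w, u \<xi>\<rangle>\<^bsub>W\<^esub>"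
    by (rule cinner_flip_slice[OF x]) blast
  have "\<langle>x, slice (frame j) \<eta>\<rangle>\<^bsub>V\<^esub> = \<langle>frame j, u \<eta>\<rangle>\<^bsub>W\<^esub>" for j
    using u(2)[OF \<eta> frame_closed] cinner_slice[OF frame_closed \<eta> x] by simp
  then show ?thesis
    using W.orthogonal_frame_sums[OF frame w u(1)[OF \<eta>]] u(2)[OF \<eta> w] by simp
qed

text \<open>The slices of \<open>\<tau> x w\<close> are multiples of \<open>x\<close>, so the
  defining series becomes the slice expansion of \<open>\<tau> (S x) w\<close>.\<close>

lemma ampliation_\<tau>:
  assumes S: "S \<in> bounded_ops V" and x: "x \<in> carrier V" and w: "w \<in> carrier W"
  shows "ampliation S (\<tau> x w) = \<tau> (S x) w"
proof (rule X.cinner_ext)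
  fix \<eta> assume \<eta>: "\<eta> \<in> carrier X"
  have "(\<lambda>j. \<langle>w, frame j\<rangle>\<^bsub>W\<^esub> * \<langle>S x, slice (frame j) \<eta>\<rangle>\<^bsub>V\<^esub>) sums \<langle>ampliation S (\<tau> x w), \<eta>\<rangle>\<^bsub>X\<^esub>"
    using cinner_ampliation[OF S \<tau>_closed[OF x w] \<eta>] S x w \<eta>
    by (simp add: slice_\<tau> V.bounded_ops_smult V.cinner_simps)
  then show "\<langle>ampliation S (\<tau> x w), \<eta>\<rangle>\<^bsub>X\<^esub> = \<langle>\<tau> (S x) w, \<eta>\<rangle>\<^bsub>X\<^esub>"
    by (rule sums_unique2) (use S x w \<eta> slice_expansion in simp)
qed (use S x w in auto)

text \<open>Dual to \<open>ampliation_\<tau>\<close>, through the adjoint of \<open>S\<close>. It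
  makes multiplicativity of \<open>ampliation\<close> a termwise identity.\<close>

lemma slice_ampliation:
  assumes S: "S \<in> bounded_ops V" and w: "w \<in> carrier W" and \<xi>: "\<xi> \<in> carrier X"
  shows "slice w (ampliation S \<xi>) = S (slice w \<xi>)"
proof (rule V.cinner_ext_right)
  fix x assume x: "x \<in> carrier V"
  have "\<langle>x, slice w (ampliation S \<xi>)\<rangle>\<^bsub>V\<^esub> = \<langle>\<tau> x w, ampliation S \<xi>\<rangle>\<^bsub>X\<^esub>"
    using S w \<xi> x by (simp add: cinner_slice)
  also have "\<dots> = \<langle>\<tau> (op_adj V S x) w, \<xi>\<rangle>\<^bsub>X\<^esub>"
    using S w \<xi> x by (simp flip: X.cinner_op_adj' ampliation_adj add: ampliation_\<tau>)
  also have "\<dots> = \<langle>x, S (slice w \<xi>)\<rangle>\<^bsub>V\<^esub>"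
    using S w \<xi> x by (simp add: cinner_slice V.cinner_op_adj')
  finally show "\<langle>x, slice w (ampliation S \<xi>)\<rangle>\<^bsub>V\<^esub> = \<langle>x, S (slice w \<xi>)\<rangle>\<^bsub>V\<^esub>" .
qed (use S w \<xi> in auto)

lemma ampliation_mult:
  assumes S: "S \<in> bounded_ops V" and T: "T \<in> bounded_ops V"
  shows "ampliation (op_mult V S T) = op_mult X (ampliation S) (ampliation T)"
proof (rule ampliation_eqI)
  fix \<xi> \<eta> assume *: "\<xi> \<in> carrier X" "\<eta> \<in> carrier X"
  then show "(\<lambda>j. \<langle>op_mult V S T (slice (frame j) \<xi>), slice (frame j) \<eta>\<rangle>\<^bsub>V\<^esub>) sums
      \<langle>op_mult X (ampliation S) (ampliation T) \<xi>, \<eta>\<rangle>\<^bsub>X\<^esub>"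
    using cinner_ampliation[OF S X.bounded_ops_closed[OF ampliation_bounded[OF T] *(1)] *(2)] S T
    by (simp add: compose_eq slice_ampliation)
qed (use S T in auto)

text \<open>Here \<open>p\<close> and \<open>q\<close> are the adjoints of \<open>\<tau> x\<close>
  and \<open>\<tau> y\<close>, so \<open>A\<close> is \<open>\<tau> x\<close> composed with
  \<open>q\<close>. The series is the frame expansion of
  \<open>\<langle>q \<xi>, p \<eta>\<rangle>\<close>.\<close>

lemma ampliation_rank_one:
  assumes x: "x \<in> carrier V" and y: "y \<in> carrier V"
    and p: "\<And>\<eta>. \<eta> \<in> carrier X \<Longrightarrow> p \<eta> \<in> carrier W"
      "\<And>\<eta> w. \<lbrakk>\<eta> \<in> carrier X; w \<in> carrier W\<rbrakk> \<Longrightarrow> \<langle>\<tau> x w, \<eta>\<rangle>\<^bsub>X\<^esub> = \<langle>w, p \<eta>\<rangle>\<^bsub>W\<^esub>"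
    and q: "\<And>\<xi>. \<xi> \<in> carrier X \<Longrightarrow> q \<xi> \<in> carrier W"
      "\<And>\<xi> w. \<lbrakk>\<xi> \<in> carrier X; w \<in> carrier W\<rbrakk> \<Longrightarrow> \<langle>\<tau> y w, \<xi>\<rangle>\<^bsub>X\<^esub> = \<langle>w, q \<xi>\<rangle>\<^bsub>W\<^esub>"
    and A: "A \<in> bounded_ops X"
      "\<And>\<xi> \<eta>. \<lbrakk>\<xi> \<in> carrier X; \<eta> \<in> carrier X\<rbrakk> \<Longrightarrow> \<langle>A \<xi>, \<eta>\<rangle>\<^bsub>X\<^esub> = \<langle>q \<xi>, p \<eta>\<rangle>\<^bsub>W\<^esub>"
  shows "ampliation (rank_one V x y) = A"
proof (rule ampliation_eqI)
  fix \<xi> \<eta> assume \<xi>: "\<xi> \<in> carrier X" and \<eta>: "\<eta> \<in> carrier X"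
  have "\<langle>slice (frame j) \<xi>, y\<rangle>\<^bsub>V\<^esub> = \<langle>q \<xi>, frame j\<rangle>\<^bsub>W\<^esub>" for j
  proof -
    have "\<langle>y, slice (frame j) \<xi>\<rangle>\<^bsub>V\<^esub> = \<langle>frame j, q \<xi>\<rangle>\<^bsub>W\<^esub>"
      using q(2)[OF \<xi> frame_closed] cinner_slice[OF frame_closed \<xi> y] by simp
    then show ?thesis
      using V.cinner_commute[of y "slice (frame j) \<xi>"] W.cinner_commute[of "frame j" "q \<xi>"] \<xi> y q(1)
      by simp
  qed
  moreover have "\<langle>x, slice (frame j) \<eta>\<rangle>\<^bsub>V\<^esub> = \<langle>frame j, p \<eta>\<rangle>\<^bsub>W\<^esub>" for j
    using p(2)[OF \<eta> frame_closed] cinner_slice[OF frame_closed \<eta> x] by simp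
  ultimately show "(\<lambda>j. \<langle>rank_one V x y (slice (frame j) \<xi>), slice (frame j) \<eta>\<rangle>\<^bsub>V\<^esub>) sums \<langle>A \<xi>, \<eta>\<rangle>\<^bsub>X\<^esub>"
    using W.orthogonal_frame_sums[OF frame q(1)[OF \<xi>] p(1)[OF \<eta>]] x y \<xi> \<eta>
    by (simp add: rank_one_def V.cinner_simps A(2))
qed (use x y A(1) in auto)

text \<open>\<open>ampliation (op_one V)\<close> is the projection onto the closed span of the elementary tensors.\<close>

lemma op_mult_ampliation_one_cong:
  assumes C: "C \<in> bounded_ops X" and D: "D \<in> bounded_ops X"
    and eq: "\<And>x w. \<lbrakk>x \<in> carrier V; w \<in> carrier W\<rbrakk> \<Longrightarrow> C (\<tau> x w) = D (\<tau> x w)"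
  shows "op_mult X C (ampliation (op_one V)) = op_mult X D (ampliation (op_one V))"
proof (rule X.op_cinner_ext)
  fix \<xi> \<eta> assume *: "\<xi> \<in> carrier X" "\<eta> \<in> carrier X"
  \<comment> \<open>Moving \<open>A\<close> to the other side as an adjoint exhibits the product as
    a series involving only values of \<open>A\<close> on elementary tensors.\<close>
  have *: "(\<lambda>j. \<langle>A (\<tau> (slice (frame j) \<xi>) (frame j)), \<eta>\<rangle>\<^bsub>X\<^esub>) sums
      \<langle>op_mult X A (ampliation (op_one V)) \<xi>, \<eta>\<rangle>\<^bsub>X\<^esub>" if A: "A \<in> bounded_ops X" for A
  proof -
    have "\<langle>op_one V (slice (frame j) \<xi>), slice (frame j) (op_adj X A \<eta>)\<rangle>\<^bsub>V\<^esub>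
        = \<langle>A (\<tau> (slice (frame j) \<xi>) (frame j)), \<eta>\<rangle>\<^bsub>X\<^esub>" for j
      using A * by (simp add: op_one_def X.cinner_op_adj[OF A] cinner_slice)
    moreover have "\<langle>ampliation (op_one V) \<xi>, op_adj X A \<eta>\<rangle>\<^bsub>X\<^esub>
        = \<langle>op_mult X A (ampliation (op_one V)) \<xi>, \<eta>\<rangle>\<^bsub>X\<^esub>"
      using A * by (simp add: compose_eq X.cinner_op_adj[OF A])
    ultimately show ?thesis
      using cinner_ampliation[of "op_one V" \<xi> "op_adj X A \<eta>"] A * by simp
  qed
  have "(\<lambda>j. \<langle>D (\<tau> (slice (frame j) \<xi>) (frame j)), \<eta>\<rangle>\<^bsub>X\<^esub>) sums
      \<langle>op_mult X C (ampliation (op_one V)) \<xi>, \<eta>\<rangle>\<^bsub>X\<^esub>"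
    using *[OF C] eq \<open>\<xi> \<in> carrier X\<close> by simp
  then show "\<langle>op_mult X C (ampliation (op_one V)) \<xi>, \<eta>\<rangle>\<^bsub>X\<^esub>
      = \<langle>op_mult X D (ampliation (op_one V)) \<xi>, \<eta>\<rangle>\<^bsub>X\<^esub>"
    by (rule sums_unique2[OF _ *[OF D]])
qed (use C D in auto)

text \<open>Adjoints are compared because \<open>total\<close> concerns vectors orthogonal to all
  elementary tensors: the difference of the two adjoints applied to any vector is such a
  vector.\<close>

lemma ampliation_unique:
  assumes total: "\<And>\<eta>. \<lbrakk>\<eta> \<in> carrier X; \<And>x w. \<lbrakk>x \<in> carrier V; w \<in> carrier W\<rbrakk> \<Longrightarrow> \<langle>\<tau> x w, \<eta>\<rangle>\<^bsub>X\<^esub> = 0\<rbrakk>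
      \<Longrightarrow> \<eta> = \<zero>\<^bsub>X\<^esub>"
    and S: "S \<in> bounded_ops V" and T: "T \<in> bounded_ops X"
    and eq: "\<And>x w. \<lbrakk>x \<in> carrier V; w \<in> carrier W\<rbrakk> \<Longrightarrow> T (\<tau> x w) = \<tau> (S x) w"
  shows "T = ampliation S"
proof -
  have "op_adj X T = op_adj X (ampliation S)"
  proof (rule X.op_ext)
    fix \<eta> assume \<eta>: "\<eta> \<in> carrier X"
    have "op_adj X T \<eta> \<ominus>\<^bsub>X\<^esub> op_adj X (ampliation S) \<eta> = \<zero>\<^bsub>X\<^esub>"
    proof (rule total)
      fix x w assume "x \<in> carrier V" "w \<in> carrier W"
      then show "\<langle>\<tau> x w, op_adj X T \<eta> \<ominus>\<^bsub>X\<^esub> op_adj X (ampliation S) \<eta>\<rangle>\<^bsub>X\<^esub> = 0"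
        using S T \<eta> by (simp add: X.cinner_simps eq ampliation_\<tau> flip: X.cinner_op_adj)
    qed (use S T \<eta> in simp)
    then show "op_adj X T \<eta> = op_adj X (ampliation S) \<eta>"
      using S T \<eta> by (simp add: X.minus_eq_zero_iff)
  qed (use S T in auto)
  then show ?thesis
    using X.op_adj_adj S T by (metis ampliation_bounded)
qed

text \<open>The functionals defining \<open>\<sigma>\<close>-weak continuity are single series, whence the enumeration.\<close>

definition slices :: "(nat \<Rightarrow> 'c) \<Rightarrow> nat \<Rightarrow> 'a" where
  "slices \<xi> k = (case prod_decode k of (n, j) \<Rightarrow> slice (frame j) (\<xi> n))"

text \<open>The terms are nonnegative, so iterated summation suffices;
  \<open>suminf_slice_le\<close> dominates the inner sum at \<open>n\<close> by the squared norm of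
  \<open>\<xi> n\<close>.\<close>

lemma summable_on_slices:
  assumes \<xi>: "square_summable X \<xi>"
  shows "(\<lambda>(n, j). (hnorm V (slice (frame j) (\<xi> n)))\<^sup>2) summable_on (UNIV \<times> UNIV)"
proof (rule summable_on_SigmaI)
  note [simp] = X.square_summable_closed[OF \<xi>]
  let ?g = "\<lambda>n. \<Sum>j. (hnorm V (slice (frame j) (\<xi> n)))\<^sup>2"
  show "((\<lambda>j. case (n, j) of (n, j) \<Rightarrow> (hnorm V (slice (frame j) (\<xi> n)))\<^sup>2) has_sum ?g n) UNIV" for n
    by (simp add: sums_nonneg_imp_has_sum summable_sums summable_slice)
  have g0: "0 \<le> ?g n" for n
    by (intro suminf_nonneg summable_slice) auto
  have "summable ?g"
    by (rule summable_comparison_test'[of "\<lambda>n. (hnorm X (\<xi> n))\<^sup>2"])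
      (use \<xi> g0 in \<open>auto simp: square_summable_def suminf_slice_le\<close>)
  then show "?g summable_on UNIV"
    using g0 by (simp add: summable_on_UNIV_nonneg_real_iff)
qed auto

lemma square_summable_slices:
  assumes \<xi>: "square_summable X \<xi>"
  shows "square_summable V (slices \<xi>)"
proof -
  have "(\<lambda>k. case prod_decode k of (n, j) \<Rightarrow> (hnorm V (slice (frame j) (\<xi> n)))\<^sup>2) summable_on UNIV"
    using summable_on_slices[OF \<xi>] bij_prod_decode
      summable_on_reindex_bij_betw[of prod_decode UNIV UNIV "\<lambda>(n, j). (hnorm V (slice (frame j) (\<xi> n)))\<^sup>2"]
    by simp
  then have "summable (\<lambda>k. (hnorm V (slices \<xi> k))\<^sup>2)"
    unfolding slices_def by (intro summable_on_imp_summable) (simp add: case_prod_unfold)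
  then show ?thesis
    using X.square_summable_closed[OF \<xi>]
    by (auto simp: square_summable_def slices_def case_prod_unfold)
qed

text \<open>Both sides are sums of one double series, taken iteratedly on the left and along
  \<open>prod_decode\<close> on the right. Absolute summability follows from the product of two
  norms being at most the sum of their squares.\<close>

lemma suminf_ampliation:
  assumes S: "S \<in> bounded_ops V" and \<xi>: "square_summable X \<xi>" and \<eta>: "square_summable X \<eta>"
  shows "(\<Sum>n. \<langle>ampliation S (\<xi> n), \<eta> n\<rangle>\<^bsub>X\<^esub>) = (\<Sum>k. \<langle>S (slices \<xi> k), slices \<eta> k\<rangle>\<^bsub>V\<^esub>)"
proof -
  note [simp] = X.square_summable_closed[OF \<xi>] X.square_summable_closed[OF \<eta>]
  let ?h = "\<lambda>(n, j). \<langle>S (slice (frame j) (\<xi> n)), slice (frame j) (\<eta> n)\<rangle>\<^bsub>V\<^esub>"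
  obtain B where B: "B \<ge> 0" "\<And>x. x \<in> carrier V \<Longrightarrow> hnorm V (S x) \<le> B * hnorm V x"
    using V.bounded_ops_bound[OF S] by metis
  have "(\<lambda>p. norm (?h p)) summable_on (UNIV \<times> UNIV)"
  proof (rule Infinite_Sum.abs_summable_on_comparison_test')
    show "(\<lambda>p. B * ((\<lambda>(n, j). (hnorm V (slice (frame j) (\<xi> n)))\<^sup>2) p
        + (\<lambda>(n, j). (hnorm V (slice (frame j) (\<eta> n)))\<^sup>2) p)) summable_on (UNIV \<times> UNIV)"
      by (intro summable_on_cmult_right summable_on_add summable_on_slices \<xi> \<eta>)
    fix p :: "nat \<times> nat"
    obtain n j where p: "p = (n, j)"
      by fastforce
    let ?a = "hnorm V (slice (frame j) (\<xi> n))" and ?b = "hnorm V (slice (frame j) (\<eta> n))"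
    have "0 \<le> ?a" "0 \<le> ?b"
      by simp_all
    then have "0 \<le> ?a * ?b" "2 * (?a * ?b) \<le> ?a\<^sup>2 + ?b\<^sup>2"
      using sum_squares_bound[of ?a ?b] by (simp_all add: mult.assoc)
    then have "?a * ?b \<le> ?a\<^sup>2 + ?b\<^sup>2"
      by linarith
    from order_trans[OF norm_slice_op_le[OF S B(2)] mult_left_mono[OF this B(1)]]
    show "norm (?h p) \<le> B * ((\<lambda>(n, j). (hnorm V (slice (frame j) (\<xi> n)))\<^sup>2) p
        + (\<lambda>(n, j). (hnorm V (slice (frame j) (\<eta> n)))\<^sup>2) p)"
      by (simp add: p)
  qed
  then have "?h summable_on (UNIV \<times> UNIV)"
    by (rule Infinite_Sum.abs_summable_summable)
  then obtain s where s: "(?h has_sum s) (UNIV \<times> UNIV)"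
    by (auto simp: summable_on_def)
  have "((\<lambda>n. \<langle>ampliation S (\<xi> n), \<eta> n\<rangle>\<^bsub>X\<^esub>) has_sum s) UNIV"
  proof (rule has_sum_SigmaD[OF s])
    show "((\<lambda>j. ?h (n, j)) has_sum \<langle>ampliation S (\<xi> n), \<eta> n\<rangle>\<^bsub>X\<^esub>) UNIV" for n
      using norm_summable_imp_has_sum[OF summable_slice_op_norm[OF S] cinner_ampliation[OF S], of "\<xi> n" "\<eta> n"]
      by simp
  qed
  moreover have "((\<lambda>k. ?h (prod_decode k)) has_sum s) UNIV"
    using s has_sum_reindex_bij_betw[OF bij_prod_decode, of ?h s] by simp
  then have "((\<lambda>k. \<langle>S (slices \<xi> k), slices \<eta> k\<rangle>\<^bsub>V\<^esub>) has_sum s) UNIV"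
    by (simp add: slices_def case_prod_unfold)
  ultimately show ?thesis
    using has_sum_imp_sums sums_unique by metis
qed

text \<open>By \<open>suminf_ampliation\<close> the preimage of a subbasic set is again subbasic,
  given by the enumerated slices.\<close>

lemma continuous_map_ampliation:
  "continuous_map (sigma_weak V) (sigma_weak X) (restrict ampliation (bounded_ops V))"
  unfolding sigma_weak_def[of X]
proof (rule continuous_on_generated_topo)
  let ?\<pi> = "restrict ampliation (bounded_ops V)"
  show "?\<pi> ` topspace (sigma_weak V) \<subseteq> \<Union> {{T \<in> bounded_ops X. (\<Sum>n. \<langle>T (\<xi> n), \<eta> n\<rangle>\<^bsub>X\<^esub>) \<in> U} | \<xi> \<eta> U.
        square_summable X \<xi> \<and> square_summable X \<eta> \<and> open U}"
    using X.topspace_sigma_weak by (auto simp: sigma_weak_def[of X])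
  fix A assume "A \<in> {{T \<in> bounded_ops X. (\<Sum>n. \<langle>T (\<xi> n), \<eta> n\<rangle>\<^bsub>X\<^esub>) \<in> U} | \<xi> \<eta> U.
        square_summable X \<xi> \<and> square_summable X \<eta> \<and> open U}"
  then obtain \<xi> \<eta> U where \<xi>: "square_summable X \<xi>" and \<eta>: "square_summable X \<eta>" and U: "open U"
    and A: "A = {T \<in> bounded_ops X. (\<Sum>n. \<langle>T (\<xi> n), \<eta> n\<rangle>\<^bsub>X\<^esub>) \<in> U}"
    by blast
  have "?\<pi> -` A \<inter> topspace (sigma_weak V)
      = {S \<in> bounded_ops V. (\<Sum>k. \<langle>S (slices \<xi> k), slices \<eta> k\<rangle>\<^bsub>V\<^esub>) \<in> U}"
    using suminf_ampliation[OF _ \<xi> \<eta>] by (auto simp: A)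
  then show "openin (sigma_weak V) (?\<pi> -` A \<inter> topspace (sigma_weak V))"
    using V.openin_sigma_weak[OF square_summable_slices[OF \<xi>] square_summable_slices[OF \<eta>] U] by simp
qed

lemma star_hom_ampliation_bounded: "star_hom V (bounded_ops V) X (restrict ampliation (bounded_ops V))"
  unfolding star_hom_def
  by (auto simp: ampliation_add ampliation_smult ampliation_mult ampliation_adj)

lemma star_hom_ampliation_compact: "star_hom V (compact_ops V) X (restrict ampliation (compact_ops V))"
  unfolding star_hom_def
  by (auto simp: ampliation_add ampliation_smult ampliation_mult ampliation_adj)

end

text \<open>Truncations are finite sums of rank-one operators and converge \<open>\<sigma>\<close>-weakly.\<close>

lemma normal_star_hom_unique:
  assumes V: "separable_hilbert_space V" and X: "separable_hilbert_space X"
    and hom: "star_hom V (bounded_ops V) X \<pi>" "star_hom V (bounded_ops V) X \<pi>'"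
    and cont: "continuous_map (sigma_weak V) (sigma_weak X) \<pi>" "continuous_map (sigma_weak V) (sigma_weak X) \<pi>'"
    and eq: "\<And>x y. \<lbrakk>x \<in> carrier V; y \<in> carrier V\<rbrakk> \<Longrightarrow> \<pi> (rank_one V x y) = \<pi>' (rank_one V x y)"
  shows "\<pi> = \<pi>'"
proof -
  interpret V: separable_hilbert_space V by fact
  interpret X: separable_hilbert_space X by fact
  obtain e where e: "orthogonal_frame V e"
    using V.ex_orthogonal_frame by blast
  have bounded: "\<pi> T \<in> bounded_ops X" "\<pi>' T \<in> bounded_ops X" if "T \<in> bounded_ops V" for T
    using hom that by (auto simp: star_hom_def)
  have "\<pi> T = \<pi>' T" if T: "T \<in> bounded_ops V" for T
  proof (rule X.op_cinner_ext)
    have trunc: "\<pi> (truncation V T e n) = \<pi>' (truncation V T e n)" for n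
    proof (induction n)
      case 0
      \<comment> \<open>Truncations start from a scalar multiple of the identity, so the scalar law
        of a homomorphism settles the base case.\<close>
      have smult: "\<rho> (op_smult V 0 (op_one V)) = op_smult X 0 (\<rho> (op_one V))"
        if "star_hom V (bounded_ops V) X \<rho>" for \<rho>
        using that V.op_one_bounded unfolding star_hom_def by blast
      have "op_smult X 0 (\<pi> (op_one V)) = op_smult X 0 (\<pi>' (op_one V))"
        by (rule X.op_cinner_ext) (simp_all add: bounded, simp add: op_smult_def bounded X.cinner_simps)
      then show ?case
        by (simp add: smult hom)
    next
      case (Suc n)
      have "\<rho> (truncation V T e (Suc n)) = op_add X (\<rho> (truncation V T e n)) (\<rho> (rank_one V (T (e n)) (e n)))"
        if "star_hom V (bounded_ops V) X \<rho>" for \<rho>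
        using that e T by (simp add: star_hom_def)
      then show ?case
        using Suc hom e T by (simp add: eq)
    qed
    fix h k assume *: "h \<in> carrier X" "k \<in> carrier X"
    \<comment> \<open>Matrix coefficients are \<sigma>-weakly continuous, so continuity of
      \<open>\<rho>\<close> carries the convergence of truncations over to them.\<close>
    have lim: "(\<lambda>n. \<langle>\<rho> (truncation V T e n) h, k\<rangle>\<^bsub>X\<^esub>) \<longlonglongrightarrow> \<langle>\<rho> T h, k\<rangle>\<^bsub>X\<^esub>"
      if "continuous_map (sigma_weak V) (sigma_weak X) \<rho>" for \<rho>
      using continuous_map_limit[OF continuous_map_compose[OF that X.continuous_map_cinner_sigma_weak[OF *]]
          V.truncation_tendsto[OF e T]]
      by (simp add: o_def)
    show "\<langle>\<pi> T h, k\<rangle>\<^bsub>X\<^esub> = \<langle>\<pi>' T h, k\<rangle>\<^bsub>X\<^esub>"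
      using lim[OF cont(1)] lim[OF cont(2)] LIMSEQ_unique by (simp add: trunc)
  qed (use T bounded in auto)
  then show ?thesis
    using hom by (intro extensionalityI[of _ "bounded_ops V"]) (auto simp: star_hom_def PiE_def)
qed

section \<open>Representations of product systems\<close>

context quasi_lattice_ordered
begin

lemma P_in_carrier [simp]: "s \<in> P \<Longrightarrow> s \<in> carrier G"
  using P_subset by blast

lemma left_le_antisym:
  assumes "r \<in> P" "r' \<in> P" "left_le G P r r'" "left_le G P r' r"
  shows "r = r'"
proof -
  have "inv r \<otimes> r' = inv (inv r' \<otimes> r)"
    using assms by (simp add: inv_mult_group)
  then have "inv r \<otimes> r' \<in> P \<inter> (\<lambda>s. inv s) ` P"
    using assms by (auto simp: left_le_def)
  then have "inv r \<otimes> r' = \<one>"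
    using P_inter_inv by blast
  then show ?thesis
    using assms by (metis P_in_carrier inv_closed inv_inv inv_equality)
qed

text \<open>Antisymmetry makes least upper bounds unique, so the definite description in
  \<open>join\<close> denotes the one provided by the order axiom.\<close>

lemma join_SomeD:
  assumes s: "s \<in> P" and t: "t \<in> P" and j: "join G P s t = Some r"
  shows "r \<in> P" "left_le G P s r" "left_le G P t r"
proof -
  have ex: "\<exists>u. upper_bound G P {s, t} u"
    using j by (auto simp: join_def split: if_splits)
  then obtain q where q: "least_upper_bound G P {s, t} q"
    using ex_least_upper_bound[of "{s, t}"] s t by auto
  have "(THE r. least_upper_bound G P {s, t} r) = q"
  proof (rule the_equality)
    show "least_upper_bound G P {s, t} q"
      by (rule q)
    fix r assume "least_upper_bound G P {s, t} r"
    then show "r = q"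
      using q by (intro left_le_antisym) (auto simp: least_upper_bound_def upper_bound_def)
  qed
  then have "r = q"
    using j ex by (simp add: join_def)
  then show "r \<in> P" "left_le G P s r" "left_le G P t r"
    using q by (auto simp: least_upper_bound_def upper_bound_def)
qed

end

section \<open>Representations and multiplications as tensor isometries\<close>

locale product_system_representation =
  quasi_lattice_ordered G P + product_system G P E + H: separable_hilbert_space H
  for G :: "'g monoid" (structure) and P :: "'g set" and E :: "('g, 'e) prod_system"
    and H :: "'h inner_module" +
  fixes \<phi> :: "'e \<Rightarrow> 'h \<Rightarrow> 'h"
  assumes rep: "representation E H \<phi>"
begin

lemma fibre_total: "\<lbrakk>t \<in> P; x \<in> carrier (fibre E t)\<rbrakk> \<Longrightarrow> x \<in> total E \<and> proj E x = t"
  by (simp add: carrier_fibre)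

lemma \<phi>_bounded: "\<lbrakk>t \<in> P; x \<in> carrier (fibre E t)\<rbrakk> \<Longrightarrow> \<phi> x \<in> bounded_ops H"
  using rep fibre_total by (auto simp: representation_def)

lemma \<phi>_mult:
  "\<lbrakk>s \<in> P; t \<in> P; x \<in> carrier (fibre E s); y \<in> carrier (fibre E t); h \<in> carrier H\<rbrakk>
    \<Longrightarrow> \<phi> (x \<cdot>\<^bsub>E\<^esub> y) h = \<phi> x (\<phi> y h)"
  using rep fibre_total by (simp add: representation_def compose_eq)

text \<open>The second axiom of a representation, evaluated at \<open>h\<close> and paired with
  \<open>k\<close>; this is the isometry condition for \<open>\<tau> = \<phi>\<close>.\<close>

lemma cinner_\<phi>:
  assumes t: "t \<in> P" and xy: "x \<in> carrier (fibre E t)" "y \<in> carrier (fibre E t)"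
    and hk: "h \<in> carrier H" "k \<in> carrier H"
  shows "\<langle>\<phi> x h, \<phi> y k\<rangle>\<^bsub>H\<^esub> = \<langle>x, y\<rangle>\<^bsub>fibre E t\<^esub> * \<langle>h, k\<rangle>\<^bsub>H\<^esub>"
proof -
  note b = \<phi>_bounded[OF t xy(1)] \<phi>_bounded[OF t xy(2)]
  have "op_mult H (op_adj H (\<phi> y)) (\<phi> x) = op_smult H (\<langle>x, y\<rangle>\<^bsub>fibre E t\<^esub>) (op_one H)"
    using rep fibre_total[OF t xy(1)] fibre_total[OF t xy(2)] unfolding representation_def by metis
  from fun_cong[OF this, of h]
  have "op_adj H (\<phi> y) (\<phi> x h) = \<langle>x, y\<rangle>\<^bsub>fibre E t\<^esub> \<odot>\<^bsub>H\<^esub> h"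
    using hk by (simp add: compose_eq op_smult_def op_one_def)
  then show ?thesis
    using H.cinner_op_adj'[OF b(2), of "\<phi> x h" k] b hk by (simp add: H.cinner_simps)
qed

lemma tensor_\<phi>: "t \<in> P \<Longrightarrow> tensor_isometry (fibre E t) H H \<phi>"
  by (intro tensor_isometry.intro tensor_isometry_axioms.intro fibre_hilbert H.separable_hilbert_space_axioms)
    (use \<phi>_bounded cinner_\<phi> in auto)

lemma tensor_pmult:
  assumes s: "s \<in> P" and r: "r \<in> P" and le: "left_le G P s r"
  shows "tensor_isometry (fibre E s) (fibre E (inv s \<otimes> r)) (fibre E r) (pmult E)"
    and "\<And>\<eta>. \<lbrakk>\<eta> \<in> carrier (fibre E r);
        \<And>x y. \<lbrakk>x \<in> carrier (fibre E s); y \<in> carrier (fibre E (inv s \<otimes> r))\<rbrakk>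
          \<Longrightarrow> \<langle>x \<cdot>\<^bsub>E\<^esub> y, \<eta>\<rangle>\<^bsub>fibre E r\<^esub> = 0\<rbrakk>
      \<Longrightarrow> \<eta> = \<zero>\<^bsub>fibre E r\<^esub>"
proof -
  have t: "inv s \<otimes> r \<in> P"
    using le by (simp add: left_le_def)
  \<comment> \<open>Identifies the target fibre of the multiplication with the fibre over
    \<open>r\<close>.\<close>
  have "s \<otimes> (inv s \<otimes> r) = r"
    using s r by (simp flip: m_assoc)
  then have ht: "hilbert_tensor (fibre E s) (fibre E (inv s \<otimes> r)) (fibre E r) (pmult E)"
    using pmult_unitary[OF s t] by simp
  interpret X: separable_hilbert_space "fibre E r"
    by (rule fibre_hilbert[OF r])
  show "tensor_isometry (fibre E s) (fibre E (inv s \<otimes> r)) (fibre E r) (pmult E)"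
    using ht
    by (intro tensor_isometry.intro tensor_isometry_axioms.intro fibre_hilbert s t r)
      (simp_all add: hilbert_tensor_def)
  show "\<eta> = \<zero>\<^bsub>fibre E r\<^esub>" if "\<eta> \<in> carrier (fibre E r)"
    "\<And>x y. \<lbrakk>x \<in> carrier (fibre E s); y \<in> carrier (fibre E (inv s \<otimes> r))\<rbrakk>
      \<Longrightarrow> \<langle>x \<cdot>\<^bsub>E\<^esub> y, \<eta>\<rangle>\<^bsub>fibre E r\<^esub> = 0" for \<eta>
    by (rule X.orthogonal_total[of "{x \<cdot>\<^bsub>E\<^esub> y | x y. x \<in> carrier (fibre E s) \<and> y \<in> carrier (fibre E (inv s \<otimes> r))}"])
      (use ht that in \<open>auto simp: hilbert_tensor_def\<close>)
qed

abbreviation rho_amp :: "'g \<Rightarrow> ('e \<Rightarrow> 'e) \<Rightarrow> 'h \<Rightarrow> 'h" where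
  "rho_amp t \<equiv> tensor_isometry.ampliation (fibre E t) H H \<phi>"

abbreviation fibre_amp :: "'g \<Rightarrow> 'g \<Rightarrow> ('e \<Rightarrow> 'e) \<Rightarrow> 'e \<Rightarrow> 'e" where
  "fibre_amp s r \<equiv> tensor_isometry.ampliation (fibre E s) (fibre E (inv s \<otimes> r)) (fibre E r) (pmult E)"

lemma rho_amp_rank_one:
  assumes t: "t \<in> P" and xy: "x \<in> carrier (fibre E t)" "y \<in> carrier (fibre E t)"
  shows "rho_amp t (rank_one (fibre E t) x y) = op_mult H (\<phi> x) (op_adj H (\<phi> y))"
proof -
  interpret T: tensor_isometry "fibre E t" H H \<phi>
    by (rule tensor_\<phi>[OF t])
  note b = \<phi>_bounded[OF t xy(1)] \<phi>_bounded[OF t xy(2)]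
  show ?thesis
    by (rule T.ampliation_rank_one[where p = "op_adj H (\<phi> x)" and q = "op_adj H (\<phi> y)"])
      (use b xy in \<open>simp_all add: H.cinner_op_adj[OF b(1)] H.cinner_op_adj[OF b(2)] compose_eq\<close>)
qed

text \<open>Evaluates the definite description in \<open>rho\<close>: the ampliation has the
  required properties, and \<open>normal_star_hom_unique\<close> excludes any other
  candidate.\<close>

lemma rho_eq:
  assumes t: "t \<in> P"
  shows "rho E H \<phi> t = restrict (rho_amp t) (bounded_ops (fibre E t))"
  unfolding rho_def
proof (rule the_equality)
  interpret T: tensor_isometry "fibre E t" H H \<phi>
    by (rule tensor_\<phi>[OF t])
  let ?V = "fibre E t"
  have sub: "restrict (restrict (rho_amp t) (bounded_ops ?V)) (compact_ops ?V)
      = restrict (rho_amp t) (compact_ops ?V)"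
    by (auto simp: restrict_def fun_eq_iff)
  have "is_compact_rho E H \<phi> t (restrict (rho_amp t) (compact_ops ?V))"
    unfolding is_compact_rho_def using T.star_hom_ampliation_compact rho_amp_rank_one[OF t] by auto
  then show "star_hom ?V (bounded_ops ?V) H (restrict (rho_amp t) (bounded_ops ?V)) \<and>
      continuous_map (sigma_weak ?V) (sigma_weak H) (restrict (rho_amp t) (bounded_ops ?V)) \<and>
      is_compact_rho E H \<phi> t (restrict (restrict (rho_amp t) (bounded_ops ?V)) (compact_ops ?V))"
    unfolding sub using T.star_hom_ampliation_bounded T.continuous_map_ampliation by blast
  fix \<pi> assume \<pi>: "star_hom ?V (bounded_ops ?V) H \<pi> \<and> continuous_map (sigma_weak ?V) (sigma_weak H) \<pi> \<and>
      is_compact_rho E H \<phi> t (restrict \<pi> (compact_ops ?V))"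
  show "\<pi> = restrict (rho_amp t) (bounded_ops ?V)"
  proof (rule normal_star_hom_unique[of ?V H])
    fix x y assume "x \<in> carrier ?V" "y \<in> carrier ?V"
    then show "\<pi> (rank_one ?V x y) = restrict (rho_amp t) (bounded_ops ?V) (rank_one ?V x y)"
      using \<pi> by (simp add: is_compact_rho_def rho_amp_rank_one[OF t])
  qed (use \<pi> T.star_hom_ampliation_bounded T.continuous_map_ampliation
      T.V.separable_hilbert_space_axioms H.separable_hilbert_space_axioms in auto)
qed

text \<open>Existence is \<open>ampliation_\<tau>\<close>; uniqueness uses that the products of
  fibre elements are total.\<close>

lemma amplify_eq:
  assumes s: "s \<in> P" and r: "r \<in> P" and le: "left_le G P s r" and S: "S \<in> bounded_ops (fibre E s)"
  shows "amplify G E s r S = fibre_amp s r S"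
  unfolding amplify_def
proof (rule the_equality)
  interpret T: tensor_isometry "fibre E s" "fibre E (inv s \<otimes> r)" "fibre E r" "pmult E"
    by (rule tensor_pmult[OF s r le])
  show "fibre_amp s r S \<in> bounded_ops (fibre E r) \<and>
     (\<forall>x\<in>carrier (fibre E s). \<forall>y\<in>carrier (fibre E (inv s \<otimes> r)). fibre_amp s r S (x \<cdot>\<^bsub>E\<^esub> y) = S x \<cdot>\<^bsub>E\<^esub> y)"
    using S by (simp add: T.ampliation_\<tau>)
  fix T assume "T \<in> bounded_ops (fibre E r) \<and>
     (\<forall>x\<in>carrier (fibre E s). \<forall>y\<in>carrier (fibre E (inv s \<otimes> r)). T (x \<cdot>\<^bsub>E\<^esub> y) = S x \<cdot>\<^bsub>E\<^esub> y)"
  then show "T = fibre_amp s r S"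
    by (intro T.ampliation_unique S tensor_pmult(2)[OF s r le]) auto
qed

section \<open>Calculus of the homomorphisms on different fibres\<close>

lemma rho_amp_bounded:
  assumes "t \<in> P" "S \<in> bounded_ops (fibre E t)"
  shows "rho_amp t S \<in> bounded_ops H"
  using tensor_isometry.ampliation_bounded[OF tensor_\<phi>] assms by blast

lemma fibre_amp_bounded:
  assumes "s \<in> P" "r \<in> P" "left_le G P s r" "S \<in> bounded_ops (fibre E s)"
  shows "fibre_amp s r S \<in> bounded_ops (fibre E r)"
  using tensor_isometry.ampliation_bounded[OF tensor_pmult(1)] assms by blast

lemma op_one_fibre [simp]: "t \<in> P \<Longrightarrow> op_one (fibre E t) \<in> bounded_ops (fibre E t)"
  using complex_hilbert_space.op_one_bounded fibre_hilbert separable_hilbert_space.axioms(1) by blast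

lemma fibre_amp_one:
  assumes s: "s \<in> P" and r: "r \<in> P" and le: "left_le G P s r"
  shows "fibre_amp s r (op_one (fibre E s)) = op_one (fibre E r)"
proof -
  interpret T: tensor_isometry "fibre E s" "fibre E (inv s \<otimes> r)" "fibre E r" "pmult E"
    by (rule tensor_pmult[OF s r le])
  show ?thesis
    by (rule sym, rule T.ampliation_unique[OF tensor_pmult(2)[OF s r le]])
      (simp_all, simp add: op_one_def)
qed

lemma rho_amp_mult:
  assumes "t \<in> P" "S \<in> bounded_ops (fibre E t)" "T \<in> bounded_ops (fibre E t)"
  shows "rho_amp t (op_mult (fibre E t) S T) = op_mult H (rho_amp t S) (rho_amp t T)"
  using tensor_isometry.ampliation_mult[OF tensor_\<phi>] assms by blast

lemma rho_amp_mult_one: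
  assumes "t \<in> P" "S \<in> bounded_ops (fibre E t)"
  shows "op_mult H (rho_amp t S) (rho_amp t (op_one (fibre E t))) = rho_amp t S"
    and "op_mult H (rho_amp t (op_one (fibre E t))) (rho_amp t S) = rho_amp t S"
proof -
  interpret V: separable_hilbert_space "fibre E t"
    by (rule fibre_hilbert[OF assms(1)])
  show "op_mult H (rho_amp t S) (rho_amp t (op_one (fibre E t))) = rho_amp t S"
    using rho_amp_mult[OF assms V.op_one_bounded] assms(2) by (simp add: V.op_mult_one_right)
  show "op_mult H (rho_amp t (op_one (fibre E t))) (rho_amp t S) = rho_amp t S"
    using rho_amp_mult[OF assms(1) V.op_one_bounded assms(2)] assms(2) by (simp add: V.op_mult_one_left)
qed

lemma rho_amp_adj:
  assumes "t \<in> P" "S \<in> bounded_ops (fibre E t)"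
  shows "op_adj H (rho_amp t S) = rho_amp t (op_adj (fibre E t) S)"
  using tensor_isometry.ampliation_adj[OF tensor_\<phi>] assms by simp

lemma rho_amp_\<phi>:
  assumes "t \<in> P" "S \<in> bounded_ops (fibre E t)" "x \<in> carrier (fibre E t)" "h \<in> carrier H"
  shows "rho_amp t S (\<phi> x h) = \<phi> (S x) h"
  using tensor_isometry.ampliation_\<tau>[OF tensor_\<phi>] assms by blast

text \<open>Both sides act on \<open>\<phi> (x \<cdot> y) h = \<phi> x (\<phi> y h)\<close> by applying \<open>S\<close> to \<open>x\<close>, and the products \<open>x \<cdot> y\<close>
  are total in the fibre over \<open>r\<close>.\<close>

lemma rho_amp_mult_larger:
  assumes s: "s \<in> P" and r: "r \<in> P" and le: "left_le G P s r" and S: "S \<in> bounded_ops (fibre E s)"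
  shows "op_mult H (rho_amp s S) (rho_amp r (op_one (fibre E r))) = rho_amp r (fibre_amp s r S)"
proof -
  interpret F: tensor_isometry "fibre E s" "fibre E (inv s \<otimes> r)" "fibre E r" "pmult E"
    by (rule tensor_pmult[OF s r le])
  interpret R: tensor_isometry "fibre E r" H H \<phi>
    by (rule tensor_\<phi>[OF r])
  have t: "inv s \<otimes> r \<in> P"
    using le by (simp add: left_le_def)
  let ?A = "fibre_amp s r S"
  have C: "rho_amp s S \<in> bounded_ops H"
    by (rule rho_amp_bounded[OF s S])
  have A: "?A \<in> bounded_ops (fibre E r)"
    using S by simp
  have D: "rho_amp r ?A \<in> bounded_ops H"
    using A by simp
  have "rho_amp s S (\<phi> z h) = rho_amp r ?A (\<phi> z h)" if z: "z \<in> carrier (fibre E r)" and h: "h \<in> carrier H" for z h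
  proof (rule H.cinner_ext)
    fix \<eta> assume \<eta>: "\<eta> \<in> carrier H"
    \<comment> \<open>For fixed \<open>h\<close> and \<open>\<eta>\<close> both sides are linear
      functionals of \<open>z\<close>, represented by \<open>?p\<close> and \<open>?q\<close>.
      Totality of the products in the fibre then shows that these vectors agree.\<close>
    let ?p = "R.slice h (op_adj H (rho_amp s S) \<eta>)" and ?q = "R.slice h (op_adj H (rho_amp r ?A) \<eta>)"
    have pq: "?p \<in> carrier (fibre E r)" "?q \<in> carrier (fibre E r)"
      using C D h \<eta> by auto
    have *: "\<langle>rho_amp s S (\<phi> z h), \<eta>\<rangle>\<^bsub>H\<^esub> = \<langle>z, ?p\<rangle>\<^bsub>fibre E r\<^esub>"
      "\<langle>rho_amp r ?A (\<phi> z h), \<eta>\<rangle>\<^bsub>H\<^esub> = \<langle>z, ?q\<rangle>\<^bsub>fibre E r\<^esub>" if "z \<in> carrier (fibre E r)" for z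
      using that C D h \<eta> by (simp_all add: H.cinner_op_adj[OF C] H.cinner_op_adj[OF D] R.cinner_slice)
    have "?p \<ominus>\<^bsub>fibre E r\<^esub> ?q = \<zero>\<^bsub>fibre E r\<^esub>"
    proof (rule tensor_pmult(2)[OF s r le])
      fix x y assume x: "x \<in> carrier (fibre E s)" and y: "y \<in> carrier (fibre E (inv s \<otimes> r))"
      have xy: "x \<cdot>\<^bsub>E\<^esub> y \<in> carrier (fibre E r)"
        using x y by simp
      have yh: "\<phi> y h \<in> carrier H"
        using \<phi>_bounded[OF t y] h by simp
      have "rho_amp s S (\<phi> (x \<cdot>\<^bsub>E\<^esub> y) h) = \<phi> (S x \<cdot>\<^bsub>E\<^esub> y) h"
        using S x y yh h by (simp add: \<phi>_mult[OF s t] rho_amp_\<phi>[OF s])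
      also have "\<dots> = rho_amp r ?A (\<phi> (x \<cdot>\<^bsub>E\<^esub> y) h)"
        using rho_amp_\<phi>[OF r A xy h] S x y by (simp add: F.ampliation_\<tau>)
      finally show "\<langle>x \<cdot>\<^bsub>E\<^esub> y, ?p \<ominus>\<^bsub>fibre E r\<^esub> ?q\<rangle>\<^bsub>fibre E r\<^esub> = 0"
        using *[OF xy] pq xy by (simp add: F.X.cinner_simps)
    qed (use pq in simp)
    then have "?p = ?q"
      using pq by (simp add: F.X.minus_eq_zero_iff)
    then show "\<langle>rho_amp s S (\<phi> z h), \<eta>\<rangle>\<^bsub>H\<^esub> = \<langle>rho_amp r ?A (\<phi> z h), \<eta>\<rangle>\<^bsub>H\<^esub>"
      using *[OF z] by simp
  qed (use C D z h in auto)
  \<comment> \<open>Agreement on the vectors \<open>\<phi> z h\<close> determines the operators only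
    on their closed span, hence the projection as right factor.\<close>
  then have "op_mult H (rho_amp s S) (rho_amp r (op_one (fibre E r)))
      = op_mult H (rho_amp r ?A) (rho_amp r (op_one (fibre E r)))"
    by (rule R.op_mult_ampliation_one_cong[OF C D])
  then show ?thesis
    using rho_amp_mult_one[OF r A] by simp
qed

text \<open>The adjoint of \<open>rho_amp_mult_larger\<close> for the adjoint of
  \<open>S\<close>.\<close>

lemma rho_amp_mult_larger':
  assumes s: "s \<in> P" and r: "r \<in> P" and le: "left_le G P s r" and S: "S \<in> bounded_ops (fibre E s)"
  shows "op_mult H (rho_amp r (op_one (fibre E r))) (rho_amp s S) = rho_amp r (fibre_amp s r S)"
proof -
  interpret F: tensor_isometry "fibre E s" "fibre E (inv s \<otimes> r)" "fibre E r" "pmult E"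
    by (rule tensor_pmult[OF s r le])
  note b = rho_amp_bounded[OF s S] rho_amp_bounded[OF r op_one_fibre[OF r]]
    rho_amp_bounded[OF r F.ampliation_bounded[OF S]]
  have "op_adj H (op_mult H (rho_amp r (op_one (fibre E r))) (rho_amp s S))
      = op_mult H (rho_amp s (op_adj (fibre E s) S)) (rho_amp r (op_one (fibre E r)))"
    using b S s r by (simp add: H.op_adj_mult rho_amp_adj F.X.op_adj_one)
  also have "\<dots> = rho_amp r (fibre_amp s r (op_adj (fibre E s) S))"
    using S by (simp add: rho_amp_mult_larger[OF s r le])
  also have "\<dots> = op_adj H (rho_amp r (fibre_amp s r S))"
    using S r by (simp add: rho_amp_adj F.ampliation_adj)
  finally show ?thesis
    by (rule H.op_adj_inject) (use b in auto)
qed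

text \<open>With \<open>T = rank_one x x\<close> the hypothesis says that \<open>C\<close> and \<open>D\<close> agree on \<open>\<langle>x, x\<rangle> \<phi> x h\<close>.\<close>

lemma op_mult_rho_amp_one_cong:
  assumes t: "t \<in> P" and C: "C \<in> bounded_ops H" and D: "D \<in> bounded_ops H"
    and eq: "\<And>T. T \<in> compact_ops (fibre E t) \<Longrightarrow> op_mult H C (rho_amp t T) = op_mult H D (rho_amp t T)"
  shows "op_mult H C (rho_amp t (op_one (fibre E t))) = op_mult H D (rho_amp t (op_one (fibre E t)))"
proof -
  interpret R: tensor_isometry "fibre E t" H H \<phi>
    by (rule tensor_\<phi>[OF t])
  show ?thesis
  proof (rule R.op_mult_ampliation_one_cong[OF C D])
    fix x h assume x: "x \<in> carrier (fibre E t)" and h: "h \<in> carrier H"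
    let ?c = "\<langle>x, x\<rangle>\<^bsub>fibre E t\<^esub>"
    have "rho_amp t (rank_one (fibre E t) x x) (\<phi> x h) = ?c \<odot>\<^bsub>H\<^esub> \<phi> x h"
      using x h by (simp add: R.ampliation_\<tau>, simp add: rank_one_def R.\<tau>_smult_left)
    then have "?c \<odot>\<^bsub>H\<^esub> C (\<phi> x h) = ?c \<odot>\<^bsub>H\<^esub> D (\<phi> x h)"
      using fun_cong[OF eq[OF R.V.rank_one_compact[OF x x]], of "\<phi> x h"] x h C D
      by (simp add: compose_eq H.bounded_ops_smult)
    then have *: "?c * \<langle>C (\<phi> x h), k\<rangle>\<^bsub>H\<^esub> = ?c * \<langle>D (\<phi> x h), k\<rangle>\<^bsub>H\<^esub>" if "k \<in> carrier H" for k
      using that x h C D by (metis H.cinner_smult_left H.bounded_ops_closed R.\<tau>_closed)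
    \<comment> \<open>The scalar \<open>?c\<close> cancels unless it is zero, in which case
      \<open>\<phi> x h\<close> itself vanishes.\<close>
    show "C (\<phi> x h) = D (\<phi> x h)"
    proof (cases "?c = 0")
      case True
      then have "\<phi> x h = \<zero>\<^bsub>H\<^esub>"
        using x h by (intro H.cinner_definite) (auto simp: R.cinner_\<tau>)
      then show ?thesis
        using C D by (simp add: H.bounded_ops_zero)
    next
      case False
      then show ?thesis
        using * x h C D by (intro H.cinner_ext) auto
    qed
  qed
qed

text \<open>Follows from \<open>op_mult_rho_amp_one_cong\<close> by taking adjoints, since compact
  operators are closed under adjoints.\<close>

lemma rho_amp_one_op_mult_cong:
  assumes t: "t \<in> P" and C: "C \<in> bounded_ops H" and D: "D \<in> bounded_ops H"
    and eq: "\<And>T. T \<in> compact_ops (fibre E t) \<Longrightarrow> op_mult H (rho_amp t T) C = op_mult H (rho_amp t T) D"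
  shows "op_mult H (rho_amp t (op_one (fibre E t))) C = op_mult H (rho_amp t (op_one (fibre E t))) D"
proof -
  interpret V: separable_hilbert_space "fibre E t"
    by (rule fibre_hilbert[OF t])
  have adj: "op_adj H (op_mult H (rho_amp t T) B) = op_mult H (op_adj H B) (rho_amp t (op_adj (fibre E t) T))"
    if "T \<in> bounded_ops (fibre E t)" "B \<in> bounded_ops H" for T B
    using that t by (simp add: H.op_adj_mult rho_amp_bounded rho_amp_adj)
  have "op_mult H (op_adj H C) (rho_amp t (op_one (fibre E t)))
      = op_mult H (op_adj H D) (rho_amp t (op_one (fibre E t)))"
  proof (rule op_mult_rho_amp_one_cong[OF t])
    fix T assume T: "T \<in> compact_ops (fibre E t)"
    then have "op_mult H (rho_amp t (op_adj (fibre E t) T)) C = op_mult H (rho_amp t (op_adj (fibre E t) T)) D"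
      by (intro eq) simp
    then show "op_mult H (op_adj H C) (rho_amp t T) = op_mult H (op_adj H D) (rho_amp t T)"
      using adj[of "op_adj (fibre E t) T" C] adj[of "op_adj (fibre E t) T" D] T C D
      by (simp add: V.op_adj_adj)
  qed (use C D in auto)
  then have "op_adj H (op_mult H (rho_amp t (op_one (fibre E t))) C)
      = op_adj H (op_mult H (rho_amp t (op_one (fibre E t))) D)"
    using C D by (simp add: adj V.op_adj_one)
  then show ?thesis
    by (rule H.op_adj_inject) (use C D rho_amp_bounded[OF t V.op_one_bounded] in auto)
qed

section \<open>Covariance and the product formula\<close>

definition join_proj :: "'g \<Rightarrow> 'g \<Rightarrow> 'h \<Rightarrow> 'h" where
  "join_proj s t = (case join G P s t of Some r \<Rightarrow> rho_amp r (op_one (fibre E r)) | None \<Rightarrow> op_zero H)"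

lemma join_proj_bounded: "\<lbrakk>s \<in> P; t \<in> P\<rbrakk> \<Longrightarrow> join_proj s t \<in> bounded_ops H"
  by (cases "join G P s t") (auto simp: join_proj_def rho_amp_bounded dest: join_SomeD(1))

lemma covariant_iff:
  "covariant G P E H \<phi> \<longleftrightarrow>
    (\<forall>s\<in>P. \<forall>t\<in>P. op_mult H (rho_amp s (op_one (fibre E s))) (rho_amp t (op_one (fibre E t))) = join_proj s t)"
  unfolding covariant_def
proof (intro ball_cong refl)
  fix s t assume s: "s \<in> P" and t: "t \<in> P"
  have "(case join G P s t of Some r \<Rightarrow> rho E H \<phi> r (op_one (fibre E r)) | None \<Rightarrow> op_zero H) = join_proj s t"
    using join_SomeD[OF s t] by (auto simp: join_proj_def rho_eq split: option.split)
  then show "(op_mult H (rho E H \<phi> s (op_one (fibre E s))) (rho E H \<phi> t (op_one (fibre E t))) =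
      (case join G P s t of Some r \<Rightarrow> rho E H \<phi> r (op_one (fibre E r)) | None \<Rightarrow> op_zero H))
    \<longleftrightarrow> op_mult H (rho_amp s (op_one (fibre E s))) (rho_amp t (op_one (fibre E t))) = join_proj s t"
    using s t by (simp add: rho_eq)
qed

text \<open>For a finite join the projection \<open>?Q\<close> is split as its own square; one copy
  turns \<open>rho_amp s S\<close> into the image of the amplified \<open>S\<close>, the other does
  the same for \<open>T\<close>.\<close>

lemma join_product:
  assumes s: "s \<in> P" and t: "t \<in> P"
    and S: "S \<in> bounded_ops (fibre E s)" and T: "T \<in> bounded_ops (fibre E t)"
  shows "op_mult H (rho_amp s S) (op_mult H (join_proj s t) (rho_amp t T)) =
    (case join G P s t of
       Some r \<Rightarrow> rho E H \<phi> r (op_mult (fibre E r) (amplify G E s r S) (amplify G E t r T))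
     | None \<Rightarrow> op_zero H)"
proof (cases "join G P s t")
  case None
  then show ?thesis
    using rho_amp_bounded[OF s S] rho_amp_bounded[OF t T]
    by (simp add: join_proj_def H.op_mult_zero_left H.op_mult_zero_right)
next
  case (Some r)
  note r = join_SomeD[OF s t Some]
  interpret V: separable_hilbert_space "fibre E r"
    by (rule fibre_hilbert[OF r(1)])
  note b = rho_amp_bounded[OF s S] rho_amp_bounded[OF t T] rho_amp_bounded[OF r(1) V.op_one_bounded]
  note f = fibre_amp_bounded[OF s r(1) r(2) S] fibre_amp_bounded[OF t r(1) r(3) T]
  let ?Q = "rho_amp r (op_one (fibre E r))"
  have "op_mult H (rho_amp s S) (op_mult H ?Q (rho_amp t T))
      = op_mult H (op_mult H (rho_amp s S) ?Q) (op_mult H ?Q (rho_amp t T))"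
    using b rho_amp_mult_one(1)[OF r(1) V.op_one_bounded] H.op_mult_assoc
    by (metis H.op_mult_bounded)
  also have "\<dots> = rho_amp r (op_mult (fibre E r) (fibre_amp s r S) (fibre_amp t r T))"
    using f by (simp add: rho_amp_mult_larger[OF s r(1,2) S] rho_amp_mult_larger'[OF t r(1,3) T]
        rho_amp_mult[OF r(1)])
  finally show ?thesis
    using f Some r by (simp add: join_proj_def rho_eq amplify_eq s t S T)
qed

text \<open>The case of identity operators in \<open>join_product\<close>, whose amplifications are
  again identities.\<close>

lemma join_proj_absorb:
  assumes s: "s \<in> P" and t: "t \<in> P"
  shows "op_mult H (rho_amp s (op_one (fibre E s))) (op_mult H (join_proj s t) (rho_amp t (op_one (fibre E t))))
    = join_proj s t"
proof (cases "join G P s t")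
  case None
  then show ?thesis
    using join_product[OF s t op_one_fibre[OF s] op_one_fibre[OF t]] by (simp add: join_proj_def)
next
  case (Some r)
  note r = join_SomeD[OF s t Some]
  interpret V: separable_hilbert_space "fibre E r"
    by (rule fibre_hilbert[OF r(1)])
  show ?thesis
    using join_product[OF s t op_one_fibre[OF s] op_one_fibre[OF t]] Some r s t
    by (simp add: amplify_eq fibre_amp_one rho_eq V.op_mult_one_left)
      (simp add: join_proj_def)
qed

text \<open>The equivalence holds for each pair \<open>s\<close>, \<open>t\<close> separately. The
  identity of an infinite-dimensional fibre is not compact, so the converse cannot just insert it
  and relies on the two cancellation lemmas.\<close>

lemma covariant_iff_compact:
  "covariant G P E H \<phi> \<longleftrightarrow>
    (\<forall>s\<in>P. \<forall>t\<in>P. \<forall>S\<in>compact_ops (fibre E s). \<forall>T\<in>compact_ops (fibre E t).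
       op_mult H (rho E H \<phi> s S) (rho E H \<phi> t T) =
         (case join G P s t of
            Some r \<Rightarrow> rho E H \<phi> r (op_mult (fibre E r) (amplify G E s r S) (amplify G E t r T))
          | None \<Rightarrow> op_zero H))"
  (is "_ \<longleftrightarrow> (\<forall>s\<in>P. \<forall>t\<in>P. \<forall>S\<in>?K s. \<forall>T\<in>?K t. ?eq s t S T)")
proof -
  have K: "S \<in> bounded_ops (fibre E s)" if "S \<in> ?K s" for S s
    using that by (simp add: compact_ops_def)
  have eq: "?eq s t S T \<longleftrightarrow> op_mult H (rho_amp s S) (rho_amp t T)
      = op_mult H (rho_amp s S) (op_mult H (join_proj s t) (rho_amp t T))"
    if "s \<in> P" "t \<in> P" "S \<in> ?K s" "T \<in> ?K t" for s t S T
    using that K by (simp add: rho_eq join_product)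
  have "op_mult H (rho_amp s (op_one (fibre E s))) (rho_amp t (op_one (fibre E t))) = join_proj s t
    \<longleftrightarrow> (\<forall>S\<in>?K s. \<forall>T\<in>?K t. ?eq s t S T)" if s: "s \<in> P" and t: "t \<in> P" for s t
  proof
    let ?p = "\<lambda>s. rho_amp s (op_one (fibre E s))"
    note b = rho_amp_bounded[OF s op_one_fibre[OF s]] rho_amp_bounded[OF t op_one_fibre[OF t]]
      join_proj_bounded[OF s t]
    {
      assume cov: "op_mult H (?p s) (?p t) = join_proj s t"
      show "\<forall>S\<in>?K s. \<forall>T\<in>?K t. ?eq s t S T"
      proof (intro ballI)
        fix S T assume S: "S \<in> ?K s" and T: "T \<in> ?K t"
        note b' = rho_amp_bounded[OF s K[OF S]] rho_amp_bounded[OF t K[OF T]]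
        \<comment> \<open>Each factor absorbs the projection of its own fibre, so
          \<open>?p s\<close> and \<open>?p t\<close> can be placed side by side in the
          middle.\<close>
        have "op_mult H (rho_amp s S) (rho_amp t T)
            = op_mult H (op_mult H (rho_amp s S) (?p s)) (op_mult H (?p t) (rho_amp t T))"
          using rho_amp_mult_one[OF s K[OF S]] rho_amp_mult_one[OF t K[OF T]] by simp
        also have "\<dots> = op_mult H (rho_amp s S) (op_mult H (op_mult H (?p s) (?p t)) (rho_amp t T))"
          using b b' by (simp add: H.op_mult_assoc)
        finally show "?eq s t S T"
          using eq[OF s t S T] cov by simp
      qed
    next
      assume all: "\<forall>S\<in>?K s. \<forall>T\<in>?K t. ?eq s t S T"
      \<comment> \<open>First \<open>S\<close> varies with \<open>T\<close> fixed, which puts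
        \<open>?p s\<close> on the left; then \<open>T\<close> varies, which puts
        \<open>?p t\<close> on the right.\<close>
      have "op_mult H (?p s) (rho_amp t T) = op_mult H (?p s) (op_mult H (join_proj s t) (rho_amp t T))"
        if T: "T \<in> ?K t" for T
        by (rule rho_amp_one_op_mult_cong[OF s])
          (use all eq[OF s t _ T] T b rho_amp_bounded[OF t K[OF T]] in auto)
      then have "op_mult H (?p s) (?p t) = op_mult H (op_mult H (?p s) (join_proj s t)) (?p t)"
        by (intro op_mult_rho_amp_one_cong[OF t]) (use b t K in \<open>auto simp: H.op_mult_assoc rho_amp_bounded\<close>)
      then show "op_mult H (?p s) (?p t) = join_proj s t"
        using join_proj_absorb[OF s t] b by (simp add: H.op_mult_assoc)
    }
  qed
  then show ?thesis
    unfolding covariant_iff by blast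
qed

end

theorem proposition1p4:
  fixes G :: "'g monoid" and P :: "'g set"
    and E :: "('g, 'e) prod_system"
    and H :: "'h inner_module"
    and \<phi> :: "'e \<Rightarrow> 'h \<Rightarrow> 'h"
  assumes "quasi_lattice_ordered G P"
    and "countable P"
    and "product_system G P E"
    and "separable_hilbert_space H"
    and "representation E H \<phi>"
  shows "covariant G P E H \<phi> \<longleftrightarrow>
    (\<forall>s\<in>P. \<forall>t\<in>P. \<forall>S\<in>compact_ops (fibre E s). \<forall>T\<in>compact_ops (fibre E t).
       op_mult H (rho E H \<phi> s S) (rho E H \<phi> t T) =
         (case join G P s t of
            Some r \<Rightarrow> rho E H \<phi> r (op_mult (fibre E r) (amplify G E s r S) (amplify G E t r T))
          | None \<Rightarrow> op_zero H))"
proof -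
  interpret product_system_representation G P E H \<phi>
    using assms by (intro product_system_representation.intro product_system_representation_axioms.intro)
  show ?thesis
    by (rule covariant_iff_compact)
qed

end
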